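(* Let $(\mathcal{X},\mathrm{dist})$ be a metric space, $P=P_1\cup\cdots\cup P_m$ a finite colored point set, and $k_1,\ldots,k_m$ positive integers with $|P_\ell|\ge k_\ell$ and $k=\sum_\ell k_\ell$. There exists an algorithm running in time $O(k^k\cdot\mathrm{poly}(m,k))$ that outputs $T_\ell\subseteq P_\ell$ with $|T_\ell|=k_\ell$ for all $\ell$ such that $\mathrm{div}(\bigcup_\ell T_\ell)\ge \frac{1}{C\,m\log k}\mathrm{div}_{k_1,\ldots,k_m}(P)$ for an absolute constant $C$, i.e., an $O(m\log k)$-approximation for fair diversity maximization under the sum-of-nearest-neighbor-distances measure.
   Context: Sum-of-nearest-neighbor diversity: $\mathrm{div}(S)=\sum_{p\in S}\min_{q\in S\setminus\{p\}}\mathrm{dist}(p,q)$. Fair diversity maximization: $\mathrm{div}_{k_1,\ldots,k_m}(P)=\max\{\mathrm{div}(\bigcup_\ell T_\ell):T_\ell\subseteq P_\ell,\ |T_\ell|=k_\ell\}$.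
   Formalization: The running time proved is O((n + k^k)·poly(m,k)) with n = |P|, since no bounded ratio is possible without scanning the input; it equals the stated bound when n ≤ k^k·poly(m,k). For k = 1, where log k = 0, the ratio bound is read as 0. *)

theory Defs
  imports "HOL-Analysis.Analysis"
begin

section \<open>Fair diversity maximization\<close>

text \<open>
  A one-point set has no nearest neighbours; its diversity is fixed to be 0. (This only concerns
  \<open>k = 1\<close>, where \<open>log k = 0\<close>.)
\<close>

definition sum_nn_div :: "('a \<Rightarrow> 'a \<Rightarrow> real) \<Rightarrow> 'a set \<Rightarrow> real" where
  "sum_nn_div d S =
     (\<Sum>p\<in>S. if S - {p} = {} then 0 else Min ((\<lambda>q. d p q) ` (S - {p})))"

text \<open>The colours are \<open>0, ..., m - 1\<close>; \<open>\<kappa> l\<close> points of colour \<open>l\<close> have to be selected.\<close>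

definition fair_selection ::
    "nat \<Rightarrow> (nat \<Rightarrow> 'a set) \<Rightarrow> (nat \<Rightarrow> nat) \<Rightarrow> (nat \<Rightarrow> 'a set) \<Rightarrow> bool" where
  "fair_selection m P \<kappa> T \<longleftrightarrow> (\<forall>l<m. T l \<subseteq> P l \<and> card (T l) = \<kappa> l)"

definition fair_div_opt ::
    "('a \<Rightarrow> 'a \<Rightarrow> real) \<Rightarrow> nat \<Rightarrow> (nat \<Rightarrow> 'a set) \<Rightarrow> (nat \<Rightarrow> nat) \<Rightarrow> real" where
  "fair_div_opt d m P \<kappa> = Max {sum_nn_div d (\<Union>l<m. T l) | T. fair_selection m P \<kappa> T}"

definition fair_instance ::
    "'a set \<Rightarrow> ('a \<Rightarrow> 'a \<Rightarrow> real) \<Rightarrow> nat \<Rightarrow> (nat \<Rightarrow> 'a set) \<Rightarrow> (nat \<Rightarrow> nat) \<Rightarrow> bool" where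
  "fair_instance X d m P \<kappa> \<longleftrightarrow>
     Metric_space X d \<and> 0 < m \<and>
     (\<forall>l<m. P l \<subseteq> X \<and> finite (P l)) \<and> disjoint_family_on P {..<m} \<and>
     (\<forall>l<m. 0 < \<kappa> l \<and> \<kappa> l \<le> card (P l))"


section \<open>Machine model\<close>

text \<open>
  Programs of a structured unit-cost random access machine with distance queries. A store has
  arrays of naturals and arrays of reals. A program mentions finitely many arrays (by constant
  identifiers), and each of them is indexed by all naturals, with indices computed at run time.
  Naturals only admit addition and truncated subtraction, reals only addition, subtraction and
  comparison, and the only real constant is 0: unit-cost multiplication or arbitrary real
  constants would make the model unrealistically powerful. Every operation, memory access and
  distance query costs one time unit.
\<close>

datatype nexp =
    NConst nat
  | NGet nat nexp
  | NAdd nexp nexp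
  | NSub nexp nexp

datatype rexp =
    RZero
  | RGet nat nexp
  | RDist nexp nexp
  | RAdd rexp rexp
  | RSub rexp rexp

datatype cond =
    NLess nexp nexp
  | RLess rexp rexp
  | CNot cond
  | CAnd cond cond

datatype prog =
    PSkip
  | NSet nat nexp nexp
  | RSet nat nexp rexp
  | PSeq prog prog
  | PIf cond prog prog
  | PWhile cond prog

type_synonym store = "(nat \<Rightarrow> nat \<Rightarrow> nat) \<times> (nat \<Rightarrow> nat \<Rightarrow> real)"

primrec nval :: "store \<Rightarrow> nexp \<Rightarrow> nat" where
  "nval s (NConst c) = c"
| "nval s (NGet a e) = fst s a (nval s e)"
| "nval s (NAdd e f) = nval s e + nval s f"
| "nval s (NSub e f) = nval s e - nval s f"

primrec rval :: "(nat \<Rightarrow> nat \<Rightarrow> real) \<Rightarrow> store \<Rightarrow> rexp \<Rightarrow> real" where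
  "rval \<delta> s RZero = 0"
| "rval \<delta> s (RGet a e) = snd s a (nval s e)"
| "rval \<delta> s (RDist e f) = \<delta> (nval s e) (nval s f)"
| "rval \<delta> s (RAdd e f) = rval \<delta> s e + rval \<delta> s f"
| "rval \<delta> s (RSub e f) = rval \<delta> s e - rval \<delta> s f"

primrec cval :: "(nat \<Rightarrow> nat \<Rightarrow> real) \<Rightarrow> store \<Rightarrow> cond \<Rightarrow> bool" where
  "cval \<delta> s (NLess e f) \<longleftrightarrow> nval s e < nval s f"
| "cval \<delta> s (RLess e f) \<longleftrightarrow> rval \<delta> s e < rval \<delta> s f"
| "cval \<delta> s (CNot b) \<longleftrightarrow> \<not> cval \<delta> s b"
| "cval \<delta> s (CAnd b c) \<longleftrightarrow> cval \<delta> s b \<and> cval \<delta> s c"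

primrec ncost :: "nexp \<Rightarrow> nat" where
  "ncost (NConst c) = 1"
| "ncost (NGet a e) = ncost e + 1"
| "ncost (NAdd e f) = ncost e + ncost f + 1"
| "ncost (NSub e f) = ncost e + ncost f + 1"

primrec rcost :: "rexp \<Rightarrow> nat" where
  "rcost RZero = 1"
| "rcost (RGet a e) = ncost e + 1"
| "rcost (RDist e f) = ncost e + ncost f + 1"
| "rcost (RAdd e f) = rcost e + rcost f + 1"
| "rcost (RSub e f) = rcost e + rcost f + 1"

primrec ccost :: "cond \<Rightarrow> nat" where
  "ccost (NLess e f) = ncost e + ncost f + 1"
| "ccost (RLess e f) = rcost e + rcost f + 1"
| "ccost (CNot b) = ccost b + 1"
| "ccost (CAnd b c) = ccost b + ccost c + 1"

text \<open>
  \<open>exec \<delta> p s t s'\<close>: with \<open>\<delta>\<close> answering distance queries, program \<open>p\<close> started in store \<open>s\<close> halts after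
  exactly \<open>t\<close> time units in store \<open>s'\<close>.
\<close>

inductive exec :: "(nat \<Rightarrow> nat \<Rightarrow> real) \<Rightarrow> prog \<Rightarrow> store \<Rightarrow> nat \<Rightarrow> store \<Rightarrow> bool"
  for \<delta> :: "nat \<Rightarrow> nat \<Rightarrow> real" where
  exec_Skip: "exec \<delta> PSkip s 1 s"
| exec_NSet: "exec \<delta> (NSet a i e) s (ncost i + ncost e + 1)
    ((fst s)(a := (fst s a)(nval s i := nval s e)), snd s)"
| exec_RSet: "exec \<delta> (RSet a i e) s (ncost i + rcost e + 1)
    (fst s, (snd s)(a := (snd s a)(nval s i := rval \<delta> s e)))"
| exec_Seq: "exec \<delta> p s t s' \<Longrightarrow> exec \<delta> q s' u s'' \<Longrightarrow> exec \<delta> (PSeq p q) s (t + u) s''"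
| exec_IfTrue: "cval \<delta> s b \<Longrightarrow> exec \<delta> p s t s' \<Longrightarrow> exec \<delta> (PIf b p q) s (ccost b + t + 1) s'"
| exec_IfFalse: "\<not> cval \<delta> s b \<Longrightarrow> exec \<delta> q s t s' \<Longrightarrow> exec \<delta> (PIf b p q) s (ccost b + t + 1) s'"
| exec_WhileFalse: "\<not> cval \<delta> s b \<Longrightarrow> exec \<delta> (PWhile b p) s (ccost b + 1) s"
| exec_WhileTrue: "cval \<delta> s b \<Longrightarrow> exec \<delta> p s t s' \<Longrightarrow> exec \<delta> (PWhile b p) s' u s'' \<Longrightarrow>
    exec \<delta> (PWhile b p) s (ccost b + t + u + 1) s''"

inductive_cases exec_SkipE: "exec \<delta> PSkip s t s'"
  and exec_NSetE: "exec \<delta> (NSet a i e) s t s'"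
  and exec_RSetE: "exec \<delta> (RSet a i e) s t s'"
  and exec_SeqE: "exec \<delta> (PSeq p q) s t s'"
  and exec_IfE: "exec \<delta> (PIf b p q) s t s'"
  and exec_WhileE: "exec \<delta> (PWhile b p) s t s'"

lemma exec_deterministic:
  "exec \<delta> p s t s' \<Longrightarrow> exec \<delta> p s u s'' \<Longrightarrow> t = u \<and> s' = s''"
proof (induction arbitrary: u s'' rule: exec.induct)
  case (exec_Seq p s t s1 q t2 s2)
  from exec_Seq.prems obtain v v' r where
    "exec \<delta> p s v r" "exec \<delta> q r v' s''" "u = v + v'" by (rule exec_SeqE) simp
  with exec_Seq.IH(1)[of v r] exec_Seq.IH(2)[of v' s''] show ?case by simp
next
  case (exec_IfTrue s b p t s1 q)
  from exec_IfTrue.prems exec_IfTrue.hyps obtain v where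
    "exec \<delta> p s v s''" "u = ccost b + v + 1" by (cases rule: exec_IfE) auto
  with exec_IfTrue.IH[of v s''] show ?case by simp
next
  case (exec_IfFalse s b q t s1 p)
  from exec_IfFalse.prems exec_IfFalse.hyps obtain v where
    "exec \<delta> q s v s''" "u = ccost b + v + 1" by (cases rule: exec_IfE) auto
  with exec_IfFalse.IH[of v s''] show ?case by simp
next
  case (exec_WhileFalse s b p)
  from exec_WhileFalse.prems exec_WhileFalse.hyps show ?case by (cases rule: exec_WhileE) auto
next
  case (exec_WhileTrue s b p t s1 t2 s2)
  from exec_WhileTrue.prems exec_WhileTrue.hyps obtain v v' r where
    "exec \<delta> p s v r" "exec \<delta> (PWhile b p) r v' s''" "u = ccost b + v + v' + 1"
    by (cases rule: exec_WhileE) auto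
  with exec_WhileTrue.IH(1)[of v r] exec_WhileTrue.IH(2)[of v' s''] show ?case by simp
qed (elim exec_SkipE exec_NSetE exec_RSetE; simp)+


section \<open>Fair diversity maximization as a computational problem\<close>

text \<open>
  The \<open>n\<close> input points are presented in an arbitrary order \<open>x 0, ..., x (n - 1)\<close>, and \<open>c i\<close> is the
  colour of \<open>x i\<close>. A program only sees the indices, the colours and, by queries, the distances.
\<close>

definition presents ::
    "nat \<Rightarrow> (nat \<Rightarrow> 'a set) \<Rightarrow> nat \<Rightarrow> (nat \<Rightarrow> 'a) \<Rightarrow> (nat \<Rightarrow> nat) \<Rightarrow> bool" where
  "presents m P n x c \<longleftrightarrow>
     bij_betw x {..<n} (\<Union>l<m. P l) \<and> (\<forall>i<n. c i < m \<and> x i \<in> P (c i))"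

definition dist_oracle :: "('a \<Rightarrow> 'a \<Rightarrow> real) \<Rightarrow> nat \<Rightarrow> (nat \<Rightarrow> 'a) \<Rightarrow> nat \<Rightarrow> nat \<Rightarrow> real" where
  "dist_oracle d n x i j = (if i < n \<and> j < n then d (x i) (x j) else 0)"

text \<open>
  Input format: array 0 holds \<open>n\<close> and \<open>m\<close>, array 1 the numbers \<open>\<kappa> l\<close>, array 2 the colours; all other
  cells are 0.
\<close>

definition input_store :: "nat \<Rightarrow> nat \<Rightarrow> (nat \<Rightarrow> nat) \<Rightarrow> (nat \<Rightarrow> nat) \<Rightarrow> store" where
  "input_store n m \<kappa> c =
     (\<lambda>a i. if a = 0 \<and> i = 0 then n
            else if a = 0 \<and> i = 1 then m
            else if a = 1 \<and> i < m then \<kappa> i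
            else if a = 2 \<and> i < n then c i
            else 0,
      \<lambda>a i. 0)"

text \<open>
  Output format: the first \<open>k\<close> cells of arrays 3 and 4 hold a list of \<open>k\<close> pairs (point index, colour);
  \<open>output_sel k n x s l\<close> is the set of points listed with colour \<open>l\<close>.
\<close>

definition output_sel :: "nat \<Rightarrow> nat \<Rightarrow> (nat \<Rightarrow> 'a) \<Rightarrow> store \<Rightarrow> nat \<Rightarrow> 'a set" where
  "output_sel k n x s l = {x (fst s 3 q) | q. q < k \<and> fst s 3 q < n \<and> fst s 4 q = l}"

text \<open>
  \<open>p\<close> is an approximation algorithm for fair diversity maximization on all metric spaces with
  points in \<open>'a\<close>, with approximation ratio \<open>C * m * log k\<close> and running time
  \<open>O((n + k ^ k) * poly(m, k))\<close>. The summand \<open>n\<close> is the number of input points: it accounts for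
  scanning the input, without which no bounded approximation ratio is possible. Whenever
  \<open>n \<le> k ^ k * poly(m, k)\<close>, the bound is \<open>O(k ^ k * poly(m, k))\<close>.
\<close>

definition fair_div_approx_alg :: "'a itself \<Rightarrow> prog \<Rightarrow> real \<Rightarrow> nat \<Rightarrow> nat \<Rightarrow> bool" where
  "fair_div_approx_alg _ p C A e \<longleftrightarrow>
     (\<forall>(X :: 'a set) d m P \<kappa> n x c k.
        fair_instance X d m P \<kappa> \<longrightarrow> presents m P n x c \<longrightarrow> k = (\<Sum>l<m. \<kappa> l) \<longrightarrow>
        (\<exists>t s T. exec (dist_oracle d n x) p (input_store n m \<kappa> c) t s \<and>
           t \<le> A * (n + k ^ k) * (m + k) ^ e \<and>
           T = output_sel k n x s \<and>
           fair_selection m P \<kappa> T \<and>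
           sum_nn_div d (\<Union>l<m. T l) \<ge> 1 / (C * real m * ln (real k)) * fair_div_opt d m P \<kappa>))"

text \<open>
  The program and the constants must not depend on the metric space, but HOL has no quantification
  over types below an existential quantifier. This is harmless: a program that works for all metric
  spaces on sets of naturals works, with the same constants, for metric spaces over every type.
\<close>

lemma sum_nn_div_image:
  assumes "inj_on f S"
  shows "sum_nn_div d (f ` S) = sum_nn_div (\<lambda>i j. d (f i) (f j)) S"
proof -
  have eq: "f ` S - {f p} = f ` (S - {p})" if "p \<in> S" for p
    using assms that by (auto simp: inj_on_def)
  have emp: "f ` S - {f p} = {} \<longleftrightarrow> S - {p} = {}" if "p \<in> S" for p
    unfolding eq[OF that] by (rule image_is_empty)
  have "sum_nn_div d (f ` S) =
      (\<Sum>p\<in>S. if f ` S - {f p} = {} then 0 else Min ((\<lambda>q. d (f p) q) ` (f ` S - {f p})))"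
    unfolding sum_nn_div_def by (subst sum.reindex[OF assms]) (simp only: o_def)
  also have "\<dots> = sum_nn_div (\<lambda>i j. d (f i) (f j)) S"
    unfolding sum_nn_div_def
    by (rule sum.cong[OF refl]) (simp only: emp, simp only: eq image_image)
  finally show ?thesis .
qed

lemma fair_div_approx_alg_transfer:
  assumes alg: "fair_div_approx_alg TYPE(nat) p C A e"
  shows "fair_div_approx_alg TYPE('a) p C A e"
  unfolding fair_div_approx_alg_def
proof (intro allI impI)
  fix X :: "'a set" and d m P \<kappa> n x c k
  assume inst: "fair_instance X d m P \<kappa>" and pres: "presents m P n x c"
    and k: "k = (\<Sum>l<m. \<kappa> l)"
  define d' where "d' = (\<lambda>i j. d (x i) (x j))"
  define P' where "P' = (\<lambda>l. {i. i < n \<and> x i \<in> P l})"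
  from inst interpret Metric_space X d by (simp add: fair_instance_def)
  have bij: "bij_betw x {..<n} (\<Union>l<m. P l)" and col: "\<And>i. i < n \<Longrightarrow> c i < m \<and> x i \<in> P (c i)"
    using pres by (auto simp: presents_def)
  have inj: "inj_on x {..<n}" and img: "x ` {..<n} = (\<Union>l<m. P l)"
    using bij by (auto simp: bij_betw_def)
  have sub: "\<And>l. l < m \<Longrightarrow> P l \<subseteq> X" using inst by (auto simp: fair_instance_def)
  have inX: "x i \<in> X" if "i < n" for i using col[OF that] sub by blast
  have imgP: "x ` P' l = P l" if "l < m" for l
  proof -
    have "P l \<subseteq> x ` {..<n}" using img that by blast
    then show ?thesis unfolding P'_def by blast
  qed
  have P'n: "P' l \<subseteq> {..<n}" for l by (auto simp: P'_def)
  have cardx: "card (x ` S) = card S" if "S \<subseteq> {..<n}" for S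
    using inj that by (meson card_image inj_on_subset)
  have ms: "Metric_space {..<n} d'"
    unfolding d'_def
  proof
    fix i j l
    show "0 \<le> d (x i) (x j)" "d (x i) (x j) = d (x j) (x i)" by (auto simp: commute)
    show "d (x i) (x j) = 0 \<longleftrightarrow> i = j" if "i \<in> {..<n}" "j \<in> {..<n}"
      using that inX inj by (auto simp: inj_on_def)
    show "d (x i) (x l) \<le> d (x i) (x j) + d (x j) (x l)"
      if "i \<in> {..<n}" "j \<in> {..<n}" "l \<in> {..<n}"
      using that inX by (simp add: triangle)
  qed
  have inst': "fair_instance {..<n} d' m P' \<kappa>"
  proof -
    have "disjoint_family_on P' {..<m}"
      using inst unfolding fair_instance_def disjoint_family_on_def P'_def by blast
    moreover have "card (P' l) = card (P l)" if "l < m" for l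
      using cardx[OF P'n, of l] imgP[OF that] by simp
    moreover have "finite (P' l)" for l using P'n finite_subset by blast
    ultimately show ?thesis using inst ms P'n by (simp add: fair_instance_def)
  qed
  have pres': "presents m P' n (\<lambda>i. i) c"
  proof -
    have "(\<Union>l<m. P' l) = {..<n}" using col by (auto simp: P'_def)
    then show ?thesis using col by (auto simp: presents_def P'_def bij_betw_def)
  qed
  have dist_eq: "dist_oracle d' n (\<lambda>i. i) = dist_oracle d n x"
    by (auto simp: dist_oracle_def d'_def fun_eq_iff)
  have sel: "fair_selection m P \<kappa> (\<lambda>l. x ` T l)" if "fair_selection m P' \<kappa> T" for T
    unfolding fair_selection_def
  proof (intro allI impI conjI)
    fix l assume l: "l < m"
    have Tl: "T l \<subseteq> P' l" "card (T l) = \<kappa> l"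
      using that l by (auto simp: fair_selection_def)
    show "x ` T l \<subseteq> P l" using image_mono[OF Tl(1), of x] unfolding imgP[OF l] .
    show "card (x ` T l) = \<kappa> l" using cardx[OF order_trans[OF Tl(1) P'n]] Tl(2) by simp
  qed
  have div: "sum_nn_div d (\<Union>l<m. x ` T l) = sum_nn_div d' (\<Union>l<m. T l)"
    if "fair_selection m P' \<kappa> T" for T
  proof -
    have "(\<Union>l<m. T l) \<subseteq> {..<n}" using that P'n by (fastforce simp: fair_selection_def)
    then have "inj_on x (\<Union>l<m. T l)" using inj inj_on_subset by blast
    from sum_nn_div_image[OF this, of d] show ?thesis by (simp add: d'_def image_UN)
  qed
  have pull: "\<exists>T'. fair_selection m P' \<kappa> T' \<and> (\<forall>l<m. T l = x ` T' l)"
    if T: "fair_selection m P \<kappa> T" for T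
  proof -
    define T' where "T' = (\<lambda>l. {i \<in> P' l. x i \<in> T l})"
    have im: "x ` T' l = T l" if "l < m" for l
    proof -
      have "T l \<subseteq> x ` P' l" using T that imgP by (auto simp: fair_selection_def)
      then show ?thesis by (auto simp: T'_def)
    qed
    moreover have "card (T' l) = \<kappa> l" if "l < m" for l
    proof -
      have "T' l \<subseteq> {..<n}" using P'n by (auto simp: T'_def)
      from cardx[OF this] have "card (T' l) = card (T l)" unfolding im[OF that] ..
      then show ?thesis using T that by (simp add: fair_selection_def)
    qed
    ultimately show ?thesis unfolding fair_selection_def by (intro exI[of _ T']) (auto simp: T'_def)
  qed
  have "{sum_nn_div d (\<Union>l<m. T l) | T. fair_selection m P \<kappa> T}
      = {sum_nn_div d' (\<Union>l<m. T l) | T. fair_selection m P' \<kappa> T}" (is "?L = ?R")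
  proof
    show "?L \<subseteq> ?R"
    proof
      fix v assume "v \<in> ?L"
      then obtain T where v: "v = sum_nn_div d (\<Union>l<m. T l)" and T: "fair_selection m P \<kappa> T"
        by blast
      from pull[OF T] obtain T' where T': "fair_selection m P' \<kappa> T'" "\<forall>l<m. T l = x ` T' l"
        by blast
      from T'(2) have "(\<Union>l<m. T l) = (\<Union>l<m. x ` T' l)" by simp
      with v div[OF T'(1)] have "v = sum_nn_div d' (\<Union>l<m. T' l)" by simp
      with T'(1) show "v \<in> ?R" by blast
    qed
    show "?R \<subseteq> ?L"
    proof
      fix v assume "v \<in> ?R"
      then obtain T where v: "v = sum_nn_div d' (\<Union>l<m. T l)" and T: "fair_selection m P' \<kappa> T"
        by blast
      show "v \<in> ?L" unfolding v div[OF T, symmetric] using sel[OF T] by blast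
    qed
  qed
  then have opt: "fair_div_opt d m P \<kappa> = fair_div_opt d' m P' \<kappa>"
    by (simp add: fair_div_opt_def)
  obtain t s T where run: "exec (dist_oracle d n x) p (input_store n m \<kappa> c) t s"
      "t \<le> A * (n + k ^ k) * (m + k) ^ e"
    and T: "T = output_sel k n (\<lambda>i. i) s" "fair_selection m P' \<kappa> T"
      "sum_nn_div d' (\<Union>l<m. T l) \<ge> 1 / (C * real m * ln (real k)) * fair_div_opt d' m P' \<kappa>"
    using alg[unfolded fair_div_approx_alg_def, rule_format, OF inst' pres' k]
    unfolding dist_eq by blast
  have out: "output_sel k n x s = (\<lambda>l. x ` T l)"
    by (auto simp: T(1) output_sel_def fun_eq_iff)
  show "\<exists>t s T. exec (dist_oracle d n x) p (input_store n m \<kappa> c) t s \<and>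
           t \<le> A * (n + k ^ k) * (m + k) ^ e \<and>
           T = output_sel k n x s \<and>
           fair_selection m P \<kappa> T \<and>
           sum_nn_div d (\<Union>l<m. T l) \<ge> 1 / (C * real m * ln (real k)) * fair_div_opt d m P \<kappa>"
    using run sel[OF T(2)] T(3) out unfolding opt div[OF T(2), symmetric]
    by (intro exI[of _ t] exI[of _ s] exI[of _ "\<lambda>l. x ` T l"] conjI) simp_all
qed

end

theory Submission
  imports Defs
begin

text \<open>
  Let \<open>v p\<close> be the nearest-neighbour distance of \<open>p\<close> in an optimal selection. Some colour \<open>l\<close> carries a
  \<open>1/m\<close> fraction of the optimum, and since the harmonic sum is \<open>O(log k)\<close> there is a scale \<open>r\<close> such that
  the set \<open>S\<close> of the optimal points of colour \<open>l\<close> with \<open>v p \<ge> r\<close> satisfies \<open>|S| r \<ge> OPT / O(m log k)\<close>. It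
  suffices to find \<open>|S|\<close> points of colour \<open>l\<close> with distance \<open>\<Omega>(r)\<close> to all other selected points.

  A farthest-first traversal with \<open>2k\<close> centres contains, for every scale \<open>\<rho>\<close>, a \<open>\<rho>\<close>-separated prefix that
  either is a \<open>\<rho>\<close>-net of the colour class or has \<open>2k\<close> points. In the first case the points of \<open>S\<close> can be
  moved to nearby centres; in the second case the balls around at least \<open>k\<close> of the centres contain no
  optimal point, and any of these can replace \<open>S\<close>. So one of the \<open>4^k\<close> sets \<open>Z\<close> of centres of colour \<open>l\<close> is a
  good replacement. Given \<open>Z\<close>, completing it by the points farthest from \<open>Z\<close> is best possible. By the
  same dichotomy these points may be taken from a coreset that consists of the centres of every colour
  and up to \<open>k\<close> points of each of their cells, so that only the construction of the coreset depends on \<open>n\<close>.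
\<close>

section \<open>Total correctness with time bounds\<close>

text \<open>The program knows neither the colour \<open>l\<close> nor the scale \<open>r\<close>,
  both of which come from an unknown optimum. Hence one net has to serve all scales at once, every
  pair of a colour and a set of its centres is tried, and the candidate with the largest computed
  diversity is kept.

  The lower bound counts the points of \<open>Z\<close> only; the other selected points may be close
  to each other. So the completion merely has to stay away from \<open>Z\<close>, and each colour
  can be completed on its own: exchanging \<open>S\<close> for \<open>Z\<close> leaves as many
  positions per colour as the optimum fills outside \<open>S\<close>, and those optimal points are
  far from \<open>Z\<close>.

  The number \<open>2k\<close> of centres stems from the fact that each of at most \<open>k\<close>
  points to be avoided is close to at most one point of a separated set. The ratio
  \<open>96 m ln k\<close> is composed of \<open>m\<close> for the colour, \<open>3 ln k\<close> for
  the harmonic sum and 32 for distances: a factor 4 for the step from \<open>S\<close> to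
  \<open>Z\<close> and a factor 8 for the step to the coreset.\<close>

definition runs :: "(nat \<Rightarrow> nat \<Rightarrow> real) \<Rightarrow> prog \<Rightarrow> store \<Rightarrow> nat \<Rightarrow> (store \<Rightarrow> bool) \<Rightarrow> bool" where
  "runs \<delta> p s B Q \<longleftrightarrow> (\<exists>t s'. exec \<delta> p s t s' \<and> t \<le> B \<and> Q s')"

primrec nmods :: "prog \<Rightarrow> nat set" where
  "nmods PSkip = {}"
| "nmods (NSet a i e) = {a}"
| "nmods (RSet a i e) = {}"
| "nmods (PSeq p q) = nmods p \<union> nmods q"
| "nmods (PIf b p q) = nmods p \<union> nmods q"
| "nmods (PWhile b p) = nmods p"

primrec rmods :: "prog \<Rightarrow> nat set" where
  "rmods PSkip = {}"
| "rmods (NSet a i e) = {}"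
| "rmods (RSet a i e) = {a}"
| "rmods (PSeq p q) = rmods p \<union> rmods q"
| "rmods (PIf b p q) = rmods p \<union> rmods q"
| "rmods (PWhile b p) = rmods p"

definition same :: "nat set \<Rightarrow> nat set \<Rightarrow> store \<Rightarrow> store \<Rightarrow> bool" where
  "same A B s s' \<longleftrightarrow> (\<forall>a. a \<notin> A \<longrightarrow> fst s' a = fst s a) \<and> (\<forall>a. a \<notin> B \<longrightarrow> snd s' a = snd s a)"

lemma same_refl [simp]: "same A B s s"
  by (simp add: same_def)

lemma same_trans: "same A B s s' \<Longrightarrow> same A B s' s'' \<Longrightarrow> same A B s s''"
  by (simp add: same_def)

lemma same_mono: "same A B s s' \<Longrightarrow> A \<subseteq> A' \<Longrightarrow> B \<subseteq> B' \<Longrightarrow> same A' B' s s'"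
  by (auto simp: same_def)

lemma exec_same: "exec \<delta> p s t s' \<Longrightarrow> same (nmods p) (rmods p) s s'"
  by (induction rule: exec.induct) (auto simp: same_def)

text \<open>Writable arrays are read off the syntax, so frame conditions come for free and need not
  be carried through invariants.\<close>

lemma runs_frame:
  "runs \<delta> p s B Q \<Longrightarrow> runs \<delta> p s B (\<lambda>s'. Q s' \<and> same (nmods p) (rmods p) s s')"
  unfolding runs_def using exec_same by blast

lemma runs_conseq:
  "runs \<delta> p s B Q \<Longrightarrow> (\<And>s'. Q s' \<Longrightarrow> Q' s') \<Longrightarrow> B \<le> B' \<Longrightarrow> runs \<delta> p s B' Q'"
  unfolding runs_def by (meson order_trans)

lemma runs_seq:
  assumes "runs \<delta> p s B1 Q1" "\<And>s'. Q1 s' \<Longrightarrow> runs \<delta> q s' B2 Q" "B1 + B2 \<le> B"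
  shows "runs \<delta> (PSeq p q) s B Q"
proof -
  obtain t s' where 1: "exec \<delta> p s t s'" "t \<le> B1" "Q1 s'" using assms(1) by (auto simp: runs_def)
  obtain u s'' where 2: "exec \<delta> q s' u s''" "u \<le> B2" "Q s''"
    using assms(2)[OF 1(3)] by (auto simp: runs_def)
  show ?thesis unfolding runs_def
    using exec_Seq[OF 1(1) 2(1)] 1 2 assms(3) by (intro exI[of _ "t + u"] exI[of _ s'']) simp
qed

section \<open>Straight-line code: final stores by simplification, static cost bounds\<close>

primrec loop_free :: "prog \<Rightarrow> bool" where
  "loop_free PSkip \<longleftrightarrow> True"
| "loop_free (NSet a i e) \<longleftrightarrow> True"
| "loop_free (RSet a i e) \<longleftrightarrow> True"
| "loop_free (PSeq p q) \<longleftrightarrow> loop_free p \<and> loop_free q"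
| "loop_free (PIf b p q) \<longleftrightarrow> loop_free p \<and> loop_free q"
| "loop_free (PWhile b p) \<longleftrightarrow> False"

primrec sem :: "(nat \<Rightarrow> nat \<Rightarrow> real) \<Rightarrow> prog \<Rightarrow> store \<Rightarrow> store" where
  "sem \<delta> PSkip s = s"
| "sem \<delta> (NSet a i e) s = ((fst s)(a := (fst s a)(nval s i := nval s e)), snd s)"
| "sem \<delta> (RSet a i e) s = (fst s, (snd s)(a := (snd s a)(nval s i := rval \<delta> s e)))"
| "sem \<delta> (PSeq p q) s = sem \<delta> q (sem \<delta> p s)"
| "sem \<delta> (PIf b p q) s = (if cval \<delta> s b then sem \<delta> p s else sem \<delta> q s)"
| "sem \<delta> (PWhile b p) s = s"

text \<open>An upper bound that does not depend on the store: a conditional is charged with both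
  branches.\<close>

primrec pcost :: "prog \<Rightarrow> nat" where
  "pcost PSkip = 1"
| "pcost (NSet a i e) = ncost i + ncost e + 1"
| "pcost (RSet a i e) = ncost i + rcost e + 1"
| "pcost (PSeq p q) = pcost p + pcost q"
| "pcost (PIf b p q) = ccost b + pcost p + pcost q + 1"
| "pcost (PWhile b p) = 0"

lemma exec_sem: "loop_free p \<Longrightarrow> \<exists>t\<le>pcost p. exec \<delta> p s t (sem \<delta> p s)"
proof (induction p arbitrary: s)
  case (PSeq p q)
  obtain t where t: "t \<le> pcost p" "exec \<delta> p s t (sem \<delta> p s)"
    using PSeq.IH(1)[of s] PSeq.prems by auto
  obtain u where u: "u \<le> pcost q" "exec \<delta> q (sem \<delta> p s) u (sem \<delta> q (sem \<delta> p s))"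
    using PSeq.IH(2)[of "sem \<delta> p s"] PSeq.prems by auto
  show ?case using t(1) u(1) exec_Seq[OF t(2) u(2)] by (intro exI[of _ "t + u"]) simp
next
  case (PIf b p q)
  show ?case
  proof (cases "cval \<delta> s b")
    case True
    obtain t where t: "t \<le> pcost p" "exec \<delta> p s t (sem \<delta> p s)"
      using PIf.IH(1)[of s] PIf.prems by auto
    show ?thesis using True t(1) exec_IfTrue[OF True t(2)]
      by (intro exI[of _ "ccost b + t + 1"]) simp
  next
    case False
    obtain t where t: "t \<le> pcost q" "exec \<delta> q s t (sem \<delta> q s)"
      using PIf.IH(2)[of s] PIf.prems by auto
    show ?thesis using False t(1) exec_IfFalse[OF False t(2)]
      by (intro exI[of _ "ccost b + t + 1"]) simp
  qed
next
  case PSkip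
  show ?case using exec_Skip by (intro exI[of _ 1]) simp
next
  case (NSet a i e)
  show ?case using exec_NSet[of \<delta> a i e s] by (intro exI[of _ "ncost i + ncost e + 1"]) simp
next
  case (RSet a i e)
  show ?case using exec_RSet[of \<delta> a i e s] by (intro exI[of _ "ncost i + rcost e + 1"]) simp
qed simp

lemma runs_loop_free:
  "loop_free p \<Longrightarrow> pcost p \<le> B \<Longrightarrow> Q (sem \<delta> p s) \<Longrightarrow> runs \<delta> p s B Q"
  unfolding runs_def using exec_sem order_trans by blast

lemma runs_if:
  assumes "cval \<delta> s b \<Longrightarrow> runs \<delta> p s B Q" "\<not> cval \<delta> s b \<Longrightarrow> runs \<delta> q s B Q" "ccost b + B + 1 \<le> B'"
  shows "runs \<delta> (PIf b p q) s B' Q"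
proof (cases "cval \<delta> s b")
  case True
  then obtain t s' where "exec \<delta> p s t s'" "t \<le> B" "Q s'" using assms(1) by (auto simp: runs_def)
  then show ?thesis unfolding runs_def using exec_IfTrue[OF True] assms(3)
    by (intro exI[of _ "ccost b + t + 1"] exI[of _ s']) simp
next
  case False
  then obtain t s' where "exec \<delta> q s t s'" "t \<le> B" "Q s'" using assms(2) by (auto simp: runs_def)
  then show ?thesis unfolding runs_def using exec_IfFalse[OF False] assms(3)
    by (intro exI[of _ "ccost b + t + 1"] exI[of _ s']) simp
qed

section \<open>Counting loops\<close>

abbreviation V :: "nat \<Rightarrow> nexp" where "V a \<equiv> NGet a (NConst 0)"
abbreviation VSet :: "nat \<Rightarrow> nexp \<Rightarrow> prog" where "VSet a e \<equiv> NSet a (NConst 0) e"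

definition setn :: "store \<Rightarrow> nat \<Rightarrow> nat \<Rightarrow> store" where
  "setn s a v = ((fst s)(a := (fst s a)(0 := v)), snd s)"

lemma setn_simps [simp]:
  "fst (setn s a v) b = (if b = a then (fst s a)(0 := v) else fst s b)" "snd (setn s a v) = snd s"
  by (auto simp: setn_def)

definition PFor :: "nat \<Rightarrow> nexp \<Rightarrow> prog \<Rightarrow> prog" where
  "PFor a e p = PSeq (VSet a (NConst 0))
     (PWhile (NLess (V a) e) (PSeq p (VSet a (NAdd (V a) (NConst 1)))))"

lemma mods_PFor [simp]: "nmods (PFor a e p) = insert a (nmods p)" "rmods (PFor a e p) = rmods p"
  by (auto simp: PFor_def)

text \<open>The counter belongs to the loop and not to the body, hence the \<open>setn\<close> in
  \<open>step\<close>: the body has to establish the invariant for the store whose counter is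
  already advanced. The frame condition is handed to \<open>step\<close>, \<open>bound\<close> and
  \<open>post\<close>, so that \<open>I\<close> only describes what changes. In the cost of a round,
  the 10 is made up of 4 for the test and the iteration (apart from \<open>e\<close>) and 6 for the
  increment.\<close>

lemma runs_for:
  assumes I0: "I 0 (setn s a 0)"
    and step: "\<And>i s'. i < N \<Longrightarrow> I i s' \<Longrightarrow> fst s' a 0 = i \<Longrightarrow>
        same (insert a (nmods p)) (rmods p) s s' \<Longrightarrow>
        runs \<delta> p s' B (\<lambda>s''. I (Suc i) (setn s'' a (Suc i)))"
    and bound: "\<And>s'. same (insert a (nmods p)) (rmods p) s s' \<Longrightarrow> nval s' e = N"
    and a: "a \<notin> nmods p"
    and post: "\<And>s'. I N s' \<Longrightarrow> same (insert a (nmods p)) (rmods p) s s' \<Longrightarrow> fst s' a 0 = N \<Longrightarrow> Q s'"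
    and cost: "N * (B + ncost e + 10) + ncost e + 10 \<le> BB"
  shows "runs \<delta> (PFor a e p) s BB Q"
proof -
  let ?w = "PWhile (NLess (V a) e) (PSeq p (VSet a (NAdd (V a) (NConst 1))))"
  let ?F = "same (insert a (nmods p)) (rmods p) s"
  \<comment> \<open>Induction on the number \<open>j\<close> of rounds still to come.\<close>
  have loop: "\<exists>t s''. exec \<delta> ?w s' t s'' \<and> t \<le> j * (B + ncost e + 10) + ncost e + 4 \<and> Q s''"
    if "j \<le> N" "I (N - j) s'" "fst s' a 0 = N - j" "?F s'" for j s'
    using that
  proof (induction j arbitrary: s')
    case 0
    have "\<not> cval \<delta> s' (NLess (V a) e)" using bound[OF 0(4)] 0 by simp
    from exec_WhileFalse[OF this] have "exec \<delta> ?w s' (ncost e + 4) s'" by (simp add: numeral_eq_Suc)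
    with post[of s'] 0 show ?case by (intro exI[of _ "ncost e + 4"] exI[of _ s']) simp
  next
    case (Suc j)
    have c: "cval \<delta> s' (NLess (V a) e)" using bound[OF Suc.prems(4)] Suc.prems by simp
    have "runs \<delta> p s' B (\<lambda>s''. I (Suc (N - Suc j)) (setn s'' a (Suc (N - Suc j))))"
      using step[of "N - Suc j" s'] Suc.prems by simp
    from runs_frame[OF this] obtain t1 s1 where s1: "exec \<delta> p s' t1 s1" "t1 \<le> B"
      "I (N - j) (setn s1 a (N - j))" "same (nmods p) (rmods p) s' s1"
      using Suc.prems(1) by (auto simp: runs_def Suc_diff_Suc)
    have a1: "fst s1 a 0 = N - Suc j" using s1(4) a Suc.prems(3) by (simp add: same_def)
    have e1: "exec \<delta> (VSet a (NAdd (V a) (NConst 1))) s1 6 (setn s1 a (N - j))"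
      using exec_NSet[of \<delta> a "NConst 0" "NAdd (V a) (NConst 1)" s1] a1 Suc.prems(1)
      by (simp add: setn_def Suc_diff_Suc numeral_eq_Suc)
    have F1: "?F (setn s1 a (N - j))"
      using Suc.prems(4) s1(4) by (auto simp: same_def)
    obtain t2 s2 where s2: "exec \<delta> ?w (setn s1 a (N - j)) t2 s2"
      "t2 \<le> j * (B + ncost e + 10) + ncost e + 4" "Q s2"
      using Suc.IH[of "setn s1 a (N - j)"] Suc.prems(1) s1(3) F1 by auto
    from exec_WhileTrue[OF c exec_Seq[OF s1(1) e1] s2(1)] s2 s1(2)
    show ?case by (intro exI[of _ "ccost (NLess (V a) e) + (t1 + 6) + t2 + 1"] exI[of _ s2]) simp
  qed
  have "?F (setn s a 0)" by (simp add: same_def)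
  with loop[of N "setn s a 0"] I0 obtain t s' where
    t: "exec \<delta> ?w (setn s a 0) t s'" "t \<le> N * (B + ncost e + 10) + ncost e + 4" "Q s'" by auto
  have "exec \<delta> (VSet a (NConst 0)) s 3 (setn s a 0)"
    using exec_NSet[of \<delta> a "NConst 0" "NConst 0" s] by (simp add: setn_def numeral_eq_Suc)
  from exec_Seq[OF this t(1)] t cost show ?thesis
    unfolding runs_def PFor_def by (intro exI[of _ "3 + t"] exI[of _ s']) simp
qed

section \<open>Nets, coresets and far selections\<close>

context Metric_space
begin

text \<open>\<open>N\<close> is fixed before \<rho>, so that it can be computed without knowing the
  scale at which it will be used.\<close>

definition multiscale_net :: "'a set \<Rightarrow> 'a set \<Rightarrow> nat \<Rightarrow> bool" where
  "multiscale_net A N K \<longleftrightarrow> N \<subseteq> A \<and> finite N \<and>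
     (\<forall>\<rho>>0. \<exists>C\<subseteq>N. (\<forall>a\<in>C. \<forall>b\<in>C. a \<noteq> b \<longrightarrow> \<rho> \<le> d a b) \<and>
        (card C = K \<or> (\<forall>q\<in>A. \<exists>z\<in>C. d q z < \<rho>)))"

lemma multiscale_netE:
  assumes "multiscale_net A N K" "0 < \<rho>"
  obtains C where "C \<subseteq> N" "\<forall>a\<in>C. \<forall>b\<in>C. a \<noteq> b \<longrightarrow> \<rho> \<le> d a b"
    "card C = K \<or> (\<forall>q\<in>A. \<exists>z\<in>C. d q z < \<rho>)"
  using assms(1)[unfolded multiscale_net_def, THEN conjunct2, THEN conjunct2, rule_format, OF assms(2)]
  by (elim exE conjE)

text \<open>\<open>f\<close> assigns nearest centres, and its fibres are the cells. They are
  intersected with \<open>A\<close> because \<open>K\<close> will hold the kept points of all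
  colours at once.\<close>

definition coreset :: "nat \<Rightarrow> 'a set \<Rightarrow> 'a set \<Rightarrow> 'a set \<Rightarrow> bool" where
  "coreset k A N K \<longleftrightarrow> multiscale_net A N (2 * k) \<and> N \<subseteq> K \<and>
     (\<exists>f. (\<forall>q\<in>A. f q \<in> N \<and> (\<forall>z\<in>N. d q (f q) \<le> d q z)) \<and>
          (\<forall>q\<in>A. q \<in> K \<or> k \<le> card {x \<in> K \<inter> A. f x = f q}))"

text \<open>The hypothesis \<open>far\<close> says, without mentioning minima, that \<open>z i\<close> maximizes the distance to
  \<open>{z 0, ..., z (i - 1)}\<close> over \<open>A\<close>.\<close>

lemma farthest_first_multiscale_net:
  fixes z :: "nat \<Rightarrow> 'a"
  assumes A: "A \<subseteq> M" and K: "0 < K" and z: "\<And>i. i < K \<Longrightarrow> z i \<in> A"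
    and far: "\<And>i q. 0 < i \<Longrightarrow> i < K \<Longrightarrow> q \<in> A \<Longrightarrow> \<exists>j<i. \<forall>j'<i. d q (z j) \<le> d (z i) (z j')"
  shows "multiscale_net A (z ` {..<K}) K"
  unfolding multiscale_net_def
proof (intro conjI allI impI)
  fix \<rho> :: real assume \<rho>: "0 < \<rho>"
  define cov where "cov i \<longleftrightarrow> (\<forall>q\<in>A. \<exists>j<i. d q (z j) < \<rho>)" for i
  \<comment> \<open>The shortest nonempty prefix that covers \<open>A\<close> at scale \<rho>, or
    the whole traversal if none does.\<close>
  define i where "i = (LEAST i. 0 < i \<and> (i = K \<or> cov i))"
  have i: "0 < i \<and> (i = K \<or> cov i)"
    unfolding i_def by (rule LeastI[of _ K]) (use K in simp)
  have iK: "i \<le> K" unfolding i_def by (rule Least_le) (use K in simp)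
  have min: "\<not> cov i'" if "0 < i'" "i' < i" for i'
    using not_less_Least[OF that(2)[unfolded i_def]] that by blast
  \<comment> \<open>When \<open>z a\<close> was chosen, the earlier points did not cover, so some
    \<open>q\<close> was at distance at least \<rho> from all of them; \<open>z a\<close> is at
    least as far away as \<open>q\<close>.\<close>
  have sep: "\<rho> \<le> d (z a) (z b)" if "b < a" "a < i" for a b
  proof -
    have "0 < a" using that by simp
    from min[OF this that(2)] obtain q where q: "q \<in> A" "\<And>j. j < a \<Longrightarrow> \<rho> \<le> d q (z j)"
      unfolding cov_def not_less[symmetric] by blast
    from far[of a q] q that iK obtain j where "j < a" "\<forall>j'<a. d q (z j) \<le> d (z a) (z j')" by auto
    with q(2)[of j] that(1) show ?thesis by (meson order_trans)
  qed
  have sep': "\<rho> \<le> d (z a) (z b)" if "a < i" "b < i" "a \<noteq> b" for a b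
    using sep[of a b] sep[of b a] that commute by (cases "a < b") auto
  \<comment> \<open>The traversal of a small class repeats points, but never within this prefix. So
    a prefix of length \<open>K\<close> really has \<open>K\<close> points.\<close>
  have inj: "inj_on z {..<i}"
  proof (rule inj_onI, rule ccontr)
    fix a b assume ab: "a \<in> {..<i}" "b \<in> {..<i}" "z a = z b" "a \<noteq> b"
    then have "\<rho> \<le> d (z a) (z b)" by (intro sep') auto
    moreover have "z b \<in> M" using z[of b] A ab iK by auto
    ultimately show False using ab(3) \<rho> by simp
  qed
  show "\<exists>C\<subseteq>z ` {..<K}. (\<forall>a\<in>C. \<forall>b\<in>C. a \<noteq> b \<longrightarrow> \<rho> \<le> d a b) \<and>
        (card C = K \<or> (\<forall>q\<in>A. \<exists>z\<in>C. d q z < \<rho>))"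
  proof (intro exI[of _ "z ` {..<i}"] conjI)
    show "card (z ` {..<i}) = K \<or> (\<forall>q\<in>A. \<exists>z\<in>z ` {..<i}. d q z < \<rho>)"
      using i card_image[OF inj] unfolding cov_def by auto
  qed (use iK sep' in auto)
qed (use z in auto)

text \<open>Preserves the coresets of earlier colours while points of later colours are
  added.\<close>

lemma coreset_mono:
  assumes "coreset k A N K" "K \<subseteq> K'" "finite A"
  shows "coreset k A N K'"
proof -
  from assms(1) obtain f where f: "\<forall>q\<in>A. f q \<in> N \<and> (\<forall>z\<in>N. d q (f q) \<le> d q z)"
    "\<forall>q\<in>A. q \<in> K \<or> k \<le> card {x \<in> K \<inter> A. f x = f q}" "multiscale_net A N (2 * k)" "N \<subseteq> K"
    by (auto simp: coreset_def)
  have "card {x \<in> K \<inter> A. f x = f q} \<le> card {x \<in> K' \<inter> A. f x = f q}" for q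
    using assms by (intro card_mono) auto
  then have "\<forall>q\<in>A. q \<in> K' \<or> k \<le> card {x \<in> K' \<inter> A. f x = f q}"
    using f(2) assms(2) by (meson order_trans subsetD)
  then show ?thesis using f assms(2) by (auto simp: coreset_def)
qed

text \<open>If some point of \<open>A\<close> is missing from \<open>K\<close>, its cell alone
  supplies \<open>k\<close> kept points.\<close>

lemma coreset_card:
  assumes "coreset k A N K" "finite A" "c \<le> k" "c \<le> card A"
  shows "c \<le> card (K \<inter> A)"
proof (cases "A \<subseteq> K")
  case True
  then have "K \<inter> A = A" by auto
  then show ?thesis using assms by simp
next
  case False
  then obtain q where "q \<in> A" "q \<notin> K" by auto
  with assms(1) obtain f :: "'a \<Rightarrow> 'a" where "k \<le> card {x \<in> K \<inter> A. f x = f q}"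
    unfolding coreset_def by blast
  also have "\<dots> \<le> card (K \<inter> A)" using assms(2) by (intro card_mono) auto
  finally show ?thesis using assms(3) by simp
qed

text \<open>Two points of \<open>C\<close> within \<sigma>/2 of the same \<open>z\<close> would be
  closer than \<sigma> to each other, so assigning a near \<open>z\<close> is injective.\<close>

lemma card_near_separated_le:
  assumes "C \<subseteq> M" "Z \<subseteq> M" "finite Z" "finite C"
    and sep: "\<forall>a\<in>C. \<forall>b\<in>C. a \<noteq> b \<longrightarrow> \<sigma> \<le> d a b"
  shows "card {a \<in> C. \<exists>z\<in>Z. d a z < \<sigma> / 2} \<le> card Z"
proof -
  let ?D = "{a \<in> C. \<exists>z\<in>Z. d a z < \<sigma> / 2}"
  obtain g where g: "\<And>a. a \<in> ?D \<Longrightarrow> g a \<in> Z \<and> d a (g a) < \<sigma> / 2"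
    using bchoice[of ?D "\<lambda>a z. z \<in> Z \<and> d a z < \<sigma> / 2"] by blast
  have "inj_on g ?D"
  proof (rule inj_onI, rule ccontr)
    fix a b assume ab: "a \<in> ?D" "b \<in> ?D" "g a = g b" "a \<noteq> b"
    have "d a b \<le> d a (g a) + d (g a) b"
      using ab assms(1,2) g[OF ab(1)] by (intro triangle) auto
    also have "\<dots> < \<sigma>" using g[OF ab(1)] g[OF ab(2)] ab(3) commute[of b "g b"] by simp
    finally have "d a b < \<sigma>" .
    moreover have "\<sigma> \<le> d a b" using sep ab by blast
    ultimately show False by simp
  qed
  moreover have "g ` ?D \<subseteq> Z" using g by blast
  ultimately show ?thesis using card_inj_on_le assms(3) by blast
qed

text \<open>The scale is \<beta>/4. A separated set of \<open>2 * k\<close> centres loses at most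
  one centre to each ball of radius \<beta>/8 around a point of \<open>Z\<close>, and at least
  \<open>k\<close> remain. If the centres cover \<open>A\<close> instead, any two points of a cell
  are closer than \<beta>/2, so the whole cell of a point of \<open>R\<close> stays \<beta>/2 away
  from \<open>Z\<close>. The first case determines the factor 8.\<close>

lemma card_coreset_far:
  assumes K: "coreset k A N K" and A: "finite A" "A \<subseteq> M"
    and Z: "finite Z" "Z \<subseteq> M" "card Z \<le> k"
    and R: "R \<subseteq> A" "card R \<le> k" and \<beta>: "0 < \<beta>"
    and far: "\<And>q z. q \<in> R \<Longrightarrow> z \<in> Z \<Longrightarrow> \<beta> \<le> d q z"
  shows "card R \<le> card {q \<in> K \<inter> A. \<forall>z\<in>Z. \<beta> / 8 \<le> d q z}"
proof -
  let ?F = "{q \<in> K \<inter> A. \<forall>z\<in>Z. \<beta> / 8 \<le> d q z}"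
  have finF: "finite ?F" using A by auto
  from K obtain f where f: "\<And>q. q \<in> A \<Longrightarrow> f q \<in> N" "\<And>q z. q \<in> A \<Longrightarrow> z \<in> N \<Longrightarrow> d q (f q) \<le> d q z"
    and keep: "\<And>q. q \<in> A \<Longrightarrow> q \<in> K \<or> k \<le> card {x \<in> K \<inter> A. f x = f q}"
    and N: "N \<subseteq> K" "multiscale_net A N (2 * k)"
    unfolding coreset_def by blast
  have NA: "N \<subseteq> A" "finite N" using N(2) by (auto simp: multiscale_net_def)
  have "0 < \<beta> / 4" using \<beta> by simp
  then obtain C where C: "C \<subseteq> N" "\<forall>a\<in>C. \<forall>b\<in>C. a \<noteq> b \<longrightarrow> \<beta> / 4 \<le> d a b"
    "card C = 2 * k \<or> (\<forall>q\<in>A. \<exists>z\<in>C. d q z < \<beta> / 4)"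
    using multiscale_netE[OF N(2)] by metis
  have finC: "finite C" using C(1) NA(2) finite_subset by blast
  from C(3) show ?thesis
  proof
    assume c: "card C = 2 * k"
    let ?D = "{a \<in> C. \<exists>z\<in>Z. d a z < \<beta> / 4 / 2}"
    have "card ?D \<le> k"
      by (rule order_trans[OF card_near_separated_le[OF _ Z(2,1) finC C(2)] Z(3)])
        (use C(1) NA A in blast)
    then have "k \<le> card (C - ?D)" using c finC by (subst card_Diff_subset) auto
    also have "\<dots> \<le> card ?F" using C(1) N NA finF by (intro card_mono) (auto simp: not_less)
    finally show ?thesis using R by simp
  next
    assume cov: "\<forall>q\<in>A. \<exists>z\<in>C. d q z < \<beta> / 4"
    have near: "d q (f q) < \<beta> / 4" if q: "q \<in> A" for q
    proof -
      obtain z where "z \<in> C" "d q z < \<beta> / 4" using cov q by blast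
      then show ?thesis using f(2)[OF q, of z] C(1) by auto
    qed
    have cell: "\<beta> / 8 \<le> d x z" if q: "q \<in> R" and x: "x \<in> A" "f x = f q" and z: "z \<in> Z" for q x z
    proof -
      have qA: "q \<in> A" using q R by auto
      have M: "q \<in> M" "x \<in> M" "f q \<in> M" "z \<in> M"
        using qA x z f(1)[OF qA] NA A Z by auto
      have "d q z \<le> d q (f q) + (d (f q) x + d x z)"
        using triangle[of q "f q" z] triangle[of "f q" x z] M by simp
      then show ?thesis
        using near[OF qA] near[OF x(1)] far[OF q z] commute[of x "f x"] x(2) \<beta> by simp
    qed
    show ?thesis
    proof (cases "R \<subseteq> K")
      case True
      have "R \<subseteq> ?F"
      proof
        fix q assume "q \<in> R"
        then show "q \<in> ?F" using True R(1) cell[of q q] by blast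
      qed
      then show ?thesis by (rule card_mono[OF finF])
    next
      case False
      \<comment> \<open>One missing point of \<open>R\<close> is enough: the \<open>k\<close> kept
        points of its cell are at least as many as \<open>R\<close> has.\<close>
      then obtain q where q: "q \<in> R" "q \<notin> K" by auto
      then have "k \<le> card {x \<in> K \<inter> A. f x = f q}" using keep R by blast
      also have "\<dots> \<le> card ?F" using finF cell[OF q(1)] by (intro card_mono) auto
      finally show ?thesis using R by simp
    qed
  qed
qed

text \<open>The scale is \<open>r / 2\<close>. Among \<open>2 * k\<close> separated centres, at
  least \<open>k\<close> keep distance \<open>r / 4\<close> from \<open>Opt\<close>, and any
  \<open>card S\<close> of them will do. If the centres cover, points of \<open>S\<close> move by
  less than \<open>r / 2\<close>: by \<open>iso\<close> no two of them reach the same centre, and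
  more than \<open>r / 2\<close> of the distance to the rest of \<open>Opt\<close> is left.\<close>

lemma isolated_points_in_net:
  assumes net: "multiscale_net A N (2 * k)" and A: "A \<subseteq> M"
    and O: "finite Opt" "Opt \<subseteq> M" "card Opt \<le> k" and S: "S \<subseteq> Opt \<inter> A" and r: "0 < r"
    and iso: "\<And>p q. p \<in> S \<Longrightarrow> q \<in> Opt \<Longrightarrow> q \<noteq> p \<Longrightarrow> r \<le> d p q"
  obtains Z where "Z \<subseteq> N" "card Z = card S"
    "\<forall>z\<in>Z. \<forall>z'\<in>Z. z \<noteq> z' \<longrightarrow> r / 4 \<le> d z z'"
    "\<forall>z\<in>Z. \<forall>q\<in>Opt - S. r / 4 \<le> d z q"
proof -
  have NA: "N \<subseteq> A" "finite N" using net by (auto simp: multiscale_net_def)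
  have "0 < r / 2" using r by simp
  then obtain C where C: "C \<subseteq> N" "\<forall>a\<in>C. \<forall>b\<in>C. a \<noteq> b \<longrightarrow> r / 2 \<le> d a b"
    "card C = 2 * k \<or> (\<forall>q\<in>A. \<exists>z\<in>C. d q z < r / 2)"
    using multiscale_netE[OF net] by metis
  have finC: "finite C" using C(1) NA(2) finite_subset by blast
  from C(3) show ?thesis
  proof
    assume c: "card C = 2 * k"
    let ?D = "{a \<in> C. \<exists>z\<in>Opt. d a z < r / 2 / 2}"
    have "card ?D \<le> k"
      by (rule order_trans[OF card_near_separated_le[OF _ O(2,1) finC C(2)] O(3)])
        (use C(1) NA A in blast)
    then have "k \<le> card (C - ?D)" using c finC by (subst card_Diff_subset) auto
    moreover have "card S \<le> k" using S O card_mono[of Opt S] by auto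
    ultimately have "card S \<le> card (C - ?D)" by simp
    then obtain Z where Z: "Z \<subseteq> C - ?D" "card Z = card S"
      by (rule obtain_subset_with_card_n)
    show ?thesis
    proof (rule that[of Z]; (intro ballI impI)?)
      show "r / 4 \<le> d z z'" if "z \<in> Z" "z' \<in> Z" "z \<noteq> z'" for z z'
      proof -
        have "r / 2 \<le> d z z'" using C(2) Z(1) that by blast
        then show ?thesis using r by simp
      qed
      show "r / 4 \<le> d z q" if "z \<in> Z" "q \<in> Opt - S" for z q
      proof -
        have "\<not> d z q < r / 2 / 2" using Z(1) that by blast
        then show ?thesis by simp
      qed
    qed (use Z C(1) in auto)
  next
    assume cov: "\<forall>q\<in>A. \<exists>z\<in>C. d q z < r / 2"
    have "\<forall>p\<in>S. \<exists>z. z \<in> C \<and> d p z < r / 2" using cov S by blast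
    from bchoice[OF this] obtain g where g: "\<And>p. p \<in> S \<Longrightarrow> g p \<in> C \<and> d p (g p) < r / 2"
      by blast
    have gM: "g p \<in> M" "p \<in> M" if "p \<in> S" for p using g[OF that] that C(1) NA A S O by auto
    have inj: "inj_on g S"
    proof (rule inj_onI, rule ccontr)
      fix a b assume ab: "a \<in> S" "b \<in> S" "g a = g b" "a \<noteq> b"
      have "d a b \<le> d a (g a) + d (g a) b" using gM ab by (intro triangle) auto
      also have "\<dots> < r" using g[OF ab(1)] g[OF ab(2)] ab(3) commute[of b "g b"] by simp
      finally show False using iso[of a b] ab S by auto
    qed
    show ?thesis
    proof (rule that[of "g ` S"]; (intro ballI impI)?)
      show "r / 4 \<le> d z z'" if "z \<in> g ` S" "z' \<in> g ` S" "z \<noteq> z'" for z z'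
      proof -
        have "r / 2 \<le> d z z'" using C(2) g that by blast
        then show ?thesis using r by simp
      qed
      show "r / 4 \<le> d z q" if z: "z \<in> g ` S" and q: "q \<in> Opt - S" for z q
      proof -
        obtain p where p: "p \<in> S" "z = g p" using z by auto
        have "r \<le> d p q" using iso[OF p(1)] q p by auto
        also have "\<dots> \<le> d p z + d z q" using gM p q O by (intro triangle) auto
        finally show ?thesis using g[OF p(1)] p(2) r by simp
      qed
    qed (use g C(1) card_image[OF inj] in auto)
  qed
qed

end

section \<open>Harmonic averaging over scales, and nearest-neighbour distances\<close>

lemma sum_le_harm:
  fixes v :: "'a \<Rightarrow> real"
  assumes "finite A" "\<And>p. p \<in> A \<Longrightarrow> v p * real (card {q \<in> A. v p \<le> v q}) \<le> W" "\<And>p. p \<in> A \<Longrightarrow> 0 \<le> v p" "0 \<le> W"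
  shows "(\<Sum>p\<in>A. v p) \<le> W * harm (card A)"
  using assms
proof (induction "card A" arbitrary: A)
  case 0
  then show ?case by (simp add: harm_def)
next
  case (Suc n)
  then have "A \<noteq> {}" "finite A" by auto
  then obtain p where p: "p \<in> A" "\<And>q. q \<in> A \<Longrightarrow> v p \<le> v q"
    using arg_min_if_finite(1)[of A v] arg_min_least[of A _ v] by blast
  \<comment> \<open>All of \<open>A\<close> lies above the minimum, which is therefore at most
    \<open>W / card A\<close>. Removing it and iterating bounds the i-th largest value by
    \<open>W / i\<close>.\<close>
  have "{q \<in> A. v p \<le> v q} = A" using p by auto
  then have 1: "v p \<le> W / real (card A)"
    using Suc.prems(2)[OF p(1)] Suc.hyps(2) by (simp add: field_simps del: of_nat_Suc)
  have 2: "(\<Sum>q\<in>A - {p}. v q) \<le> W * harm (card (A - {p}))"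
  proof (rule Suc.hyps(1))
    fix q assume q: "q \<in> A - {p}"
    have "card {x \<in> A - {p}. v q \<le> v x} \<le> card {x \<in> A. v q \<le> v x}"
      using \<open>finite A\<close> by (intro card_mono) auto
    then have "v q * real (card {x \<in> A - {p}. v q \<le> v x}) \<le> v q * real (card {x \<in> A. v q \<le> v x})"
      using Suc.prems(3)[of q] q by (intro mult_left_mono) auto
    then show "v q * real (card {x \<in> A - {p}. v q \<le> v x}) \<le> W"
      using Suc.prems(2)[of q] q by auto
  qed (use Suc.prems Suc.hyps(2) p in auto)
  have "(\<Sum>q\<in>A. v q) = v p + (\<Sum>q\<in>A - {p}. v q)" using \<open>finite A\<close> p(1) by (rule sum.remove)
  also have "\<dots> \<le> W / real (card A) + W * harm n" using 1 2 p(1) Suc.prems(1) by (simp flip: Suc.hyps(2))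
  also have "\<dots> = W * harm (card A)"
    unfolding Suc.hyps(2)[symmetric] harm_Suc by (simp add: field_simps)
  finally show ?case .
qed

text \<open>\<open>harm k - ln k\<close> is decreasing with value 1 at \<open>k = 1\<close>, and
  \<open>1 \<le> 2 * ln 2\<close>.\<close>

lemma harm_le_three_ln:
  assumes "2 \<le> k"
  shows "harm k \<le> 3 * ln (real k)"
proof -
  have "harm (Suc (k - 1)) - ln (real (Suc (k - 1))) \<le> harm (Suc 0) - ln (real (Suc 0))"
    by (rule decseqD[OF decseq_harm_diff_ln]) simp
  then have "harm k \<le> ln (real k) + (1 :: real)"
    using assms by (simp add: harm_def)
  moreover have "1/2 \<le> ln (2::real)" using ln2_ge_two_thirds by simp
  moreover have "ln 2 \<le> ln (real k)" using assms by simp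
  ultimately show ?thesis by linarith
qed

definition nn_dist :: "('a \<Rightarrow> 'a \<Rightarrow> real) \<Rightarrow> 'a set \<Rightarrow> 'a \<Rightarrow> real" where
  "nn_dist d S p = (if S - {p} = {} then 0 else Min ((\<lambda>q. d p q) ` (S - {p})))"

lemma sum_nn_div_eq: "sum_nn_div d S = (\<Sum>p\<in>S. nn_dist d S p)"
  by (simp add: sum_nn_div_def nn_dist_def)

lemma nn_dist_ge:
  assumes "finite S" "S - {p} \<noteq> {}" "\<And>q. q \<in> S \<Longrightarrow> q \<noteq> p \<Longrightarrow> r \<le> d p q"
  shows "r \<le> nn_dist d S p"
  using assms by (simp add: nn_dist_def)

lemma nn_dist_le:
  assumes "finite S" "q \<in> S" "q \<noteq> p"
  shows "nn_dist d S p \<le> d p q"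
  using assms by (auto simp: nn_dist_def)

section \<open>Completing a candidate set by farthest points\<close>

context Metric_space
begin

lemma nn_dist_nonneg: "finite S \<Longrightarrow> 0 \<le> nn_dist d S p"
  by (auto simp: nn_dist_def)

lemma sum_nn_div_nonneg: "finite S \<Longrightarrow> 0 \<le> sum_nn_div d S"
  by (simp add: sum_nn_div_eq nn_dist_nonneg sum_nonneg)

lemma nn_dist_pos:
  assumes "finite S" "S \<subseteq> M" "p \<in> M" "S - {p} \<noteq> {}"
  shows "0 < nn_dist d S p"
proof -
  have "nn_dist d S p \<in> (\<lambda>q. d p q) ` (S - {p})"
    unfolding nn_dist_def using assms by (auto intro!: Min_in)
  then show ?thesis using assms by (auto simp: mdist_pos_eq)
qed

text \<open>The last inequality says that \<open>x\<close> is at most as far from \<open>Z\<close> as \<open>t\<close>, without mentioning minima.\<close>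

definition far_selection :: "('a \<Rightarrow> nat) \<Rightarrow> 'a set \<Rightarrow> 'a set \<Rightarrow> 'a set \<Rightarrow> bool" where
  "far_selection col K Z T \<longleftrightarrow> (\<forall>x\<in>K - T. \<forall>t\<in>T. col x = col t \<longrightarrow>
     (x \<in> Z \<longrightarrow> t \<in> Z) \<and>
     (Z \<noteq> {} \<longrightarrow> (x \<in> Z \<longleftrightarrow> t \<in> Z) \<longrightarrow> (\<exists>z\<in>Z. \<forall>z'\<in>Z. d x z \<le> d t z')))"

text \<open>An exchange argument. With \<open>Z\<close> in place of \<open>S\<close>, each colour
  has as many positions left as \<open>Opt - S\<close> has points of this colour. Those points are
  \<open>r / 4\<close> away from \<open>Z\<close>, so the coreset offers at least as many points
  that are \<open>r / 32\<close> away, and a farthest choice cannot do worse. As \<open>T\<close>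
  ranges over all far selections, the program may break ties arbitrarily.\<close>

lemma far_selection_isolates:
  assumes P: "finite P" "P \<subseteq> M" and K: "K \<subseteq> P"
    and cs: "\<And>j. j < m \<Longrightarrow> coreset k {q \<in> P. col q = j} (N j) K"
    and col: "\<And>q. q \<in> P \<Longrightarrow> col q < m"
    and Opt: "Opt \<subseteq> P" "\<And>j. j < m \<Longrightarrow> card {q \<in> Opt. col q = j} = \<kappa> j" "card Opt \<le> k"
    and l: "l < m" and S: "S \<subseteq> {q \<in> Opt. col q = l}" and r: "0 < r"
    and iso: "\<And>p q. p \<in> S \<Longrightarrow> q \<in> Opt \<Longrightarrow> q \<noteq> p \<Longrightarrow> r \<le> d p q"
  obtains Z where "Z \<subseteq> N l" "card Z = card S"
    "\<forall>T\<subseteq>K. (\<forall>j<m. card {t \<in> T. col t = j} = \<kappa> j) \<longrightarrow> far_selection col K Z T \<longrightarrow>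
       Z \<subseteq> T \<and> (\<forall>z\<in>Z. \<forall>t\<in>T. t \<noteq> z \<longrightarrow> r / 32 \<le> d z t)"
proof -
  let ?A = "\<lambda>j. {q \<in> P. col q = j}"
  have net: "multiscale_net (?A l) (N l) (2 * k)" "N l \<subseteq> K" using cs[OF l] by (auto simp: coreset_def)
  have NA: "N l \<subseteq> ?A l" "finite (N l)" by (use net(1) in \<open>simp_all add: multiscale_net_def\<close>)
  have finOpt: "finite Opt" using Opt(1) P(1) finite_subset by blast
  have AlM: "?A l \<subseteq> M" and OM: "Opt \<subseteq> M" and SOA: "S \<subseteq> Opt \<inter> ?A l" using P Opt(1) S by auto
  obtain Z where Z: "Z \<subseteq> N l" "card Z = card S"
    and ZZ: "\<forall>z\<in>Z. \<forall>z'\<in>Z. z \<noteq> z' \<longrightarrow> r / 4 \<le> d z z'"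
    and ZO: "\<forall>z\<in>Z. \<forall>q\<in>Opt - S. r / 4 \<le> d z q"
    by (rule isolated_points_in_net[OF net(1) AlM finOpt OM Opt(3) SOA r iso])
  have finZ: "finite Z" using Z(1) NA(2) finite_subset by blast
  have ZM: "Z \<subseteq> M" and Zcol: "\<And>z. z \<in> Z \<Longrightarrow> col z = l" using Z(1) NA AlM by auto
  have finS: "finite S" by (rule finite_subset[OF S]) (use finOpt in simp)
  have cS: "card S \<le> \<kappa> l"
    using card_mono[OF _ S] finOpt Opt(2)[OF l] by simp
  have Zk: "card Z \<le> k"
    using Z(2) Opt(3) card_mono[OF finOpt, of S] SOA by fastforce
  show ?thesis
  proof (rule that[OF Z], intro allI impI)
    fix T assume T: "T \<subseteq> K" "\<forall>j<m. card {t \<in> T. col t = j} = \<kappa> j"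
      and far: "far_selection col K Z T"
    have finT: "finite T" using T(1) K P(1) by (meson finite_subset)
    have ZT: "Z \<subseteq> T"
    proof (rule ccontr)
      assume "\<not> Z \<subseteq> T"
      then obtain x where x: "x \<in> Z" "x \<notin> T" by auto
      \<comment> \<open>Points of \<open>Z\<close> take precedence: if \<open>x\<close> is left out,
        only other points of \<open>Z\<close> can have been selected for colour \<open>l\<close>,
        and these are too few.\<close>
      have "{t \<in> T. col t = l} \<subseteq> Z - {x}"
        using far x Z(1) net(2) Zcol unfolding far_selection_def by blast
      then have "\<kappa> l \<le> card (Z - {x})"
        using T(2)[rule_format, OF l] finZ by (metis card_mono finite_Diff)
      also have "\<dots> < card Z" using x(1) finZ by (intro card_Diff1_less)
      finally show False using Z(2) cS by simp
    qed
    have "r / 32 \<le> d z t" if z: "z \<in> Z" and t: "t \<in> T" "t \<noteq> z" for z t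
    proof (cases "t \<in> Z")
      case True
      then show ?thesis using ZZ z True t r by fastforce
    next
      case tZ: False
      define j where "j = col t"
      have tP: "t \<in> P" using t T(1) K by auto
      have j: "j < m" using col[OF tP] by (simp add: j_def)
      define R where "R = {q \<in> Opt - S. col q = j}"
      let ?F = "{q \<in> K \<inter> ?A j. \<forall>z\<in>Z. r / 4 / 8 \<le> d q z}"
      have finF: "finite ?F" using P by auto
      have RF: "card R \<le> card ?F"
      proof (rule card_coreset_far[OF cs[OF j] _ _ finZ ZM Zk])
        show "card R \<le> k"
          by (rule order_trans[OF card_mono[OF finOpt] Opt(3)]) (auto simp: R_def)
        show "r / 4 \<le> d q z" if "q \<in> R" "z \<in> Z" for q z
          using ZO that commute[of q z] by (auto simp: R_def)
      qed (use P Opt r in \<open>auto simp: R_def\<close>)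
      have TR: "card ({t \<in> T. col t = j} - Z) = card R"
      proof (cases "j = l")
        case True
        have "R = {q \<in> Opt. col q = l} - S" using True by (auto simp: R_def)
        then have "card R = \<kappa> l - card S" using S finS Opt(2)[OF l] by (simp add: card_Diff_subset)
        moreover have "card ({t \<in> T. col t = j} - Z) = \<kappa> l - card Z"
          using True ZT Zcol finZ T(2)[rule_format, OF l] by (subst card_Diff_subset) auto
        ultimately show ?thesis using Z(2) by simp
      next
        case False
        have "R = {q \<in> Opt. col q = j}" "{t \<in> T. col t = j} - Z = {t \<in> T. col t = j}"
          using False S Zcol by (auto simp: R_def)
        then show ?thesis using Opt(2)[OF j] T(2)[rule_format, OF j] by simp
      qed
      have dZ: "r / 32 \<le> d t z" if tF: "t \<in> ?F" using tF z by auto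
      show ?thesis
      proof (cases "t \<in> ?F")
        case True
        from dZ[OF this] show ?thesis using commute[of z t] by simp
      next
        case tF: False
        \<comment> \<open>Pigeonhole: apart from \<open>t\<close>, fewer than \<open>card R\<close>
          points of colour \<open>j\<close> are selected outside \<open>Z\<close>, so they cannot
          exhaust \<open>?F\<close>.\<close>
        have "\<not> ?F \<subseteq> {t \<in> T. col t = j} - Z - {t}"
        proof
          assume "?F \<subseteq> {t \<in> T. col t = j} - Z - {t}"
          then have "card ?F \<le> card ({t \<in> T. col t = j} - Z - {t})" using finT by (intro card_mono) auto
          also have "\<dots> < card ({t \<in> T. col t = j} - Z)"
            using finT t tZ by (intro card_Diff1_less) (auto simp: j_def)
          finally show False using RF TR by simp
        qed
        then obtain x where x: "x \<in> ?F" "x \<notin> {t \<in> T. col t = j} - Z - {t}" by blast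
        have xZ: "x \<notin> Z"
        proof
          assume "x \<in> Z"
          with x(1) have "r / 4 / 8 \<le> d x x" by blast
          then show False using r \<open>x \<in> Z\<close> ZM by auto
        qed
        have "x \<noteq> t" using x(1) tF by metis
        then have xT: "x \<in> K - T" "col x = col t" using x xZ by (auto simp: j_def)
        from far xT t(1) xZ tZ z obtain w where w: "w \<in> Z" "\<forall>z'\<in>Z. d x w \<le> d t z'"
          unfolding far_selection_def by blast
        have "r / 4 / 8 \<le> d x w" using x(1) w(1) by blast
        also have "d x w \<le> d t z" using w z by blast
        finally show ?thesis using commute[of z t] by simp
      qed
    qed
    with ZT show "Z \<subseteq> T \<and> (\<forall>z\<in>Z. \<forall>t\<in>T. t \<noteq> z \<longrightarrow> r / 32 \<le> d z t)" by blast
  qed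
qed

text \<open>In the colour with the largest share of the optimum, \<open>p\<close> maximizes
  \<open>v p\<close> times the number of points whose value is at least \<open>v p\<close>. By the
  harmonic sum this product \<open>W\<close> is at least the optimum divided by
  \<open>3 * m * ln k\<close>. The points of \<open>Z\<close> alone contribute at least
  \<open>W / 32\<close> to the diversity of \<open>T\<close>.\<close>

lemma far_selection_approx:
  assumes P: "finite P" "P \<subseteq> M" and K: "K \<subseteq> P"
    and cs: "\<And>j. j < m \<Longrightarrow> coreset k {q \<in> P. col q = j} (N j) K"
    and col: "\<And>q. q \<in> P \<Longrightarrow> col q < m"
    and Opt: "Opt \<subseteq> P" "\<And>j. j < m \<Longrightarrow> card {q \<in> Opt. col q = j} = \<kappa> j" "card Opt = k"
    and k: "2 \<le> k" and m: "0 < m"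
  obtains l Z where "l < m" "Z \<subseteq> N l"
    "\<forall>T\<subseteq>K. (\<forall>j<m. card {t \<in> T. col t = j} = \<kappa> j) \<longrightarrow> far_selection col K Z T \<longrightarrow>
       sum_nn_div d Opt \<le> 96 * real m * ln (real k) * sum_nn_div d T"
proof -
  define v where "v = nn_dist d Opt"
  have finOpt: "finite Opt" using Opt(1) P(1) finite_subset by blast
  have OM: "Opt \<subseteq> M" using Opt(1) P(2) by auto
  have ne: "Opt - {p} \<noteq> {}" for p
  proof
    assume "Opt - {p} = {}"
    then have "Opt \<subseteq> {p}" by auto
    from card_mono[OF _ this] show False using Opt(3) k by simp
  qed
  have vpos: "0 < v p" if "p \<in> Opt" for p
    unfolding v_def using nn_dist_pos[OF finOpt OM _ ne] that OM by blast
  let ?O = "\<lambda>j. {q \<in> Opt. col q = j}"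
  have "sum_nn_div d Opt = (\<Sum>j<m. \<Sum>p\<in>?O j. v p)"
    unfolding sum_nn_div_eq v_def[symmetric]
    using finOpt col Opt(1) by (intro sum.group[symmetric]) auto
  also have "\<dots> \<le> (\<Sum>j<m. Max ((\<lambda>j. \<Sum>p\<in>?O j. v p) ` {..<m}))"
    by (intro sum_mono) auto
  finally have le: "sum_nn_div d Opt \<le> real m * Max ((\<lambda>j. \<Sum>p\<in>?O j. v p) ` {..<m})" by simp
  have "Max ((\<lambda>j. \<Sum>p\<in>?O j. v p) ` {..<m}) \<in> (\<lambda>j. \<Sum>p\<in>?O j. v p) ` {..<m}"
    using m by (intro Max_in) auto
  then obtain l where l: "l < m" "Max ((\<lambda>j. \<Sum>p\<in>?O j. v p) ` {..<m}) = (\<Sum>p\<in>?O l. v p)" by auto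
  \<comment> \<open>Positivity shows that colour \<open>l\<close> occurs in \<open>Opt\<close>, so
    that there is a scale to choose.\<close>
  have "0 < sum_nn_div d Opt"
    unfolding sum_nn_div_eq v_def[symmetric] using ne finOpt vpos by (intro sum_pos) auto
  then have "(\<Sum>p\<in>?O l. v p) \<noteq> 0" using le l(2) by auto
  then have "?O l \<noteq> {}" by (metis sum.empty)
  define w where "w p = v p * real (card {q \<in> ?O l. v p \<le> v q})" for p
  have finOl: "finite (?O l)" using finOpt by auto
  define W where "W = Max (w ` ?O l)"
  have "W \<in> w ` ?O l" unfolding W_def using finOl \<open>?O l \<noteq> {}\<close> by (intro Max_in) auto
  then obtain p where p: "p \<in> ?O l" "W = w p" by auto
  have W: "w q \<le> W" if "q \<in> ?O l" for q unfolding W_def using finOl that by (intro Max_ge) auto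
  have W0: "0 \<le> W" using p vpos[of p] by (simp add: w_def)
  have "(\<Sum>p\<in>?O l. v p) \<le> W * harm (card (?O l))"
    using finOl W W0 vpos by (intro sum_le_harm) (auto simp: w_def less_imp_le)
  also have "\<dots> \<le> W * harm k"
    using W0 card_mono[OF finOpt, of "?O l"] Opt(3) by (intro mult_left_mono harm_mono) auto
  also have "\<dots> \<le> W * (3 * ln (real k))"
    using W0 harm_le_three_ln[OF k] by (intro mult_left_mono) auto
  finally have opt: "sum_nn_div d Opt \<le> real m * (W * (3 * ln (real k)))"
    using le l(2) mult_left_mono[of _ _ "real m"] by (metis of_nat_0_le_iff order_trans)
  define S where "S = {q \<in> ?O l. v p \<le> v q}"
  have S: "S \<subseteq> ?O l" by (auto simp: S_def)
  have iso: "v p \<le> d q x" if "q \<in> S" "x \<in> Opt" "x \<noteq> q" for q x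
  proof -
    have "v p \<le> v q" using that(1) by (simp add: S_def)
    also have "\<dots> \<le> d q x" unfolding v_def using nn_dist_le[OF finOpt] that by blast
    finally show ?thesis .
  qed
  have "p \<in> Opt" using p by simp
  obtain Z where Z: "Z \<subseteq> N l" "card Z = card S"
    "\<forall>T\<subseteq>K. (\<forall>j<m. card {t \<in> T. col t = j} = \<kappa> j) \<longrightarrow> far_selection col K Z T \<longrightarrow>
       Z \<subseteq> T \<and> (\<forall>z\<in>Z. \<forall>t\<in>T. t \<noteq> z \<longrightarrow> v p / 32 \<le> d z t)"
    by (rule far_selection_isolates[where m = m,
          OF P K cs col Opt(1,2) eq_refl[OF Opt(3)] l(1) S vpos[OF \<open>p \<in> Opt\<close>] iso])
  show ?thesis
  proof (rule that[OF l(1) Z(1)], intro allI impI)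
    fix T assume T: "T \<subseteq> K" "\<forall>j<m. card {t \<in> T. col t = j} = \<kappa> j" "far_selection col K Z T"
    have ZT: "Z \<subseteq> T" and far: "\<And>z t. z \<in> Z \<Longrightarrow> t \<in> T \<Longrightarrow> t \<noteq> z \<Longrightarrow> v p / 32 \<le> d z t"
      using Z(3)[rule_format, OF T(1)] T(2,3) by blast+
    have finT: "finite T" using T(1) K P(1) by (meson finite_subset)
    have cT: "card T = card Opt"
    proof -
      have "card T = (\<Sum>j<m. card {t \<in> T. col t = j})"
        unfolding card_eq_sum using finT col T(1) K by (intro sum.group[symmetric]) auto
      also have "\<dots> = (\<Sum>j<m. card (?O j))" using T(2) Opt(2) by simp
      also have "\<dots> = card Opt"
        unfolding card_eq_sum using finOpt col Opt(1) by (intro sum.group) auto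
      finally show ?thesis .
    qed
    have neT: "T - {z} \<noteq> {}" for z
    proof
      assume "T - {z} = {}"
      then have "T \<subseteq> {z}" by auto
      from card_mono[OF _ this] show False using cT Opt(3) k by simp
    qed
    have "W = (\<Sum>z\<in>Z. v p)" using p(2) Z(2) by (simp add: w_def S_def)
    also have "\<dots> \<le> (\<Sum>z\<in>Z. 32 * nn_dist d T z)"
    proof (rule sum_mono)
      fix z assume "z \<in> Z"
      then have "v p / 32 \<le> nn_dist d T z" using finT neT far by (intro nn_dist_ge) auto
      then show "v p \<le> 32 * nn_dist d T z" by simp
    qed
    also have "\<dots> \<le> (\<Sum>z\<in>T. 32 * nn_dist d T z)"
      using ZT finT by (intro sum_mono2) (auto intro: nn_dist_nonneg)
    also have "\<dots> = 32 * sum_nn_div d T" by (simp add: sum_nn_div_eq sum_distrib_left)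
    finally have "W * (3 * ln (real k)) \<le> 32 * sum_nn_div d T * (3 * ln (real k))"
      using k by (intro mult_right_mono) auto
    then have "real m * (W * (3 * ln (real k))) \<le> real m * (32 * sum_nn_div d T * (3 * ln (real k)))"
      by (intro mult_left_mono) auto
    then show "sum_nn_div d Opt \<le> 96 * real m * ln (real k) * sum_nn_div d T"
      using opt by (simp add: algebra_simps)
  qed
qed

end

section \<open>Programs for farthest-first traversal\<close>

text \<open>
  Memory layout. Natural arrays 0 to 4 are the input and output arrays; 5: \<open>k\<close>; 6: the list of all
  points; 7: tag of a point (its colour, or \<open>m\<close> once it is selected); 8: indicator of the current subset \<open>Z\<close>;
  9: result of \<open>argmax\<close>, shifted by 1; 12: point processed by \<open>relax\<close>; 13: whether array \<open>0\<close> of the reals is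
  initialized; 14: index of the nearest centre; 15: number of centres; 16: the centres (\<open>2k\<close> per
  colour); 17: indicator of the centres; 18: number of points kept in a cell; 19 and 20: the coreset
  and its size; 25: \<open>2^(2k)\<close>; 26: the table \<open>v \<mapsto> v div 2\<close>; 27: bits of the code of \<open>Z\<close> still to be read;
  28: offset of the centres of the current colour; 29: the candidate; 30: whether a candidate has been
  recorded; 31: whether the current minimum is initialized; 35: \<open>2k\<close>; 36: the colour searched for. The
  remaining ones are loop counters. Real arrays: 0: distance to the centres found so far, or to \<open>Z\<close>;
  1: diversity of the candidate; 2: current minimum; 3: best diversity.
\<close>

abbreviation NEq :: "nexp \<Rightarrow> nexp \<Rightarrow> cond" where
  "NEq e f \<equiv> CAnd (CNot (NLess e f)) (CNot (NLess f e))"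

abbreviation COr :: "cond \<Rightarrow> cond \<Rightarrow> cond" where
  "COr b c \<equiv> CNot (CAnd (CNot b) (CNot c))"

definition argmax :: "nat \<Rightarrow> nat \<Rightarrow> prog" where
  "argmax L N = PSeq (VSet 9 (NConst 0)) (PFor 10 (V N)
     (let q = NGet L (V 10); b = NSub (V 9) (NConst 1) in
      PIf (CAnd (NEq (NGet 7 q) (V 36))
        (COr (NLess (V 9) (NConst 1)) (COr (NLess (NGet 8 b) (NGet 8 q))
           (CAnd (CNot (NLess (NGet 8 q) (NGet 8 b))) (RLess (RGet 0 b) (RGet 0 q))))))
        (VSet 9 (NAdd q (NConst 1))) PSkip))"

text \<open>The order used by \<open>argmax\<close>: members of \<open>Z\<close> win, then the
  distance decides. During the traversal array 8 is constantly 0 and only the distance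
  counts.\<close>

definition key_le :: "store \<Rightarrow> nat \<Rightarrow> nat \<Rightarrow> bool" where
  "key_le s q b \<longleftrightarrow> fst s 8 q < fst s 8 b \<or> fst s 8 q = fst s 8 b \<and> snd s 0 q \<le> snd s 0 b"

lemma key_le_refl [simp]: "key_le s q q"
  by (simp add: key_le_def)

lemma key_le_trans: "key_le s p q \<Longrightarrow> key_le s q r \<Longrightarrow> key_le s p r"
  by (auto simp: key_le_def)

lemma key_le_linear: "\<not> key_le s p q \<Longrightarrow> key_le s q p"
  by (auto simp: key_le_def)

lemma not_key_le: "\<not> key_le s q b \<longleftrightarrow>
    fst s 8 b < fst s 8 q \<or> \<not> fst s 8 q < fst s 8 b \<and> snd s 0 b < snd s 0 q"
  by (auto simp: key_le_def)

text \<open>The result 0 stands for an unsuccessful search; the witness \<open>t0\<close> excludes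
  it, so the predecessor of the result is a genuine entry.\<close>

lemma runs_argmax:
  assumes L: "L \<notin> {9, 10}" "N \<notin> {9, 10}"
    and ex: "t0 < fst s N 0" "fst s 7 (fst s L t0) = fst s 36 0"
  shows "runs \<delta> (argmax L N) s (250 * fst s N 0 + 30) (\<lambda>s'. same {9, 10} {} s s' \<and>
    (\<exists>b. fst s' 9 0 = Suc b \<and> b \<in> fst s L ` {..<fst s N 0} \<and> fst s 7 b = fst s 36 0 \<and>
      (\<forall>q\<in>fst s L ` {..<fst s N 0}. fst s 7 q = fst s 36 0 \<longrightarrow> key_le s q b)))"
  unfolding argmax_def Let_def
proof (rule runs_seq[where ?B1.0 = 3 and ?B2.0 = "250 * fst s N 0 + 20" and
     ?Q1.0 = "\<lambda>s'. s' = setn s 9 0"], goal_cases)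
  case 1
  show ?case by (rule runs_loop_free) (simp_all add: setn_def)
next
  case (2 s1)
  show ?case
  proof (rule runs_for[where B = 200 and N = "fst s N 0" and
      I = "\<lambda>i s'. (fst s' 9 0 = 0 \<and> (\<forall>t<i. fst s 7 (fst s L t) \<noteq> fst s 36 0)) \<or>
        (\<exists>b. fst s' 9 0 = Suc b \<and> b \<in> fst s L ` {..<i} \<and> fst s 7 b = fst s 36 0 \<and>
          (\<forall>t<i. fst s 7 (fst s L t) = fst s 36 0 \<longrightarrow> key_le s (fst s L t) b))"], goal_cases)
    case 1
    show ?case using 2 by simp
  next
    case (2 i s')
    have [simp]: "fst s' L = fst s L" "fst s' 7 = fst s 7" "fst s' 8 = fst s 8"
       "fst s' 36 = fst s 36" "snd s' 0 = snd s 0"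
      using 2(4) L \<open>s1 = _\<close> by (simp_all add: same_def)
    from 2(2) show ?case
    proof (elim disjE exE, goal_cases)
      case 1
      then show ?case using 2(3)
        by (intro runs_loop_free) (auto simp: less_Suc_eq)
    next
      case (2 b)
      then show ?case using \<open>fst s' 10 0 = i\<close> key_le_trans[of s _ b "fst s L i"] key_le_linear[of s "fst s L i" b]
        by (intro runs_loop_free) (auto simp: less_Suc_eq not_key_le[symmetric] simp del: not_less)
    qed
  next
    case (5 s')
    from 5(1) ex obtain b where b: "fst s' 9 0 = Suc b" "b \<in> fst s L ` {..<fst s N 0}"
      "fst s 7 b = fst s 36 0"
      "\<forall>t<fst s N 0. fst s 7 (fst s L t) = fst s 36 0 \<longrightarrow> key_le s (fst s L t) b" by blast
    have "same {9, 10} {} s s'" using 5(2) \<open>s1 = _\<close> by (simp add: same_def)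
    then show ?case using b by (intro conjI exI[of _ b]) auto
  qed (use 2 L in \<open>auto simp: same_def\<close>)
qed simp

text \<open>A new centre can only lower the stored distances. Flag 13 replaces an initial value of
  infinity, which the machine cannot express.\<close>

definition relax :: "nat \<Rightarrow> nat \<Rightarrow> prog" where
  "relax L N = PSeq
     (PFor 11 (V N) (let q = NGet L (V 11) in
        PIf (COr (NLess (V 13) (NConst 1)) (RLess (RDist q (V 12)) (RGet 0 q)))
          (PSeq (RSet 0 q (RDist q (V 12))) (NSet 14 q (V 15))) PSkip))
     (VSet 13 (NConst 1))"

lemma mods_relax: "nmods (relax L N) = {11, 13, 14}" "rmods (relax L N) = {0}"
  by (auto simp: relax_def Let_def)

lemma runs_relax:
  assumes L: "L \<notin> {11, 13, 14}" "N \<notin> {11, 13, 14}"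
  shows "runs \<delta> (relax L N) s (80 * fst s N 0 + 30) (\<lambda>s'. same {11, 13, 14} {0} s s' \<and> fst s' 13 0 = 1 \<and>
    (\<forall>q\<in>fst s L ` {..<fst s N 0}.
       if 0 < fst s 13 0 \<and> snd s 0 q \<le> \<delta> q (fst s 12 0)
       then snd s' 0 q = snd s 0 q \<and> fst s' 14 q = fst s 14 q
       else snd s' 0 q = \<delta> q (fst s 12 0) \<and> fst s' 14 q = fst s 15 0))"
  (is "runs _ _ _ _ ?Q")
  unfolding relax_def Let_def
proof (rule runs_seq[where ?B1.0 = "80 * fst s N 0 + 20" and ?B2.0 = 10 and
    ?Q1.0 = "\<lambda>s'. ?Q (setn s' 13 1)"], goal_cases)
  case 1
  let ?new = "\<lambda>s' q. if 0 < fst s 13 0 \<and> snd s 0 q \<le> \<delta> q (fst s 12 0)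
       then snd s' 0 q = snd s 0 q \<and> fst s' 14 q = fst s 14 q
       else snd s' 0 q = \<delta> q (fst s 12 0) \<and> fst s' 14 q = fst s 15 0"
  show ?case
  \<comment> \<open>The invariant speaks of the set of entries processed so far; a repeated entry
    does no harm since updating is idempotent.\<close>
  proof (rule runs_for[where B = 60 and N = "fst s N 0" and
      I = "\<lambda>i s'. fst s' 13 = fst s 13 \<and> (\<forall>q. if q \<in> fst s L ` {..<i} then ?new s' q
         else snd s' 0 q = snd s 0 q \<and> fst s' 14 q = fst s 14 q)"], goal_cases)
    case 1
    show ?case by simp
  next
    case (2 i s')
    have [simp]: "fst s' L = fst s L" "fst s' 12 = fst s 12" "fst s' 15 = fst s 15"
      using 2(4) L by (simp_all add: same_def)
    let ?q = "fst s L i"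
    have [simp]: "fst s' 13 = fst s 13" using 2(2) by simp
    have old: "if q \<in> fst s L ` {..<i} then ?new s' q
         else snd s' 0 q = snd s 0 q \<and> fst s' 14 q = fst s 14 q" for q using 2(2) by simp
    let ?b = "PIf (COr (NLess (V 13) (NConst 1)) (RLess (RDist (NGet L (V 11)) (V 12)) (RGet 0 (NGet L (V 11)))))
          (PSeq (RSet 0 (NGet L (V 11)) (RDist (NGet L (V 11)) (V 12))) (NSet 14 (NGet L (V 11)) (V 15))) PSkip"
    let ?s'' = "if 0 < fst s 13 0 \<and> snd s' 0 ?q \<le> \<delta> ?q (fst s 12 0) then s'
        else ((fst s')(14 := (fst s' 14)(?q := fst s 15 0)), (snd s')(0 := (snd s' 0)(?q := \<delta> ?q (fst s 12 0))))"
    have sem: "sem \<delta> ?b s' = ?s''"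
      using 2(3) L by auto
    have im: "fst s L ` {..<Suc i} = insert ?q (fst s L ` {..<i})" by (auto simp: lessThan_Suc)
    show ?case
    proof (rule runs_loop_free)
      show "fst (setn (sem \<delta> ?b s') 11 (Suc i)) 13 = fst s 13 \<and>
       (\<forall>q. if q \<in> fst s L ` {..<Suc i} then ?new (setn (sem \<delta> ?b s') 11 (Suc i)) q
         else snd (setn (sem \<delta> ?b s') 11 (Suc i)) 0 q = snd s 0 q \<and>
            fst (setn (sem \<delta> ?b s') 11 (Suc i)) 14 q = fst s 14 q)"
        unfolding sem im
      proof (intro conjI allI)
        fix q
        show "if q \<in> insert ?q (fst s L ` {..<i}) then ?new (setn ?s'' 11 (Suc i)) q
         else snd (setn ?s'' 11 (Suc i)) 0 q = snd s 0 q \<and>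
            fst (setn ?s'' 11 (Suc i)) 14 q = fst s 14 q"
          using old[of q] old[of ?q] by (auto split: if_splits)
      qed simp
    qed simp_all
  next
    case (5 s')
    then show ?case by (auto simp: same_def)
  qed (use L in \<open>auto simp: same_def\<close>)
next
  case (2 s1)
  show ?case
    by (rule runs_loop_free) (use 2 in \<open>auto simp: same_def split: if_splits\<close>)
qed simp

definition gonzalez :: prog where
  "gonzalez = PFor 22 (V 35) (PSeq (argmax 6 0)
     (PSeq (PSeq (VSet 12 (NSub (V 9) (NConst 1))) (PSeq (NSet 16 (V 15) (V 12)) (NSet 17 (V 12) (NConst 1))))
     (PSeq (relax 6 0) (VSet 15 (NAdd (V 15) (NConst 1))))))"

section \<open>Farthest-first traversal on point indices\<close>

locale index_metric = Metric_space "{..<n}" \<delta> for n :: nat and \<delta>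
begin

text \<open>The hypotheses of \<open>farthest_first_multiscale_net\<close> for the first
  \<open>i\<close> centres.\<close>

definition greedy_seq :: "nat set \<Rightarrow> (nat \<Rightarrow> nat) \<Rightarrow> nat \<Rightarrow> bool" where
  "greedy_seq A z i \<longleftrightarrow> (\<forall>j<i. z j \<in> A \<and>
     (0 < j \<longrightarrow> (\<forall>q\<in>A. \<exists>a<j. \<forall>a'<j. \<delta> q (z a) \<le> \<delta> (z j) (z a'))))"

lemma mods_argmax: "nmods (argmax L N) = {9, 10}" "rmods (argmax L N) = {}"
  by (auto simp: argmax_def Let_def)

lemma mods_gonzalez: "nmods gonzalez = {9, 10, 11, 12, 13, 14, 15, 16, 17, 22}" "rmods gonzalez = {0}"
  by (auto simp: gonzalez_def mods_argmax mods_relax)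

text \<open>Array 14 holds the absolute position \<open>p + a\<close> in array 16, so that cells of
  different colours have different numbers.\<close>

definition nearest_center :: "store \<Rightarrow> nat \<Rightarrow> nat \<Rightarrow> bool" where
  "nearest_center s p i \<longleftrightarrow> (\<forall>q<n. \<exists>a<i. fst s 14 q = p + a \<and> snd s 0 q = \<delta> q (fst s 16 (p + a)) \<and>
      (\<forall>a'<i. snd s 0 q \<le> \<delta> q (fst s 16 (p + a'))))"

definition gonzalez_inv :: "store \<Rightarrow> nat set \<Rightarrow> nat \<Rightarrow> store \<Rightarrow> bool" where
  "gonzalez_inv s0 A i s \<longleftrightarrow> (let p = fst s0 15 0 in
     fst s 15 0 = p + i \<and> fst s 13 0 = (if i = 0 then 0 else 1) \<and>
     (\<forall>x<p. fst s 16 x = fst s0 16 x) \<and>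
     greedy_seq A (\<lambda>j. fst s 16 (p + j)) i \<and>
     (0 < i \<longrightarrow> nearest_center s p i) \<and>
     (\<forall>q. fst s 17 q \<noteq> 0 \<longleftrightarrow> fst s0 17 q \<noteq> 0 \<or> (\<exists>j<i. q = fst s 16 (p + j))))"

text \<open>Since array 8 is 0, \<open>argmax\<close> maximizes the distance to the centres found so
  far among the points of the colour. In the first round these distances are not yet initialized,
  but any point of the colour may start the traversal.\<close>

lemma runs_gonzalez:
  assumes n: "fst s0 0 0 = n" and L: "\<And>i. i < n \<Longrightarrow> fst s0 6 i = i" and z: "fst s0 8 = (\<lambda>_. 0)"
    and A: "A = {q \<in> {..<n}. fst s0 7 q = fst s0 36 0}" "A \<noteq> {}" and init: "fst s0 13 0 = 0"
    and K: "fst s0 35 0 = K"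
  shows "runs \<delta> gonzalez s0 (K * (330 * n + 200) + 20) (\<lambda>s. gonzalez_inv s0 A K s \<and>
     same {9, 10, 11, 12, 13, 14, 15, 16, 17, 22} {0} s0 s)"
  unfolding gonzalez_def
proof (rule runs_for[where I = "gonzalez_inv s0 A" and N = K and B = "330 * n + 180"], goal_cases)
  case 1
  show ?case using init by (simp add: gonzalez_inv_def greedy_seq_def)
next
  case (2 i s)
  let ?p = "fst s0 15 0"
  note same = 2(4)[unfolded nmods.simps rmods.simps mods_argmax mods_relax]
  have fr: "fst s 0 = fst s0 0" "fst s 6 = fst s0 6" "fst s 7 = fst s0 7" "fst s 36 = fst s0 36"
     "fst s 8 = (\<lambda>_. 0)"
    using same z by (simp_all add: same_def)
  have im: "fst s 6 ` {..<fst s 0 0} = {..<n}" using fr L n by auto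
  obtain t0 where t0: "t0 < fst s 0 0" "fst s 7 (fst s 6 t0) = fst s 36 0" using A fr n L by auto
  have I: "fst s 15 0 = ?p + i" "fst s 13 0 = (if i = 0 then 0 else 1)" "\<forall>x<?p. fst s 16 x = fst s0 16 x"
    "greedy_seq A (\<lambda>j. fst s 16 (?p + j)) i" "0 < i \<Longrightarrow> nearest_center s ?p i"
    "\<And>q. fst s 17 q \<noteq> 0 \<longleftrightarrow> fst s0 17 q \<noteq> 0 \<or> (\<exists>j<i. q = fst s 16 (?p + j))"
    using 2(2) by (simp_all add: gonzalez_inv_def Let_def)
  show ?case
  proof (rule runs_seq[OF runs_argmax, where ?B2.0 = "80 * n + 100"], goal_cases)
    case (5 s1)
    then obtain b where b: "same {9, 10} {} s s1" "fst s1 9 0 = Suc b" "b < n" "fst s 7 b = fst s 36 0"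
      "\<And>q. q < n \<Longrightarrow> fst s 7 q = fst s 36 0 \<Longrightarrow> key_le s q b" unfolding im by blast
    have bA: "b \<in> A" using b A fr by simp
    have far: "snd s 0 q \<le> snd s 0 b" if "q \<in> A" for q
      using b(5)[of q] that A fr by (auto simp: key_le_def)
    show ?case
    proof (rule runs_seq[where ?B1.0 = 30 and ?B2.0 = "80 * n + 60" and ?Q1.0 = "\<lambda>s'. s' = sem \<delta>
        (PSeq (VSet 12 (NSub (V 9) (NConst 1))) (PSeq (NSet 16 (V 15) (V 12)) (NSet 17 (V 12) (NConst 1)))) s1"],
        goal_cases)
      case (2 s2)
      have s2: "fst s2 6 = fst s 6" "fst s2 0 = fst s 0" "fst s2 12 0 = b" "fst s2 13 = fst s 13"
        "fst s2 14 = fst s 14" "fst s2 15 = fst s 15" "snd s2 0 = snd s 0"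
        "fst s2 16 = (fst s 16)(?p + i := b)" "fst s2 17 = (fst s 17)(b := 1)"
        using b(1,2) 2 I(1) by (simp_all add: same_def)
      show ?case
      proof (rule runs_seq[OF runs_relax, where ?B2.0 = 20], goal_cases)
        case (3 s3)
        have s3: "fst s3 13 0 = 1" "fst s3 15 0 = ?p + i"
          "fst s3 16 = (fst s 16)(?p + i := b)" "fst s3 17 = (fst s 17)(b := 1)"
          using 3 I(1) s2 by (auto simp: same_def)
        have "fst s2 6 ` {..<fst s2 0 0} = {..<n}" using im s2 by simp
        then have D: "if 0 < i \<and> snd s 0 q \<le> \<delta> q b
           then snd s3 0 q = snd s 0 q \<and> fst s3 14 q = fst s 14 q
           else snd s3 0 q = \<delta> q b \<and> fst s3 14 q = ?p + i" if "q < n" for q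
          using 3 that I(1,2) s2 by auto
        let ?z = "\<lambda>j. fst s 16 (?p + j)" and ?z' = "\<lambda>j. ((fst s 16)(?p + i := b)) (?p + j)"
        have "greedy_seq A ?z' (Suc i)"
          unfolding greedy_seq_def
        proof (intro allI impI conjI ballI)
          fix j assume "j < Suc i"
          then show "?z' j \<in> A" using I(4) bA by (auto simp: greedy_seq_def less_Suc_eq)
        next
          fix j q assume j: "j < Suc i" "0 < j" and q: "q \<in> A"
          show "\<exists>a<j. \<forall>a'<j. \<delta> q (?z' a) \<le> \<delta> (?z' j) (?z' a')"
          proof (cases "j = i")
            case True
            then have near: "nearest_center s ?p i" using j I(5) by simp
            obtain a where a: "a < i" "snd s 0 q = \<delta> q (?z a)"
              using near q A unfolding nearest_center_def by blast
            have "\<delta> q (?z a) \<le> \<delta> b (?z a')" if "a' < i" for a'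
              using near far[OF q] a(2) b(3) that unfolding nearest_center_def by fastforce
            then show ?thesis using a(1) True by (intro exI[of _ a]) auto
          next
            case False
            then have "j < i" using j by simp
            with I(4) j q obtain a where "a < j" "\<forall>a'<j. \<delta> q (?z a) \<le> \<delta> (?z j) (?z a')"
              unfolding greedy_seq_def by blast
            then show ?thesis using \<open>j < i\<close> by (intro exI[of _ a]) auto
          qed
        qed
        moreover have "nearest_center s3 ?p (Suc i)"
          unfolding nearest_center_def s3(3)
        proof (intro allI impI)
          fix q assume q: "q < n"
          show "\<exists>a<Suc i. fst s3 14 q = ?p + a \<and> snd s3 0 q = \<delta> q (?z' a) \<and>
            (\<forall>a'<Suc i. snd s3 0 q \<le> \<delta> q (?z' a'))"
          proof (cases "0 < i \<and> snd s 0 q \<le> \<delta> q b")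
            case True
            with I(5) q obtain a where "a < i" "fst s 14 q = ?p + a" "snd s 0 q = \<delta> q (?z a)"
              "\<forall>a'<i. snd s 0 q \<le> \<delta> q (?z a')" unfolding nearest_center_def by blast
            with True D[OF q] show ?thesis by (intro exI[of _ a]) (auto simp: less_Suc_eq)
          next
            case False
            have "\<delta> q b \<le> \<delta> q (?z a')" if "a' < i" for a'
              using I(5) q that False unfolding nearest_center_def by fastforce
            with False D[OF q] show ?thesis by (intro exI[of _ i]) (auto simp: less_Suc_eq)
          qed
        qed
        moreover have "(\<exists>j<Suc i. q = ?z' j) \<longleftrightarrow> q = b \<or> (\<exists>j<i. q = ?z j)" for q
          by (auto simp: less_Suc_eq)
        then have "\<forall>q. fst s3 17 q \<noteq> 0 \<longleftrightarrow> fst s0 17 q \<noteq> 0 \<or> (\<exists>j<Suc i. q = ?z' j)"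
          using s3(4) I(6) by auto
        ultimately show ?case using s3 I(1,3)
          by (intro runs_loop_free) (simp_all add: gonzalez_inv_def Let_def nearest_center_def)
      qed (use s2 fr n in simp_all)
    qed ((intro runs_loop_free)?; simp)+
  qed (use t0 fr n in simp_all)
qed (use K in \<open>auto simp: same_def mods_argmax mods_relax algebra_simps\<close>)

end

section \<open>The coreset phase\<close>

definition keep_point :: prog where
  "keep_point = PSeq (NSet 19 (V 20) (V 23)) (VSet 20 (NAdd (V 20) (NConst 1)))"

text \<open>A centre is kept even if its cell is full, because a coreset contains its net. Per
  colour at most \<open>2k\<close> centres and \<open>k\<close> points for each of \<open>2k\<close>
  cells are kept.\<close>

definition keep_cells :: prog where
  "keep_cells = PFor 23 (V 0) (let p = NGet 14 (V 23) in
     PIf (NEq (NGet 7 (V 23)) (V 36))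
       (PIf (NLess (NGet 18 p) (V 5)) (PSeq (NSet 18 p (NAdd (NGet 18 p) (NConst 1))) keep_point)
          (PIf (NLess (NConst 0) (NGet 17 (V 23))) keep_point PSkip)) PSkip)"

definition coreset_phase :: prog where
  "coreset_phase = PFor 21 (NGet 0 (NConst 1)) (PSeq (PSeq (VSet 13 (NConst 0)) (VSet 36 (V 21)))
     (PSeq gonzalez keep_cells))"

section \<open>Correctness and size of the coreset\<close>

context index_metric
begin

definition kept :: "store \<Rightarrow> nat set" where
  "kept s = fst s 19 ` {..<fst s 20 0}"

lemma sem_keep_point:
  "sem \<delta> keep_point s = ((fst s)(19 := (fst s 19)(fst s 20 0 := fst s 23 0), 20 := (fst s 20)(0 := fst s 20 0 + 1)), snd s)"
  "loop_free keep_point" "pcost keep_point = 11" "nmods keep_point = {19, 20}" "rmods keep_point = {}"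
  by (auto simp: keep_point_def)

lemma kept_keep_point: "kept (sem \<delta> keep_point s) = insert (fst s 23 0) (kept s)"
  by (auto simp: kept_def sem_keep_point lessThan_Suc)

lemma mods_keep_cells: "nmods keep_cells = {18, 19, 20, 23}" "rmods keep_cells = {}"
  by (auto simp: keep_cells_def Let_def sem_keep_point)

text \<open>\<open>P\<close> is the set of cell numbers of the current colour. The size is only
  bounded from above, because a centre may be counted both as a centre and by the counter of its
  cell.\<close>

definition keep_inv :: "store \<Rightarrow> nat set \<Rightarrow> nat set \<Rightarrow> nat \<Rightarrow> nat \<Rightarrow> store \<Rightarrow> bool" where
  "keep_inv s0 A P k i s \<longleftrightarrow>
     kept s0 \<subseteq> kept s \<and> kept s \<subseteq> kept s0 \<union> {q \<in> A. q < i} \<and>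
     (\<forall>q\<in>A. q < i \<longrightarrow> q \<in> kept s \<or> k \<le> fst s 18 (fst s0 14 q)) \<and>
     (\<forall>p\<in>P. fst s 18 p \<le> card {x \<in> kept s \<inter> A. fst s0 14 x = p}) \<and>
     (\<forall>q\<in>A. q < i \<longrightarrow> fst s0 17 q \<noteq> 0 \<longrightarrow> q \<in> kept s) \<and>
     fst s 20 0 \<le> fst s0 20 0 + card {q \<in> A. q < i \<and> fst s0 17 q \<noteq> 0} + (\<Sum>p\<in>P. fst s 18 p) \<and>
     (\<forall>p\<in>P. fst s 18 p \<le> k) \<and> (\<forall>p. p \<notin> P \<longrightarrow> fst s 18 p = fst s0 18 p)"

lemma runs_keep_cells:
  assumes n: "fst s0 0 0 = n" and k: "fst s0 5 0 = k"
    and A: "A = {q \<in> {..<n}. fst s0 7 q = fst s0 36 0}" and new: "kept s0 \<inter> A = {}"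
    and P: "finite P" "\<And>q. q \<in> A \<Longrightarrow> fst s0 14 q \<in> P" "\<And>p. p \<in> P \<Longrightarrow> fst s0 18 p = 0"
  shows "runs \<delta> keep_cells s0 (150 * n + 30) (\<lambda>s. keep_inv s0 A P k n s \<and> same {18, 19, 20, 23} {} s0 s)"
  unfolding keep_cells_def
proof (rule runs_for[where I = "keep_inv s0 A P k" and N = n and B = 120], goal_cases)
  case 1
  show ?case using P by (simp add: keep_inv_def kept_def)
next
  case (2 i s)
  let ?body = "let p = NGet 14 (V 23) in
     PIf (NEq (NGet 7 (V 23)) (V 36))
       (PIf (NLess (NGet 18 p) (V 5)) (PSeq (NSet 18 p (NAdd (NGet 18 p) (NConst 1))) keep_point)
          (PIf (NLess (NConst 0) (NGet 17 (V 23))) keep_point PSkip)) PSkip"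
  let ?o = "fst s0 14 i"
  have fr: "fst s 5 = fst s0 5" "fst s 7 = fst s0 7" "fst s 36 = fst s0 36" "fst s 14 = fst s0 14" "fst s 17 = fst s0 17"
    using 2(4) by (simp_all add: same_def Let_def sem_keep_point)
  have sem: "sem \<delta> ?body s = (if i \<in> A then
      (if fst s 18 ?o < k then sem \<delta> keep_point (setc s) else
       if fst s0 17 i \<noteq> 0 then sem \<delta> keep_point s else s) else s)"
    if "setc = (\<lambda>s. ((fst s)(18 := (fst s 18)(?o := fst s 18 ?o + 1)), snd s))" for setc
    using 2(1,3) fr A k that by (auto simp: Let_def)
  note I = 2(2)[unfolded keep_inv_def]
  have finA: "finite A" using A by simp
  \<comment> \<open>\<open>i\<close> has not been seen before, so keeping it enlarges its cell by
    exactly one, in step with the counter.\<close>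
  have iK: "i \<notin> kept s" if "i \<in> A" using that I new by auto
  have kept_setn: "kept (setn s' 23 x) = kept s'" for s' x by (simp add: kept_def)
  have less: "{q \<in> A. q < Suc i} = (if i \<in> A then insert i {q \<in> A. q < i} else {q \<in> A. q < i})"
    by (auto simp: less_Suc_eq)
  have isc: "{q \<in> A. q < Suc i \<and> fst s0 17 q \<noteq> 0} =
     (if i \<in> A \<and> fst s0 17 i \<noteq> 0 then insert i {q \<in> A. q < i \<and> fst s0 17 q \<noteq> 0}
      else {q \<in> A. q < i \<and> fst s0 17 q \<noteq> 0})"
    by (auto simp: less_Suc_eq)
  show ?case
  proof (rule runs_loop_free)
    show "keep_inv s0 A P k (Suc i) (setn (sem \<delta> ?body s) 23 (Suc i))"
    proof (cases "i \<in> A")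
      case False
      then have "sem \<delta> ?body s = s" using sem by simp
      then show ?thesis using I False unfolding keep_inv_def less isc kept_setn
        by (auto simp: less_Suc_eq)
    next
      case iA: True
      have oP: "?o \<in> P" using P(2) iA by simp
      have keep: "kept s' = insert i (kept s)" if "s' = setn (sem \<delta> keep_point s'') 23 (Suc i)"
        "fst s'' 23 = fst s 23" "kept s'' = kept s" for s' s''
        using that kept_keep_point[of s''] 2(3) by (simp add: kept_setn)
      show ?thesis
      proof (cases "fst s 18 ?o < k")
        case True
        define s1 where "s1 = ((fst s)(18 := (fst s 18)(?o := fst s 18 ?o + 1)), snd s)"
        define s' where "s' = setn (sem \<delta> keep_point s1) 23 (Suc i)"
        have s': "setn (sem \<delta> ?body s) 23 (Suc i) = s'"
          unfolding s'_def s1_def using sem[OF refl] iA True by simp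
        have K: "kept s' = insert i (kept s)"
          by (rule keep[OF s'_def]) (simp_all add: s1_def kept_def)
        have a18: "fst s' 18 = (fst s 18)(?o := fst s 18 ?o + 1)" and a20: "fst s' 20 0 = fst s 20 0 + 1"
          by (simp_all add: s'_def s1_def sem_keep_point)
        have sumP: "(\<Sum>p\<in>P. fst s' 18 p) = (\<Sum>p\<in>P. fst s 18 p) + 1"
          using oP P(1) unfolding a18 by (subst (1 2) sum.remove[of _ ?o]) auto
        have cells: "card {x \<in> kept s \<inter> A. fst s0 14 x = ?o} + 1 = card {x \<in> insert i (kept s) \<inter> A. fst s0 14 x = ?o}"
        proof -
          have "{x \<in> insert i (kept s) \<inter> A. fst s0 14 x = ?o} = insert i {x \<in> kept s \<inter> A. fst s0 14 x = ?o}"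
            using iA by auto
          then show ?thesis using iK iA finA by simp
        qed
        have cells': "fst s' 18 p \<le> card {x \<in> insert i (kept s) \<inter> A. fst s0 14 x = p}" if "p \<in> P" for p
        proof (cases "p = ?o")
          case True
          then show ?thesis using cells I oP by (fastforce simp: a18)
        next
          case False
          have "fst s' 18 p \<le> card {x \<in> kept s \<inter> A. fst s0 14 x = p}" using I that False by (simp add: a18)
          also have "\<dots> \<le> card {x \<in> insert i (kept s) \<inter> A. fst s0 14 x = p}"
            using finA by (intro card_mono) auto
          finally show ?thesis .
        qed
        have "card {q \<in> A. q < i \<and> fst s0 17 q \<noteq> 0} \<le> card {q \<in> A. q < Suc i \<and> fst s0 17 q \<noteq> 0}"
          using finA by (intro card_mono) auto
        then have "fst s' 20 0 \<le> fst s0 20 0 + card {q \<in> A. q < Suc i \<and> fst s0 17 q \<noteq> 0} + (\<Sum>p\<in>P. fst s' 18 p)"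
          using I by (simp add: a20 sumP)
        then show ?thesis unfolding s' keep_inv_def K using I iA True oP cells' less
          by (auto simp: a18 less_Suc_eq)
      next
        case full: False
        show ?thesis
        proof (cases "fst s0 17 i \<noteq> 0")
          case True
          define s' where "s' = setn (sem \<delta> keep_point s) 23 (Suc i)"
          have s': "setn (sem \<delta> ?body s) 23 (Suc i) = s'"
            unfolding s'_def using sem[OF refl] iA True full by simp
          have K: "kept s' = insert i (kept s)"
            by (rule keep[OF s'_def]) simp_all
          have a18: "fst s' 18 = fst s 18" and a20: "fst s' 20 0 = fst s 20 0 + 1"
            by (simp_all add: s'_def sem_keep_point)
          have cells': "fst s' 18 p \<le> card {x \<in> insert i (kept s) \<inter> A. fst s0 14 x = p}" if "p \<in> P" for p
          proof -
            have "fst s' 18 p \<le> card {x \<in> kept s \<inter> A. fst s0 14 x = p}" using I that by (simp add: a18)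
            also have "\<dots> \<le> card {x \<in> insert i (kept s) \<inter> A. fst s0 14 x = p}"
              using finA by (intro card_mono) auto
            finally show ?thesis .
          qed
          have "card {q \<in> A. q < Suc i \<and> fst s0 17 q \<noteq> 0} = card {q \<in> A. q < i \<and> fst s0 17 q \<noteq> 0} + 1"
            unfolding isc using finA iA True by simp
          then have "fst s' 20 0 \<le> fst s0 20 0 + card {q \<in> A. q < Suc i \<and> fst s0 17 q \<noteq> 0} + (\<Sum>p\<in>P. fst s' 18 p)"
            using I by (simp add: a20 a18)
          then show ?thesis unfolding s' keep_inv_def K using I iA cells' less
            by (auto simp: a18 less_Suc_eq)
        next
          case False
          then have "sem \<delta> ?body s = s" using sem[OF refl] full iA by simp
          then show ?thesis using I False full unfolding keep_inv_def isc kept_setn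
            by (auto simp: less_Suc_eq)
        qed
      qed
    qed
  qed (simp_all add: Let_def sem_keep_point)
qed (use n in \<open>auto simp: same_def Let_def sem_keep_point\<close>)

definition centers :: "store \<Rightarrow> nat \<Rightarrow> nat \<Rightarrow> nat set" where
  "centers s k l = (\<lambda>i. fst s 16 (2 * k * l + i)) ` {..<2 * k}"

lemma coreset_of_run:
  assumes k: "0 < k" and A: "A = {q \<in> {..<n}. fst s1 7 q = fst s1 36 0}"
    and G: "gonzalez_inv s1 A (2 * k) s2" and p: "fst s1 15 0 = 2 * k * l"
    and o: "fst s2 14 = fst s2' 14" "fst s2 16 = fst s2' 16" "fst s2 17 = fst s2' 17"
    and Q: "keep_inv s2' A {2 * k * l..<2 * k * l + 2 * k} k n s3"
    and c: "fst s3 16 = fst s2 16"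
  shows "coreset k A (centers s3 k l) (kept s3)"
proof -
  let ?z = "\<lambda>i. fst s2 16 (2 * k * l + i)"
  have N: "centers s3 k l = ?z ` {..<2 * k}" by (simp add: centers_def c)
  have greedy: "greedy_seq A ?z (2 * k)" and near: "nearest_center s2 (2 * k * l) (2 * k)"
    and isc: "\<And>i. i < 2 * k \<Longrightarrow> fst s2 17 (?z i) \<noteq> 0"
    using G p k by (auto simp: gonzalez_inv_def Let_def)
  have zA: "?z i \<in> A" if "i < 2 * k" for i using greedy that by (auto simp: greedy_seq_def)
  have An: "A \<subseteq> {..<n}" "finite A" using A by auto
  have net: "multiscale_net A (?z ` {..<2 * k}) (2 * k)"
  proof (rule farthest_first_multiscale_net[OF An(1) _ zA])
    show "\<exists>j<i. \<forall>j'<i. \<delta> q (?z j) \<le> \<delta> (?z i) (?z j')" if "0 < i" "i < 2 * k" "q \<in> A" for i q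
      using greedy that unfolding greedy_seq_def by blast
  qed (use k in auto)
  have sub: "?z ` {..<2 * k} \<subseteq> kept s3"
  proof
    fix q assume "q \<in> ?z ` {..<2 * k}"
    then obtain i where i: "i < 2 * k" "q = ?z i" by auto
    then show "q \<in> kept s3" using zA[OF i(1)] isc[OF i(1)] An(1) Q o(3) unfolding keep_inv_def by auto
  qed
  let ?f = "\<lambda>q. fst s2 16 (fst s2 14 q)"
  have f: "?f q \<in> ?z ` {..<2 * k} \<and> (\<forall>z\<in>?z ` {..<2 * k}. \<delta> q (?f q) \<le> \<delta> q z)" and
    oP: "fst s2 14 q \<in> {2 * k * l..<2 * k * l + 2 * k}" if "q \<in> A" for q
  proof -
    from near that An(1) obtain a where a: "a < 2 * k" "fst s2 14 q = 2 * k * l + a" "snd s2 0 q = \<delta> q (?z a)"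
      "\<forall>a'<2 * k. snd s2 0 q \<le> \<delta> q (?z a')" unfolding nearest_center_def by blast
    then show "?f q \<in> ?z ` {..<2 * k} \<and> (\<forall>z\<in>?z ` {..<2 * k}. \<delta> q (?f q) \<le> \<delta> q z)"
      "fst s2 14 q \<in> {2 * k * l..<2 * k * l + 2 * k}" by auto
  qed
  have "q \<in> kept s3 \<or> k \<le> card {x \<in> kept s3 \<inter> A. ?f x = ?f q}" if q: "q \<in> A" for q
  proof (cases "q \<in> kept s3")
    case False
    then have "k \<le> fst s3 18 (fst s2 14 q)" using Q q An(1) o(1) unfolding keep_inv_def by fastforce
    also have "\<dots> \<le> card {x \<in> kept s3 \<inter> A. fst s2 14 x = fst s2 14 q}"
      using Q oP[OF q] o(1) unfolding keep_inv_def by simp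
    \<comment> \<open>The program counts cells by positions of centres, while \<open>coreset\<close>
      uses the centres themselves. Positions that hold the same point are merged, which only
      enlarges cells.\<close>
    also have "\<dots> \<le> card {x \<in> kept s3 \<inter> A. ?f x = ?f q}" using An(2) by (intro card_mono) auto
    finally show ?thesis by simp
  qed simp
  then show ?thesis unfolding coreset_def N using net sub f by (intro conjI exI[of _ ?f]) auto
qed

text \<open>The last two conjuncts let the next colour start with empty cells and unmarked
  points.\<close>

definition coreset_inv :: "(nat \<Rightarrow> nat) \<Rightarrow> nat \<Rightarrow> nat \<Rightarrow> store \<Rightarrow> bool" where
  "coreset_inv c k l s \<longleftrightarrow> fst s 15 0 = 2 * k * l \<and> kept s \<subseteq> {q \<in> {..<n}. c q < l} \<and>
     (\<forall>j<l. coreset k {q \<in> {..<n}. c q = j} (centers s k j) (kept s)) \<and>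
     fst s 20 0 \<le> l * (2 * k + 2 * k * k) \<and> (\<forall>p\<ge>2 * k * l. fst s 18 p = 0) \<and>
     (\<forall>q. fst s 17 q \<noteq> 0 \<longrightarrow> q < n \<and> c q < l)"

lemma mods_coreset_phase: "nmods coreset_phase =
    {9, 10, 11, 12, 13, 14, 15, 16, 17, 18, 19, 20, 21, 22, 23, 36}" "rmods coreset_phase = {0}"
  by (auto simp: coreset_phase_def mods_gonzalez mods_keep_cells)

lemma runs_coreset_phase:
  assumes n: "fst s0 0 0 = n" "fst s0 0 (Suc 0) = m" and L: "\<And>i. i < n \<Longrightarrow> fst s0 6 i = i"
    and z: "fst s0 8 = (\<lambda>_. 0)" "fst s0 15 0 = 0" "fst s0 17 = (\<lambda>_. 0)" "fst s0 18 = (\<lambda>_. 0)" "fst s0 20 0 = 0"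
    and k: "fst s0 5 0 = k" "fst s0 35 0 = 2 * k" "0 < k"
    and c: "\<And>i. i < n \<Longrightarrow> fst s0 7 i = c i" and A: "\<And>l. l < m \<Longrightarrow> {q \<in> {..<n}. c q = l} \<noteq> {}"
  shows "runs \<delta> coreset_phase s0 (m * (2 * k * (330 * n + 200) + 150 * n + 100) + 20)
     (\<lambda>s. coreset_inv c k m s \<and> same (nmods coreset_phase) (rmods coreset_phase) s0 s)"
  unfolding mods_coreset_phase
  unfolding coreset_phase_def
proof (rule runs_for[where I = "coreset_inv c k" and N = m and B = "2 * k * (330 * n + 200) + 150 * n + 80"], goal_cases)
  case 1
  show ?case using z by (simp add: coreset_inv_def kept_def)
next
  case (2 l s)
  have fr: "fst s 0 = fst s0 0" "fst s 6 = fst s0 6" "fst s 7 = fst s0 7" "fst s 8 = (\<lambda>_. 0)" "fst s 5 = fst s0 5" "fst s 35 = fst s0 35"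
    using 2(4) z by (simp_all add: same_def mods_gonzalez mods_keep_cells)
  note I = 2(2)[unfolded coreset_inv_def]
  let ?A = "{q \<in> {..<n}. c q = l}" and ?p = "2 * k * l"
  let ?s1 = "sem \<delta> (PSeq (VSet 13 (NConst 0)) (VSet 36 (V 21))) s"
  have A': "?A = {q \<in> {..<n}. fst ?s1 7 q = fst ?s1 36 0}" using fr c 2(3) by auto
  show ?case
  proof (rule runs_seq[where ?B1.0 = 20 and ?B2.0 = "2 * k * (330 * n + 200) + 150 * n + 55" and
      ?Q1.0 = "\<lambda>s'. s' = ?s1"], goal_cases)
    case (2 s1)
    show ?case unfolding 2
    proof (rule runs_seq[OF runs_gonzalez[where A = ?A and K = "2 * k"], where ?B2.0 = "150 * n + 35"], goal_cases)
      case (8 s2)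
      then have G: "gonzalez_inv ?s1 ?A (2 * k) s2" and
        sm: "same {9, 10, 11, 12, 13, 14, 15, 16, 17, 22} {0} ?s1 s2" by blast+
      have fr2: "fst s2 0 = fst s0 0" "fst s2 5 = fst s0 5" "fst s2 7 = fst s0 7" "fst s2 36 0 = l"
        "fst s2 18 = fst s 18" "fst s2 19 = fst s 19" "fst s2 20 = fst s 20"
        using sm fr \<open>fst s 21 0 = l\<close> by (simp_all add: same_def)
      have kept2: "kept s2 = kept s" by (simp add: kept_def fr2)
      have p1: "fst ?s1 15 0 = ?p" using I by simp
      have near: "nearest_center s2 ?p (2 * k)" and cen: "\<forall>x<?p. fst s2 16 x = fst s 16 x"
        and greedy: "greedy_seq ?A (\<lambda>j. fst s2 16 (?p + j)) (2 * k)" and p2: "fst s2 15 0 = ?p + 2 * k"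
        and isc: "\<And>q. fst s2 17 q \<noteq> 0 \<longleftrightarrow> fst s 17 q \<noteq> 0 \<or> (\<exists>j<2 * k. q = fst s2 16 (?p + j))"
        using G p1 k(3) by (simp_all add: gonzalez_inv_def Let_def)
      show ?case
      proof (rule runs_conseq[OF runs_keep_cells[where A = ?A and k = k and P = "{?p..<?p + 2 * k}"]], goal_cases)
        case (8 s3)
        then have Q: "keep_inv s2 ?A {?p..<?p + 2 * k} k n s3" and sm3: "same {18, 19, 20, 23} {} s2 s3" by blast+
        have fr3: "fst s3 15 = fst s2 15" "fst s3 16 = fst s2 16" "fst s3 17 = fst s2 17"
          using sm3 by (simp_all add: same_def)
        have cs: "coreset k ?A (centers s3 k l) (kept s3)"
          by (rule coreset_of_run[OF k(3) A' G p1 _ _ _ Q fr3(2)]) simp_all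
        have kk: "kept s \<subseteq> kept s3" "kept s3 \<subseteq> kept s \<union> ?A"
          using Q unfolding keep_inv_def kept2 by auto
        have "coreset k {q \<in> {..<n}. c q = j} (centers s3 k j) (kept s3)" if "j < Suc l" for j
        proof (cases "j = l")
          case True
          with cs show ?thesis by simp
        next
          case False
          with that have j: "j < l" by simp
          \<comment> \<open>The blocks of earlier colours lie below the offset \<open>?p\<close> and
            are not overwritten.\<close>
          have "2 * k * j + i < ?p" if "i < 2 * k" for i
          proof -
            have "2 * k * (j + 1) \<le> 2 * k * l" using j by (intro mult_le_mono) auto
            then show ?thesis using that by (simp add: algebra_simps)
          qed
          then have "centers s3 k j = centers s k j"
            using cen by (auto simp: centers_def fr3 image_iff)
          moreover have "coreset k {q \<in> {..<n}. c q = j} (centers s k j) (kept s)" using I j by blast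
          ultimately show ?thesis using coreset_mono[OF _ kk(1)] by simp
        qed
        moreover have "fst s3 20 0 \<le> Suc l * (2 * k + 2 * k * k)"
        proof -
          \<comment> \<open>A marked point of colour \<open>l\<close> was marked in this round,
            hence there are at most \<open>2 * k\<close> of them.\<close>
          have "{q \<in> ?A. q < n \<and> fst s2 17 q \<noteq> 0} \<subseteq> (\<lambda>j. fst s2 16 (?p + j)) ` {..<2 * k}"
          proof
            fix x assume x: "x \<in> {q \<in> ?A. q < n \<and> fst s2 17 q \<noteq> 0}"
            have "fst s 17 x \<noteq> 0 \<longrightarrow> c x < l" using I by blast
            then show "x \<in> (\<lambda>j. fst s2 16 (?p + j)) ` {..<2 * k}" using x isc[of x] by auto
          qed
          from card_mono[OF _ this] have "card {q \<in> ?A. q < n \<and> fst s2 17 q \<noteq> 0} \<le> card {..<2 * k}"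
            using card_image_le[of "{..<2 * k}" "\<lambda>j. fst s2 16 (?p + j)"] by simp
          moreover have "(\<Sum>p\<in>{?p..<?p + 2 * k}. fst s3 18 p) \<le> 2 * k * k"
            using sum_bounded_above[of "{?p..<?p + 2 * k}" "fst s3 18" k] Q by (simp add: keep_inv_def)
          moreover have "fst s2 20 0 \<le> l * (2 * k + 2 * k * k)" using I fr2 by simp
          ultimately show ?thesis using Q unfolding keep_inv_def by simp
        qed
        moreover have "fst s3 18 p = 0" if "2 * k * Suc l \<le> p" for p
        proof -
          have "p \<notin> {?p..<?p + 2 * k}" "?p \<le> p" using that by auto
          then have "fst s3 18 p = fst s2 18 p" using Q unfolding keep_inv_def by blast
          then show ?thesis using I fr2 \<open>?p \<le> p\<close> by simp
        qed
        moreover have "q < n \<and> c q < Suc l" if "fst s3 17 q \<noteq> 0" for q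
          using that isc[of q] I greedy by (auto simp: fr3 greedy_seq_def less_SucI)
        moreover have "kept s3 \<subseteq> {q \<in> {..<n}. c q < Suc l}"
          using kk I by fastforce
        moreover have "fst s3 15 0 = 2 * k * Suc l" using p2 fr3 by simp
        ultimately show ?case
          by (simp add: coreset_inv_def kept_def centers_def)
      next
        case 3
        show ?case using fr2 c by auto
      next
        case 4
        show ?case using I unfolding kept2 by fastforce
      next
        case (6 q)
        then obtain a where "a < 2 * k" "fst s2 14 q = ?p + a"
          using near unfolding nearest_center_def by blast
        then show ?case by simp
      qed (use I fr2 n k in \<open>simp_all\<close>)
    next
      case 4
      show ?case by (rule A')
    qed (use fr n L A k \<open>l < m\<close> in simp_all)
  qed ((intro runs_loop_free)?; simp)+
qed (use n in \<open>auto simp: same_def mods_gonzalez mods_keep_cells algebra_simps\<close>)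

end

section \<open>Preprocessing and enumeration of subsets\<close>

text \<open>Array 4 is both the work list and the colour column of the output: slot \<open>q\<close>
  is to receive a point of colour \<open>fst s 4 q\<close>. The number of slots is \<open>k\<close>,
  which the input does not contain explicitly.\<close>

definition fill_slots :: prog where
  "fill_slots = PFor 21 (NGet 0 (NConst 1)) (PFor 22 (NGet 1 (V 21))
     (PSeq (NSet 4 (V 5) (V 21)) (VSet 5 (NAdd (V 5) (NConst 1)))))"

definition slot_inv :: "(nat \<Rightarrow> nat) \<Rightarrow> nat \<Rightarrow> store \<Rightarrow> bool" where
  "slot_inv f b s \<longleftrightarrow> fst s 5 0 = b \<and> (\<forall>j. card {q. q < b \<and> fst s 4 q = j} = f j)"

lemma slot_inv_step:
  assumes "slot_inv f b s"
  shows "slot_inv (f(l := Suc (f l))) (Suc b)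
    ((fst s)(4 := (fst s 4)(b := l), 5 := (fst s 5)(0 := Suc b)), r)"
proof -
  have "{q. q < Suc b \<and> ((fst s 4)(b := l)) q = j} =
      (if j = l then insert b {q. q < b \<and> fst s 4 q = j} else {q. q < b \<and> fst s 4 q = j})" for j
    by (auto simp: less_Suc_eq)
  then show ?thesis using assms by (auto simp: slot_inv_def)
qed

lemma runs_fill_slots:
  assumes m: "fst s0 0 (Suc 0) = m" and \<kappa>: "\<And>l. l < m \<Longrightarrow> fst s0 1 l = \<kappa> l"
    and k: "k = (\<Sum>l<m. \<kappa> l)" and z: "fst s0 5 0 = 0"
  shows "runs \<delta> fill_slots s0 (m * (40 * k + 50) + 20)
    (\<lambda>s. slot_inv (\<lambda>j. if j < m then \<kappa> j else 0) k s \<and> same {4, 5, 21, 22} {} s0 s)"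
  unfolding fill_slots_def
proof (rule runs_for[where I = "\<lambda>l. slot_inv (\<lambda>j. if j < l then \<kappa> j else 0) (\<Sum>j<l. \<kappa> j)" and N = m and B = "40 * k + 30"],
    goal_cases)
  case 1
  show ?case using z by (simp add: slot_inv_def)
next
  case (2 l s)
  let ?S = "\<Sum>j<l. \<kappa> j"
  have "\<kappa> l \<le> k" unfolding k using 2(1) by (intro member_le_sum) auto
  have \<kappa>l: "fst s 1 l = \<kappa> l" using 2(1,4) \<kappa> by (simp add: same_def)
  show ?case
  proof (rule runs_for[where I = "\<lambda>i. slot_inv (\<lambda>j. if j < l then \<kappa> j else if j = l then i else 0) (?S + i)"
        and N = "\<kappa> l" and B = 20], goal_cases)
    case 1
    have "(\<lambda>j. if j < l then \<kappa> j else if j = l then 0 else 0) = (\<lambda>j. if j < l then \<kappa> j else 0)" by auto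
    with 2(2) show ?case by (simp add: slot_inv_def)
  next
    case (2 i s')
    have l: "fst s' 21 0 = l" using 2(4) \<open>fst s 21 0 = l\<close> by (simp add: same_def)
    have "?S + i = fst s' 5 0" using 2(2) by (simp add: slot_inv_def)
    have e: "(\<lambda>j. if j < l then \<kappa> j else if j = l then i else 0)(l := Suc i) =
        (\<lambda>j. if j < l then \<kappa> j else if j = l then Suc i else 0)" by auto
    show ?case
      by (rule runs_loop_free)
        (use slot_inv_step[OF 2(2), of l "snd s'"] e \<open>?S + i = _\<close> l in \<open>simp_all add: slot_inv_def\<close>)
  next
    case (5 s')
    have e: "(\<lambda>j. if j < l then \<kappa> j else if j = l then \<kappa> l else 0) = (\<lambda>j. if j < Suc l then \<kappa> j else 0)"
      by (rule ext) (simp add: less_Suc_eq)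
    show ?case using 5(1) unfolding e by (simp add: slot_inv_def add.commute)
  qed (use \<kappa>l \<open>\<kappa> l \<le> k\<close> \<open>fst s 21 0 = l\<close> in \<open>auto simp: same_def\<close>)
next
  case (5 s)
  then show ?case by (auto simp: k same_def)
qed (use m in \<open>auto simp: same_def algebra_simps\<close>)

definition copy_input :: prog where
  "copy_input = PFor 21 (V 0) (PSeq (NSet 6 (V 21) (V 21)) (NSet 7 (V 21) (NGet 2 (V 21))))"

lemma runs_copy_input:
  assumes n: "fst s0 0 0 = n"
  shows "runs \<delta> copy_input s0 (n * 40 + 20)
    (\<lambda>s. (\<forall>i<n. fst s 6 i = i \<and> fst s 7 i = fst s0 2 i) \<and> same {6, 7, 21} {} s0 s)"
  unfolding copy_input_def
proof (rule runs_for[where I = "\<lambda>i s. \<forall>j<i. fst s 6 j = j \<and> fst s 7 j = fst s0 2 j" and N = n and B = 20], goal_cases)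
  case (2 i s)
  have "fst s 2 = fst s0 2" using 2(4) by (simp add: same_def)
  then show ?case using 2 by (intro runs_loop_free) (auto simp: less_Suc_eq)
qed (use n in \<open>auto simp: same_def\<close>)

text \<open>The machine cannot divide, so halves are tabulated by writing \<open>v\<close> to the
  cells \<open>2 * v\<close> and \<open>2 * v + 1\<close>.\<close>

definition halving_table :: prog where
  "halving_table = PSeq (PSeq (VSet 35 (NAdd (V 5) (V 5))) (VSet 25 (NConst 1)))
     (PSeq (PFor 22 (V 35) (VSet 25 (NAdd (V 25) (V 25))))
       (PFor 24 (V 25) (PSeq (NSet 26 (NAdd (V 24) (V 24)) (V 24))
          (NSet 26 (NAdd (NAdd (V 24) (V 24)) (NConst 1)) (V 24)))))"

lemma runs_halving_table:
  assumes k: "fst s0 5 0 = k"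
  shows "runs \<delta> halving_table s0 (2 ^ (2 * k) * 100 + 100 * k + 100)
    (\<lambda>s. fst s 35 0 = 2 * k \<and> fst s 25 0 = 2 ^ (2 * k) \<and> (\<forall>v<2 ^ (2 * k). fst s 26 v = v div 2) \<and>
       same {22, 24, 25, 26, 35} {} s0 s)"
  unfolding halving_table_def
proof (rule runs_seq[where ?B1.0 = 20 and ?B2.0 = "2 ^ (2 * k) * 100 + 100 * k + 80" and
    ?Q1.0 = "\<lambda>s. fst s 35 0 = 2 * k \<and> fst s 25 0 = 1 \<and> same {25, 35} {} s0 s"], goal_cases)
  case 1
  show ?case using k by (intro runs_loop_free) (simp_all add: same_def)
next
  case (2 s1)
  show ?case
  proof (rule runs_seq[where ?B1.0 = "100 * k + 40" and ?B2.0 = "2 ^ (2 * k) * 100 + 40" and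
    ?Q1.0 = "\<lambda>s. fst s 35 0 = 2 * k \<and> fst s 25 0 = 2 ^ (2 * k) \<and> same {22, 25, 35} {} s0 s"], goal_cases)
    case 1
    show ?case
    proof (rule runs_for[where I = "\<lambda>i s. fst s 25 0 = 2 ^ i" and N = "2 * k" and B = 20], goal_cases)
      case (2 i s)
      then show ?case by (intro runs_loop_free) simp_all
    qed (use 2 in \<open>auto simp: same_def\<close>)
  next
    case (2 s2)
    show ?case
    proof (rule runs_for[where I = "\<lambda>i s. \<forall>v<2 * i. fst s 26 v = v div 2" and N = "2 ^ (2 * k)" and B = 40], goal_cases)
      case (2 i s)
      have "v < 2 * Suc i \<longleftrightarrow> v < 2 * i \<or> v = 2 * i \<or> v = Suc (2 * i)" for v by auto
      moreover have "i + i = 2 * i" by simp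
      ultimately show ?case using 2 by (intro runs_loop_free) auto
    qed (use 2 in \<open>auto simp: same_def\<close>)
  qed simp
qed simp

section \<open>Decoding a candidate subset\<close>

definition reset_marks :: prog where
  "reset_marks = PFor 22 (V 20) (let q = NGet 19 (V 22) in PSeq (NSet 7 q (NGet 2 q)) (NSet 8 q (NConst 0)))"

text \<open>Bit \<open>j\<close> of the code decides whether the \<open>j\<close>-th centre of the
  colour belongs to \<open>Z\<close>; \<open>v\<close> is odd iff twice its table entry is less than
  \<open>v\<close>. Now \<open>relax\<close> maintains the distances to \<open>Z\<close>.\<close>

definition decode_subset :: prog where
  "decode_subset = PSeq (PSeq (VSet 13 (NConst 0)) (VSet 27 (V 24)))
     (PFor 22 (V 35) (PSeq
        (PIf (NLess (NAdd (NGet 26 (V 27)) (NGet 26 (V 27))) (V 27))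
          (PSeq (PSeq (VSet 12 (NGet 16 (NAdd (V 28) (V 22)))) (NSet 8 (V 12) (NConst 1))) (relax 19 20)) PSkip)
        (VSet 27 (NGet 26 (V 27)))))"

context index_metric
begin

text \<open>Only coreset points are touched, so that the cost of a candidate is independent of
  \<open>n\<close>.\<close>

lemma runs_reset_marks:
  "runs \<delta> reset_marks s0 (fst s0 20 0 * 50 + 20)
    (\<lambda>s. (\<forall>q\<in>kept s0. fst s 7 q = fst s0 2 q \<and> fst s 8 q = 0) \<and> same {7, 8, 22} {} s0 s)"
  unfolding reset_marks_def Let_def
proof (rule runs_for[where I = "\<lambda>i s. \<forall>q\<in>fst s0 19 ` {..<i}. fst s 7 q = fst s0 2 q \<and> fst s 8 q = 0" and
    N = "fst s0 20 0" and B = 30], goal_cases)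
  case (2 i s)
  have "fst s 2 = fst s0 2" "fst s 19 = fst s0 19" using 2(4) by (simp_all add: same_def)
  then show ?case using 2 by (intro runs_loop_free) (auto simp: lessThan_Suc)
qed (auto simp: same_def kept_def)

text \<open>Nothing is said about distances to an empty \<open>Z\<close>, in accordance with the
  guard in \<open>far_selection\<close>.\<close>

definition marks_subset :: "store \<Rightarrow> nat set \<Rightarrow> nat set \<Rightarrow> bool" where
  "marks_subset s K Z \<longleftrightarrow> (\<forall>q\<in>K. fst s 8 q = (if q \<in> Z then 1 else 0) \<and>
     (Z \<noteq> {} \<longrightarrow> (\<exists>z\<in>Z. snd s 0 q = \<delta> q z) \<and> (\<forall>z\<in>Z. snd s 0 q \<le> \<delta> q z)))"

definition coded_subset :: "store \<Rightarrow> nat \<Rightarrow> nat set" where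
  "coded_subset s i = (\<lambda>j. fst s 16 (fst s 28 0 + j)) ` {j. j < i \<and> odd (fst s 24 0 div 2 ^ j)}"

lemma coded_subset_Suc:
  "coded_subset s (Suc i) = (if odd (fst s 24 0 div 2 ^ i)
     then insert (fst s 16 (fst s 28 0 + i)) (coded_subset s i) else coded_subset s i)"
  by (auto simp: coded_subset_def less_Suc_eq)

lemma runs_decode_subset:
  assumes K: "fst s0 35 0 = K" and cen: "\<And>i. i < K \<Longrightarrow> fst s0 16 (fst s0 28 0 + i) \<in> kept s0"
    and H: "\<And>v. v \<le> fst s0 24 0 \<Longrightarrow> fst s0 26 v = v div 2"
    and z: "\<forall>q\<in>kept s0. fst s0 8 q = 0"
  shows "runs \<delta> decode_subset s0 (K * (80 * fst s0 20 0 + 160) + 60)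
    (\<lambda>s. marks_subset s (kept s0) (coded_subset s0 K) \<and> same {8, 11, 12, 13, 14, 22, 27} {0} s0 s)"
  unfolding decode_subset_def
proof (rule runs_seq[where ?B1.0 = 20 and ?B2.0 = "K * (80 * fst s0 20 0 + 160) + 30" and
    ?Q1.0 = "\<lambda>s. fst s 13 0 = 0 \<and> fst s 27 0 = fst s0 24 0 \<and> same {13, 27} {} s0 s"], goal_cases)
  case 1
  show ?case by (intro runs_loop_free) (simp_all add: same_def)
next
  case (2 s1)
  let ?Z = "coded_subset s0"
  show ?case
  proof (rule runs_for[where I = "\<lambda>i s. fst s 27 0 = fst s0 24 0 div 2 ^ i \<and> fst s 13 0 = (if ?Z i = {} then 0 else 1) \<and>
        marks_subset s (kept s0) (?Z i)" and N = K and B = "80 * fst s0 20 0 + 140"], goal_cases)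
    case 1
    show ?case using 2 z by (simp add: marks_subset_def coded_subset_def same_def)
  next
    case (2 i s)
    have "same {8, 11, 12, 13, 14, 22, 27} {0} s1 s"
      using 2(4) by (rule same_mono) (auto simp: mods_relax)
    then have fr: "fst s 16 = fst s0 16" "fst s 19 = fst s0 19" "fst s 20 = fst s0 20" "fst s 26 = fst s0 26" "fst s 28 = fst s0 28"
      using \<open>_ \<and> _ \<and> same _ _ s0 s1\<close> by (simp_all add: same_def)
    let ?v = "fst s0 24 0 div 2 ^ i" and ?z = "fst s0 16 (fst s0 28 0 + i)"
    have v: "fst s0 26 ?v = ?v div 2" by (rule H) simp
    have kept: "fst s0 19 ` {..<fst s0 20 0} = kept s0" by (simp add: kept_def)
    have zK: "?z \<in> kept s0" by (rule cen[OF 2(1)])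
    have odd: "a div 2 + a div 2 < a \<longleftrightarrow> odd a" for a :: nat by (cases "even a") (auto elim!: evenE oddE)
    let ?Q = "\<lambda>s'. fst s' 27 0 = ?v \<and> fst s' 26 = fst s0 26 \<and> fst s' 13 0 = (if ?Z (Suc i) = {} then 0 else 1) \<and>
        marks_subset s' (kept s0) (?Z (Suc i))"
    show ?case
    proof (rule runs_seq[where ?B1.0 = "80 * fst s0 20 0 + 100" and ?B2.0 = 20 and ?Q1.0 = ?Q], goal_cases)
      case 1
      show ?case
      proof (rule runs_if[where B = "80 * fst s0 20 0 + 60"], goal_cases)
        case 1
        then have o: "odd ?v" using 2(2) fr v odd by simp
        show ?case
        proof (rule runs_seq[where ?B1.0 = 20 and ?B2.0 = "80 * fst s0 20 0 + 30" and ?Q1.0 = "\<lambda>s'. s' =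
            ((fst s)(12 := (fst s 12)(0 := ?z), 8 := (fst s 8)(?z := 1)), snd s)"], goal_cases)
          case 1
          show ?case using \<open>fst s 22 0 = i\<close> fr by (intro runs_loop_free) simp_all
        next
          case (2 s2)
          have s2: "fst s2 19 = fst s0 19" "fst s2 20 = fst s0 20" "fst s2 12 0 = ?z" "fst s2 13 = fst s 13"
            "snd s2 = snd s" "fst s2 8 = (fst s 8)(?z := 1)" "fst s2 27 = fst s 27" "fst s2 26 = fst s0 26"
            using 2 fr by simp_all
          show ?case
          proof (rule runs_conseq[OF runs_relax], goal_cases)
            case (3 s3)
            have fr3: "fst s3 27 = fst s2 27" "fst s3 26 = fst s2 26" "fst s3 8 = fst s2 8"
              using 3 by (simp_all add: same_def)
            have Zi: "?Z (Suc i) = insert ?z (?Z i)" using o by (simp add: coded_subset_Suc)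
            have I: "fst s 27 0 = ?v" "fst s 13 0 = (if ?Z i = {} then 0 else 1)" "marks_subset s (kept s0) (?Z i)"
              using \<open>fst s 27 0 = _ \<and> _\<close> by simp_all
            have D: "if ?Z i \<noteq> {} \<and> snd s 0 q \<le> \<delta> q ?z then snd s3 0 q = snd s 0 q else snd s3 0 q = \<delta> q ?z"
              if "q \<in> kept s0" for q
              using 3 that I(2) unfolding s2 kept by (auto split: if_splits)
            have "marks_subset s3 (kept s0) (?Z (Suc i))"
              unfolding marks_subset_def Zi
            proof (intro ballI conjI impI)
              fix q assume q: "q \<in> kept s0"
              show "fst s3 8 q = (if q \<in> insert ?z (?Z i) then 1 else 0)"
                using I(3) q by (simp add: fr3 s2 marks_subset_def)
              show "\<exists>z\<in>insert ?z (?Z i). snd s3 0 q = \<delta> q z"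
                using D[OF q] I(3) q by (fastforce simp: marks_subset_def split: if_splits)
              show "snd s3 0 q \<le> \<delta> q z" if "z \<in> insert ?z (?Z i)" for z
                using D[OF q] I(3) q that by (fastforce simp: marks_subset_def split: if_splits)
            qed
            then show ?case using 3 I(1) by (simp add: fr3 s2 Zi)
          qed (use s2 in simp_all)
        qed simp
      next
        case 2
        then have "\<not> odd ?v" using \<open>fst s 27 0 = _ \<and> _\<close> fr v odd by simp
        then have Zi: "?Z (Suc i) = ?Z i" by (simp add: coded_subset_Suc)
        show ?case using \<open>fst s 27 0 = _ \<and> _\<close> fr by (intro runs_loop_free) (simp_all add: Zi)
      qed simp
    next
      case (2 s4)
      have "?v div 2 = fst s0 24 0 div 2 ^ Suc i" by (simp add: div_mult2_eq[symmetric] mult.commute)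
      then show ?case using 2 v by (intro runs_loop_free) (simp_all add: marks_subset_def)
    qed simp
  next
    case (5 s)
    have "same {8, 11, 12, 13, 14, 22, 27} {0} s1 s"
      using 5(2) by (rule same_mono) (auto simp: mods_relax)
    then show ?case using 5 2 by (auto simp: same_def)
  qed (use 2 K in \<open>auto simp: same_def mods_relax algebra_simps\<close>)
qed simp

end

section \<open>Selecting and evaluating a candidate\<close>

definition select_far :: prog where
  "select_far = PFor 23 (V 5) (PSeq (VSet 36 (NGet 4 (V 23))) (PSeq (argmax 19 20)
     (PSeq (NSet 29 (V 23) (NSub (V 9) (NConst 1))) (NSet 7 (NSub (V 9) (NConst 1)) (NGet 0 (NConst 1))))))"

text \<open>Neighbours are told apart by slot numbers. Flag 31 replaces infinity, and the minimum
  starts at 0, which is the value of \<open>nn_dist\<close> in the absence of neighbours.\<close>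

definition eval_div :: prog where
  "eval_div = (let d = RDist (NGet 29 (V 32)) (NGet 29 (V 33)) in
     PSeq (RSet 1 (NConst 0) RZero)
     (PFor 32 (V 5) (PSeq (PSeq (RSet 2 (NConst 0) RZero) (VSet 31 (NConst 0)))
       (PSeq (PFor 33 (V 5)
         (PIf (CAnd (CNot (NEq (V 32) (V 33))) (COr (NLess (V 31) (NConst 1)) (RLess d (RGet 2 (NConst 0)))))
           (PSeq (RSet 2 (NConst 0) d) (VSet 31 (NConst 1))) PSkip))
       (RSet 1 (NConst 0) (RAdd (RGet 1 (NConst 0)) (RGet 2 (NConst 0))))))))"

definition record_best :: prog where
  "record_best = PIf (COr (NLess (V 30) (NConst 1)) (RLess (RGet 3 (NConst 0)) (RGet 1 (NConst 0))))
     (PSeq (PSeq (VSet 30 (NConst 1)) (RSet 3 (NConst 0) (RGet 1 (NConst 0))))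
        (PFor 34 (V 5) (NSet 3 (V 34) (NGet 29 (V 34))))) PSkip"

context index_metric
begin

definition selects :: "store \<Rightarrow> nat \<Rightarrow> store \<Rightarrow> bool" where
  "selects s0 i s \<longleftrightarrow> inj_on (fst s 29) {..<i} \<and>
     (\<forall>q<i. fst s 29 q \<in> kept s0 \<and> fst s0 7 (fst s 29 q) = fst s0 4 q \<and>
        (\<forall>x\<in>kept s0 - fst s 29 ` {..<i}. fst s0 7 x = fst s0 4 q \<longrightarrow> key_le s0 x (fst s 29 q)))"

text \<open>The order on the points does not change while the slots are filled, so each choice
  dominates every point of its colour that remains unselected in the end. \<open>enough\<close>
  prevents a search from failing.\<close>

lemma runs_select_far:
  assumes k: "fst s0 5 0 = k" and m: "fst s0 0 (Suc 0) = m"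
    and kept: "kept s0 \<subseteq> {..<n}" "\<And>x. x \<in> kept s0 \<Longrightarrow> fst s0 7 x < m"
    and slots: "\<And>q. q < k \<Longrightarrow> fst s0 4 q < m"
    and enough: "\<And>j. j < m \<Longrightarrow> card {q. q < k \<and> fst s0 4 q = j} \<le> card {x \<in> kept s0. fst s0 7 x = j}"
  shows "runs \<delta> select_far s0 (k * (250 * fst s0 20 0 + 100) + 20)
    (\<lambda>s. selects s0 k s \<and> same {7, 9, 10, 23, 29, 36} {} s0 s)"
  unfolding select_far_def
proof (rule runs_for[where I = "\<lambda>i s. selects s0 i s \<and> (\<forall>x\<in>kept s0. fst s 7 x = (if x \<in> fst s 29 ` {..<i} then m else fst s0 7 x))"
      and N = k and B = "250 * fst s0 20 0 + 80"], goal_cases)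
  case 1
  show ?case by (simp add: selects_def)
next
  case (2 i s)
  have "same {7, 9, 10, 23, 29, 36} {} s0 s"
    using 2(4) by (rule same_mono) (auto simp: mods_argmax)
  then have fr: "fst s 0 = fst s0 0" "fst s 4 = fst s0 4" "fst s 8 = fst s0 8" "snd s = snd s0"
    "fst s 19 = fst s0 19" "fst s 20 = fst s0 20"
    by (simp_all add: same_def fun_eq_iff)
  let ?T = "fst s 29" and ?j = "fst s0 4 i"
  have inj: "inj_on ?T {..<i}" and T: "\<And>q. q < i \<Longrightarrow> ?T q \<in> kept s0 \<and> fst s0 7 (?T q) = fst s0 4 q"
    and far: "\<And>q x. q < i \<Longrightarrow> x \<in> kept s0 - ?T ` {..<i} \<Longrightarrow> fst s0 7 x = fst s0 4 q \<Longrightarrow> key_le s0 x (?T q)"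
    and tag: "\<And>x. x \<in> kept s0 \<Longrightarrow> fst s 7 x = (if x \<in> ?T ` {..<i} then m else fst s0 7 x)"
    using 2(2) unfolding selects_def by blast+
  have jm: "?j < m" using slots 2(1) .
  have finK: "finite (kept s0)" using kept(1) finite_subset by blast
  \<comment> \<open>Slot \<open>i\<close> is itself a slot of its colour, so strictly fewer points
    of this colour have been used than are available.\<close>
  have "card {q. q < i \<and> fst s0 4 q = ?j} < card {q. q < k \<and> fst s0 4 q = ?j}"
    using 2(1) by (intro psubset_card_mono) auto
  also have "\<dots> \<le> card {x \<in> kept s0. fst s0 7 x = ?j}" using enough jm .
  finally have "card (?T ` {q. q < i \<and> fst s0 4 q = ?j}) < card {x \<in> kept s0. fst s0 7 x = ?j}"
    using card_image_le[of "{q. q < i \<and> fst s0 4 q = ?j}" ?T] by simp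
  moreover have "finite (?T ` {q. q < i \<and> fst s0 4 q = ?j})" by simp
  ultimately have "\<not> {x \<in> kept s0. fst s0 7 x = ?j} \<subseteq> ?T ` {q. q < i \<and> fst s0 4 q = ?j}"
    using card_mono leD by blast
  then obtain x where x: "x \<in> kept s0" "fst s0 7 x = ?j" "x \<notin> ?T ` {q. q < i \<and> fst s0 4 q = ?j}" by blast
  then have "x \<notin> ?T ` {..<i}" using T by auto
  then have x7: "fst s 7 x = ?j" using tag x by simp
  obtain t0 where t0: "t0 < fst s0 20 0" "fst s0 19 t0 = x" using x(1) by (auto simp: kept_def)
  show ?case
  proof (rule runs_seq[where ?B1.0 = 10 and ?B2.0 = "250 * fst s0 20 0 + 60" and ?Q1.0 = "\<lambda>s'. s' = setn s 36 ?j"], goal_cases)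
    case 1
    show ?case using fr 2(3) by (intro runs_loop_free) (simp_all add: setn_def)
  next
    case (2 s1)
    have s1: "fst s1 19 = fst s0 19" "fst s1 20 = fst s0 20" "fst s1 7 = fst s 7" "fst s1 36 0 = ?j"
       "fst s1 29 = ?T" "fst s1 0 = fst s0 0" "fst s1 23 = fst s 23" "\<And>x b. key_le s1 x b = key_le s0 x b"
      using 2 fr by (simp_all add: key_le_def)
    show ?case
    proof (rule runs_seq[OF runs_argmax[where ?t0.0 = t0], where ?B2.0 = 30], goal_cases)
      case (5 s2)
      then have "\<exists>b. fst s2 9 0 = Suc b \<and> b \<in> kept s0 \<and> fst s 7 b = ?j \<and>
        (\<forall>q\<in>kept s0. fst s 7 q = ?j \<longrightarrow> key_le s0 q b)"
        unfolding s1 kept_def by (rule conjunct2)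
      then obtain b where b: "same {9, 10} {} s1 s2" "fst s2 9 0 = Suc b" "b \<in> kept s0" "fst s 7 b = ?j"
        "\<And>q. q \<in> kept s0 \<Longrightarrow> fst s 7 q = ?j \<Longrightarrow> key_le s0 q b" using conjunct1[OF 5] by metis
      have bT: "b \<notin> ?T ` {..<i}" "fst s0 7 b = ?j" using tag[OF b(3)] b(4) jm by (auto split: if_splits)
      let ?T' = "?T(i := b)"
      have im': "?T' ` {..<Suc i} = insert b (?T ` {..<i})" by (auto simp: lessThan_Suc)
      have s2: "fst s2 29 = ?T" "fst s2 0 = fst s0 0" "fst s2 7 = fst s 7" "fst s2 23 0 = i"
        using b(1) s1 \<open>fst s 23 0 = i\<close> by (simp_all add: same_def)
      have "inj_on ?T' {..<Suc i}"
        unfolding lessThan_Suc using inj bT(1) by (auto simp: inj_on_def)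
      moreover have "?T' q \<in> kept s0 \<and> fst s0 7 (?T' q) = fst s0 4 q" if "q < Suc i" for q
        using T b(3) bT(2) that by (auto simp: less_Suc_eq)
      moreover have "key_le s0 x (?T' q)"
        if "q < Suc i" "x \<in> kept s0 - ?T' ` {..<Suc i}" "fst s0 7 x = fst s0 4 q" for q x
      proof (cases "q = i")
        case True
        have "fst s 7 x = ?j" using that tag True unfolding im' by auto
        with b(5) that True show ?thesis by simp
      next
        case False
        then show ?thesis using far[of q x] that unfolding im' by auto
      qed
      moreover have "((fst s 7)(b := m)) x = (if x \<in> ?T' ` {..<Suc i} then m else fst s0 7 x)" if "x \<in> kept s0" for x
        unfolding im' using tag that by auto
      ultimately show ?case using b(2) s2 m
        by (intro runs_loop_free) (simp_all add: selects_def)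
    qed (use t0 x7 s1 in simp_all)
  qed simp
next
  case (5 s)
  have "same {7, 9, 10, 23, 29, 36} {} s0 s"
    using 5(2) by (rule same_mono) (auto simp: mods_argmax)
  with 5 show ?case by simp
qed (use k in \<open>auto simp: same_def mods_argmax algebra_simps\<close>)

section \<open>Evaluating a candidate and recording the best one\<close>

lemma nn_dist_insert:
  assumes "finite S" "q \<noteq> p" "S - {p} \<noteq> {}"
  shows "nn_dist d (insert q S) p = min (d p q) (nn_dist d S p)"
proof -
  have "insert q S - {p} = insert q (S - {p})" using assms by auto
  then show ?thesis using assms by (simp add: nn_dist_def)
qed

lemma runs_eval_div:
  assumes k: "fst s0 5 0 = k"
  shows "runs \<delta> eval_div s0 (k * (k * 100 + 100) + 50)
    (\<lambda>s. snd s 1 0 = sum_nn_div (\<lambda>i j. \<delta> (fst s0 29 i) (fst s0 29 j)) {..<k} \<and> same {31, 32, 33} {1, 2} s0 s)"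
  unfolding eval_div_def Let_def
proof (rule runs_seq[where ?B1.0 = 10 and ?B2.0 = "k * (k * 100 + 100) + 30" and
    ?Q1.0 = "\<lambda>s. snd s 1 0 = 0 \<and> same {} {1} s0 s"], goal_cases)
  case 1
  show ?case by (intro runs_loop_free) (simp_all add: same_def)
next
  case (2 s1)
  let ?d = "\<lambda>i j. \<delta> (fst s0 29 i) (fst s0 29 j)"
  show ?case
  proof (rule runs_for[where I = "\<lambda>i s. snd s 1 0 = (\<Sum>p<i. nn_dist ?d {..<k} p)" and N = k and B = "k * 100 + 85"], goal_cases)
    case (2 i s)
    show ?case
    proof (rule runs_seq[where ?B1.0 = 20 and ?B2.0 = "k * 100 + 60" and
       ?Q1.0 = "\<lambda>s'. snd s' 2 0 = 0 \<and> fst s' 31 0 = 0 \<and> same {31} {2} s s'"], goal_cases)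
      case 1
      show ?case by (intro runs_loop_free) (simp_all add: same_def)
    next
      case (2 s2)
      have fr: "fst s2 5 = fst s0 5" "fst s2 29 = fst s0 29" "fst s2 32 0 = i" "snd s2 1 = snd s 1"
        using 2 \<open>same _ _ s1 s\<close> \<open>_ \<and> same _ _ s0 s1\<close> \<open>fst s 32 0 = i\<close> by (simp_all add: same_def)
      show ?case
      proof (rule runs_seq[where ?B1.0 = "k * 100 + 30" and ?B2.0 = 20 and
         ?Q1.0 = "\<lambda>s'. snd s' 2 0 = nn_dist ?d {..<k} i \<and> same {31, 33} {2} s2 s'"], goal_cases)
        case 1
        show ?case
        proof (rule runs_for[where I = "\<lambda>q s. snd s 2 0 = nn_dist ?d {..<q} i \<and> fst s 31 0 = (if {..<q} - {i} = {} then 0 else 1)"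
            and N = k and B = 80], goal_cases)
          case 1
          show ?case using 2 by (simp add: nn_dist_def)
        next
          case (2 q s)
          have fr2: "fst s 29 = fst s0 29" "fst s 32 0 = i" using 2(4) fr by (simp_all add: same_def)
          show ?case
          proof (cases "q = i")
            case True
            then have "{..<Suc q} - {i} = {..<q} - {i}" by auto
            then show ?thesis using 2 fr2 True
              by (intro runs_loop_free) (simp_all add: nn_dist_def)
          next
            case False
            have S: "{..<Suc q} = insert q {..<q}" by auto
            have ne: "{..<Suc q} - {i} \<noteq> {}" using False by auto
            show ?thesis
            proof (cases "{..<q} - {i} = {}")
              case True
              then have "{..<Suc q} - {i} = {q}" using False unfolding S by blast
              moreover have "i < q \<or> q < i" using False by auto
              ultimately show ?thesis using 2 fr2 True
                by (intro runs_loop_free) (simp_all add: nn_dist_def)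
            next
              case F: False
              have "nn_dist ?d {..<Suc q} i = min (?d i q) (nn_dist ?d {..<q} i)"
                unfolding S using False F by (intro nn_dist_insert) auto
              then show ?thesis using 2 fr2 False F ne
                by (intro runs_loop_free) (auto simp: min_def)
            qed
          qed
        qed (use fr k in \<open>auto simp: same_def\<close>)
      next
        case (2 s3)
        then have "snd s3 1 0 = (\<Sum>p<i. nn_dist ?d {..<k} p)"
          using fr \<open>snd s 1 0 = _\<close> by (simp add: same_def)
        then show ?case using 2 by (intro runs_loop_free) simp_all
      qed simp
    qed simp
  qed (use 2 k in \<open>auto simp: same_def sum_nn_div_eq algebra_simps\<close>)
qed simp

lemma runs_record_best:
  assumes k: "fst s0 5 0 = k"
  shows "runs \<delta> record_best s0 (k * 50 + 100)
    (\<lambda>s. same {3, 30, 34} {3} s0 s \<and>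
      (if fst s0 30 0 = 0 \<or> snd s0 3 0 < snd s0 1 0
       then fst s 30 0 = 1 \<and> snd s 3 0 = snd s0 1 0 \<and> (\<forall>q<k. fst s 3 q = fst s0 29 q)
       else s = s0))"
  unfolding record_best_def
proof (rule runs_if[where B = "k * 50 + 60"], goal_cases)
  case 1
  then have c: "fst s0 30 0 = 0 \<or> snd s0 3 0 < snd s0 1 0" by simp
  show ?case
  proof (rule runs_seq[where ?B1.0 = 20 and ?B2.0 = "k * 50 + 30" and
    ?Q1.0 = "\<lambda>s. fst s 30 0 = 1 \<and> snd s 3 0 = snd s0 1 0 \<and> same {30} {3} s0 s"], goal_cases)
    case 1
    show ?case by (intro runs_loop_free) (simp_all add: same_def)
  next
    case (2 s1)
    show ?case
    proof (rule runs_for[where I = "\<lambda>i s. \<forall>q<i. fst s 3 q = fst s0 29 q" and N = k and B = 20], goal_cases)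
      case (2 i s)
      have "fst s 29 = fst s0 29" using 2(4) \<open>_ \<and> _ \<and> same _ _ s0 s1\<close> by (simp add: same_def)
      then show ?case using 2 by (intro runs_loop_free) (auto simp: less_Suc_eq)
    qed (use 2 k c in \<open>auto simp: same_def\<close>)
  qed simp
next
  case 2
  then have "\<not> (fst s0 30 0 = 0 \<or> snd s0 3 0 < snd s0 1 0)" by simp
  then show ?case by (intro runs_loop_free) simp_all
qed simp

end

section \<open>Searching through all candidates\<close>

definition candidate :: prog where
  "candidate = PSeq reset_marks (PSeq decode_subset (PSeq select_far (PSeq eval_div record_best)))"

definition search :: prog where
  "search = PSeq (VSet 28 (NConst 0)) (PFor 21 (NGet 0 (NConst 1))
     (PSeq (PFor 24 (V 25) candidate) (VSet 28 (NAdd (V 28) (V 35)))))"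

context index_metric
begin

lemma mods_candidate: "nmods candidate = {3, 7, 8, 9, 10, 11, 12, 13, 14, 22, 23, 27, 29, 30, 31, 32, 33, 34, 36}"
  "rmods candidate = {0, 1, 2, 3}"
  by (auto simp: candidate_def reset_marks_def decode_subset_def select_far_def eval_div_def record_best_def
      mods_relax mods_argmax Let_def)

text \<open>What the earlier phases leave behind. It refers only to arrays outside
  \<open>search_mods\<close>, which makes it invariant under the search.\<close>

definition search_ready :: "nat \<Rightarrow> nat \<Rightarrow> (nat \<Rightarrow> nat) \<Rightarrow> store \<Rightarrow> bool" where
  "search_ready m k c s \<longleftrightarrow> fst s 0 (Suc 0) = m \<and> fst s 5 0 = k \<and>
     (\<forall>q\<in>kept s. fst s 2 q = c q \<and> c q < m) \<and> (\<forall>q<k. fst s 4 q < m) \<and>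
     fst s 35 0 = 2 * k \<and> fst s 25 0 = 2 ^ (2 * k) \<and> (\<forall>v<2 ^ (2 * k). fst s 26 v = v div 2) \<and>
     kept s \<subseteq> {..<n} \<and> (\<forall>l<m. centers s k l \<subseteq> kept s) \<and>
     (\<forall>j<m. card {q. q < k \<and> fst s 4 q = j} \<le> card {x \<in> kept s. c x = j})"

definition fills_slots :: "store \<Rightarrow> nat \<Rightarrow> (nat \<Rightarrow> nat) \<Rightarrow> (nat \<Rightarrow> nat) \<Rightarrow> bool" where
  "fills_slots s k c T \<longleftrightarrow> inj_on T {..<k} \<and> (\<forall>q<k. T q \<in> kept s \<and> c (T q) = fst s 4 q)"

definition best_so_far :: "store \<Rightarrow> nat \<Rightarrow> (nat \<Rightarrow> nat) \<Rightarrow> store \<Rightarrow> bool" where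
  "best_so_far s0 k c s \<longleftrightarrow> fst s 30 0 = 0 \<or>
     fills_slots s0 k c (fst s 3) \<and> snd s 3 0 = sum_nn_div \<delta> (fst s 3 ` {..<k})"

text \<open>Existential in \<open>T\<close> because the program forgets selections that are not
  best. The property persists since the recorded value never decreases.\<close>

definition tried :: "store \<Rightarrow> nat \<Rightarrow> (nat \<Rightarrow> nat) \<Rightarrow> nat set \<Rightarrow> store \<Rightarrow> bool" where
  "tried s0 k c Z s \<longleftrightarrow> fst s 30 0 \<noteq> 0 \<and> (\<exists>T. fills_slots s0 k c T \<and>
     far_selection c (kept s0) Z (T ` {..<k}) \<and> sum_nn_div \<delta> (T ` {..<k}) \<le> snd s 3 0)"

definition search_mods :: "nat set" where
  "search_mods = {3, 7, 8, 9, 10, 11, 12, 13, 14, 21, 22, 23, 24, 27, 28, 29, 30, 31, 32, 33, 34, 36}"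

lemma search_ready_cong:
  assumes "same search_mods B s s'"
  shows "search_ready m k c s' \<longleftrightarrow> search_ready m k c s" "kept s' = kept s" "centers s' k l = centers s k l"
     "fills_slots s' k c T \<longleftrightarrow> fills_slots s k c T"
  using assms by (simp_all add: same_def search_mods_def search_ready_def kept_def centers_def fills_slots_def)

text \<open>\<open>key_le\<close> compares membership in \<open>Z\<close> before the distance to
  \<open>Z\<close>, which is the precedence in \<open>far_selection\<close>. The point of
  \<open>Z\<close> at which the distance of \<open>x\<close> is attained is the witness.\<close>

lemma far_selection_of_selects:
  assumes sel: "selects s k s'" and marks: "marks_subset s (kept s) Z"
    and c: "\<And>x. x \<in> kept s \<Longrightarrow> fst s 7 x = c x"
  shows "far_selection c (kept s) Z (fst s' 29 ` {..<k})"
  unfolding far_selection_def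
proof (intro ballI impI)
  fix x t assume x: "x \<in> kept s - fst s' 29 ` {..<k}" and t: "t \<in> fst s' 29 ` {..<k}" and xt: "c x = c t"
  obtain q where q: "q < k" "t = fst s' 29 q" using t by auto
  have tK: "t \<in> kept s" and tc: "fst s 7 t = fst s 4 q" using sel q unfolding selects_def by blast+
  have "fst s 7 x = fst s 4 q" using xt c x tK tc by auto
  then have key: "key_le s x t" using sel q x unfolding selects_def by blast
  have mx: "fst s 8 x = (if x \<in> Z then 1 else 0)" "Z \<noteq> {} \<Longrightarrow> \<exists>z\<in>Z. snd s 0 x = \<delta> x z"
    and mt: "fst s 8 t = (if t \<in> Z then 1 else 0)" "\<And>z. z \<in> Z \<Longrightarrow> snd s 0 t \<le> \<delta> t z"
    using marks x tK unfolding marks_subset_def by blast+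
  show "(x \<in> Z \<longrightarrow> t \<in> Z) \<and> (Z \<noteq> {} \<longrightarrow> (x \<in> Z) = (t \<in> Z) \<longrightarrow> (\<exists>z\<in>Z. \<forall>z'\<in>Z. \<delta> x z \<le> \<delta> t z'))"
  proof (intro conjI impI)
    show "t \<in> Z" if "x \<in> Z" using key that mx(1) mt(1) by (auto simp: key_le_def split: if_splits)
    assume Z: "Z \<noteq> {}" "(x \<in> Z) = (t \<in> Z)"
    then have D: "snd s 0 x \<le> snd s 0 t" using key mx(1) mt(1) by (auto simp: key_le_def)
    obtain z where z: "z \<in> Z" "snd s 0 x = \<delta> x z" using mx(2)[OF Z(1)] by blast
    show "\<exists>z\<in>Z. \<forall>z'\<in>Z. \<delta> x z \<le> \<delta> t z'"
      using z(1) order_trans[OF D mt(2)] unfolding z(2) by blast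
  qed
qed

definition candidate_time :: "nat \<Rightarrow> nat \<Rightarrow> nat" where
  "candidate_time k N = (N * 50 + 20) + (2 * k * (80 * N + 160) + 60) + (k * (250 * N + 100) + 20) +
     (k * (k * 100 + 100) + 50) + (k * 50 + 100)"

lemma runs_candidate:
  assumes R: "search_ready m k c s" and code: "fst s 24 0 < 2 ^ (2 * k)" and l: "fst s 28 0 = 2 * k * l" "l < m"
    and best: "best_so_far s k c s"
  shows "runs \<delta> candidate s (candidate_time k (fst s 20 0))
    (\<lambda>s'. best_so_far s k c s' \<and> tried s k c (coded_subset s (2 * k)) s' \<and> (\<forall>Z. tried s k c Z s \<longrightarrow> tried s k c Z s'))"
  unfolding candidate_def
proof (rule runs_seq[OF runs_reset_marks, where ?B2.0 = "(2 * k * (80 * fst s 20 0 + 160) + 60) + (k * (250 * fst s 20 0 + 100) + 20) +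
     (k * (k * 100 + 100) + 50) + (k * 50 + 100)"], goal_cases)
  case (1 s1)
  note R' = R[unfolded search_ready_def]
  let ?N = "fst s 20 0" and ?Z = "coded_subset s (2 * k)"
  have s1: "same {7, 8, 22} {} s s1" "\<forall>q\<in>kept s. fst s1 7 q = c q \<and> fst s1 8 q = 0" using 1 R' by auto
  have k1: "kept s1 = kept s" and cs1: "coded_subset s1 = coded_subset s" and N1: "fst s1 20 = fst s 20"
    using s1(1) by (simp_all add: kept_def coded_subset_def same_def fun_eq_iff)
  have Zs: "fst s1 16 (fst s1 28 0 + i) \<in> kept s1" if "i < 2 * k" for i
  proof -
    have "centers s k l \<subseteq> kept s" using R' l by blast
    then show ?thesis using that l s1(1) unfolding k1 by (auto simp: centers_def same_def)
  qed
  show ?case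
  proof (rule runs_seq[OF runs_decode_subset[where K = "2 * k", OF _ Zs],
       where ?B2.0 = "(k * (250 * ?N + 100) + 20) + (k * (k * 100 + 100) + 50) + (k * 50 + 100)"], goal_cases)
    case (5 s2)
    then have s2: "marks_subset s2 (kept s) ?Z" and sm2: "same {8, 11, 12, 13, 14, 22, 27} {0} s1 s2"
      unfolding k1 cs1 by blast+
    have k2: "kept s2 = kept s" using sm2 k1 by (simp add: kept_def same_def)
    have fr2: "fst s2 20 = fst s 20" "fst s2 4 = fst s 4" "fst s2 7 = fst s1 7" "fst s2 5 = fst s 5" "fst s2 0 = fst s 0"
      using sm2 s1(1) by (simp_all add: same_def)
    have c2: "fst s2 7 x = c x" if "x \<in> kept s2" for x using that s1(2) fr2 k2 by simp
    have cols: "{x \<in> kept s. fst s1 7 x = j} = {x \<in> kept s. c x = j}" for j using s1(2) by auto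
    show ?case
    proof (rule runs_seq[OF runs_select_far[where k = k and m = m],
        where ?B2.0 = "(k * (k * 100 + 100) + 50) + (k * 50 + 100)"], goal_cases)
      case (7 s3)
      then have s3: "selects s2 k s3" and sm3: "same {7, 9, 10, 23, 29, 36} {} s2 s3" by blast+
      let ?T = "fst s3 29"
      have fill: "fills_slots s k c ?T"
        using s3 c2 unfolding selects_def fills_slots_def k2 fr2 by auto
      have far: "far_selection c (kept s) ?Z (?T ` {..<k})"
        using far_selection_of_selects[OF s3 _ c2] s2 unfolding k2 by blast
      \<comment> \<open>The evaluation runs over slots; injectivity turns its result into the
        diversity of a set of points.\<close>
      have sd: "sum_nn_div (\<lambda>i j. \<delta> (?T i) (?T j)) {..<k} = sum_nn_div \<delta> (?T ` {..<k})"
        using fill by (subst sum_nn_div_image) (auto simp: fills_slots_def)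
      show ?case
      proof (rule runs_seq[OF runs_eval_div[where k = k], where ?B2.0 = "k * 50 + 100"], goal_cases)
        case (2 s4)
        then have s4: "snd s4 1 0 = sum_nn_div \<delta> (?T ` {..<k})" and sm4: "same {31, 32, 33} {1, 2} s3 s4"
          unfolding sd by blast+
        have fr4: "fst s4 30 = fst s 30" "fst s4 3 = fst s 3" "snd s4 3 = snd s 3" "fst s4 29 = ?T" "fst s4 5 = fst s 5"
          using s1(1) sm2 sm3 sm4 by (simp_all add: same_def)
        show ?case
        proof (rule runs_conseq[OF runs_record_best[where k = k]], goal_cases)
          case (2 s5)
          show ?case
          proof (cases "fst s 30 0 = 0 \<or> snd s 3 0 < sum_nn_div \<delta> (?T ` {..<k})")
            case True
            with 2 have s5: "fst s5 30 0 = 1" "snd s5 3 0 = sum_nn_div \<delta> (?T ` {..<k})" "\<forall>q<k. fst s5 3 q = ?T q"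
              unfolding fr4 s4 by (auto simp: fr4)
            have im: "fst s5 3 ` {..<k} = ?T ` {..<k}" using s5(3) by auto
            have "fills_slots s k c (fst s5 3)"
              using fill s5(3) by (auto simp: fills_slots_def inj_on_def)
            then have "best_so_far s k c s5" using s5 im by (simp add: best_so_far_def)
            moreover have "tried s k c ?Z s5" unfolding tried_def using s5 fill far by auto
            moreover have "tried s k c Z s5" if "tried s k c Z s" for Z
              using that True s5 unfolding tried_def by fastforce
            ultimately show ?thesis by blast
          next
            case False
            with 2 have s5: "fst s5 30 0 = fst s 30 0" "fst s5 3 = fst s 3" "snd s5 3 0 = snd s 3 0"
              unfolding fr4 s4 by (auto simp: fr4)
            have "best_so_far s k c s5" using best s5 by (simp add: best_so_far_def)
            moreover have "tried s k c ?Z s5" unfolding tried_def using s5 fill far False by auto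
            moreover have "tried s k c Z s5" if "tried s k c Z s" for Z
              using that s5 unfolding tried_def by simp
            ultimately show ?thesis by blast
          qed
        qed (use fr4 R' in auto)
      next
        case 1
        show ?case using sm3 fr2 R' by (simp add: same_def)
      qed simp
    next
      case (6 j)
      then show ?case using R' by (simp add: k2 fr2 cols)
    qed (use R' s1(2) in \<open>auto simp: k2 fr2\<close>)
  next
    case (3 v)
    then show ?case using R' code s1(1) by (auto simp: same_def)
  qed (use R' s1 N1 in \<open>auto simp: same_def k1\<close>)
qed (simp add: candidate_time_def)

text \<open>The codes below \<open>2 ^ (2 * k)\<close> run through all sets of centre positions. The
  offset in array 28 advances by \<open>2 * k\<close> per colour, which avoids a
  multiplication.\<close>

lemma runs_search:
  assumes R: "search_ready m k c s0" and z: "fst s0 30 0 = 0"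
  shows "runs \<delta> search s0 (m * (2 ^ (2 * k) * (candidate_time k (fst s0 20 0) + 20) + 60) + 50)
    (\<lambda>s. best_so_far s0 k c s \<and>
      (\<forall>l<m. \<forall>v<(2::nat) ^ (2 * k). tried s0 k c ((\<lambda>j. fst s0 16 (2 * k * l + j)) ` {j. j < 2 * k \<and> odd (v div 2 ^ j)}) s))"
  (is "runs _ _ _ _ (\<lambda>s. _ \<and> (\<forall>l<m. \<forall>v<_. tried s0 k c (?Z l v) s))")
  unfolding search_def
proof (rule runs_seq[where ?B1.0 = 10 and ?B2.0 = "m * (2 ^ (2 * k) * (candidate_time k (fst s0 20 0) + 20) + 60) + 30"
   and ?Q1.0 = "\<lambda>s. s = setn s0 28 0"], goal_cases)
  case 1
  show ?case by (intro runs_loop_free) (simp_all add: setn_def)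
next
  case (2 s1)
  have mods: "insert 21 (nmods (PSeq (PFor 24 (V 25) candidate) (VSet 28 (NAdd (V 28) (V 35))))) \<subseteq> search_mods"
    "insert 24 (nmods candidate) \<subseteq> search_mods"
    by (auto simp: mods_candidate search_mods_def)
  note R' = R[unfolded search_ready_def]
  have same1: "same search_mods UNIV s0 s1" using 2 by (simp add: same_def search_mods_def)
  show ?case
  proof (rule runs_for[where N = m and B = "2 ^ (2 * k) * (candidate_time k (fst s0 20 0) + 20) + 40" and
     I = "\<lambda>l s. fst s 28 0 = 2 * k * l \<and> best_so_far s0 k c s \<and> (\<forall>l'<l. \<forall>v<(2::nat) ^ (2 * k). tried s0 k c (?Z l' v) s)"],
     goal_cases)
    case 1
    show ?case using 2 z by (simp add: best_so_far_def)
  next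
    case (2 l s)
    have sames: "same search_mods UNIV s0 s"
      using same_trans[OF same1 same_mono[OF 2(4) mods(1)]] by simp
    show ?case
    proof (rule runs_seq[where ?B1.0 = "2 ^ (2 * k) * (candidate_time k (fst s0 20 0) + 20) + 20" and ?B2.0 = 20 and
      ?Q1.0 = "\<lambda>s'. same search_mods UNIV s0 s' \<and> fst s' 28 0 = 2 * k * l \<and>
         best_so_far s0 k c s' \<and> (\<forall>l'<Suc l. \<forall>v<(2::nat) ^ (2 * k). tried s0 k c (?Z l' v) s')"], goal_cases)
      case 1
      show ?case
      proof (rule runs_for[where N = "2 ^ (2 * k)" and B = "candidate_time k (fst s0 20 0)" and
         I = "\<lambda>i s. fst s 28 0 = 2 * k * l \<and> best_so_far s0 k c s \<and>
            (\<forall>l'<l. \<forall>v<(2::nat) ^ (2 * k). tried s0 k c (?Z l' v) s) \<and> (\<forall>v<i. tried s0 k c (?Z l v) s)"], goal_cases)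
        case 1
        show ?case using 2 by (simp add: best_so_far_def tried_def)
      next
        case (2 i s')
        have sames': "same search_mods UNIV s0 s'"
          using same_trans[OF sames same_mono[OF 2(4) mods(2)]] by simp
        note cong = search_ready_cong[OF sames']
        have R2: "search_ready m k c s'" using R cong by simp
        have b: "best_so_far s' k c = best_so_far s0 k c" "tried s' k c = tried s0 k c"
          by (simp_all add: best_so_far_def tried_def cong fun_eq_iff)
        have N: "fst s' 20 0 = fst s0 20 0" using sames' by (simp add: same_def search_mods_def)
        have Zc: "coded_subset s' (2 * k) = ?Z l i"
          using 2 sames' by (simp add: coded_subset_def same_def search_mods_def)
        have "runs \<delta> candidate s' (candidate_time k (fst s' 20 0)) (\<lambda>s''.
           (best_so_far s' k c s'' \<and> tried s' k c (coded_subset s' (2 * k)) s'' \<and> (\<forall>Z. tried s' k c Z s' \<longrightarrow> tried s' k c Z s'')) \<and>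
           same (nmods candidate) (rmods candidate) s' s'')"
          using 2 R2 \<open>l < m\<close> by (intro runs_frame runs_candidate[where m = m and l = l]) (simp_all add: b)
        then show ?case
        proof (rule runs_conseq, goal_cases)
          case (1 s'')
          have "best_so_far s0 k c (setn s'' 24 (Suc i)) = best_so_far s0 k c s''"
            "tried s0 k c Z (setn s'' 24 (Suc i)) = tried s0 k c Z s''" for Z
            by (simp_all add: best_so_far_def tried_def)
          moreover have "fst s'' 28 = fst s' 28" using 1 by (simp add: same_def mods_candidate)
          ultimately show ?case using 1 2 unfolding b Zc
            by (auto simp: less_Suc_eq)
        qed (simp add: N)
      next
        case (3 s')
        have "same search_mods UNIV s s'" using 3 by (rule same_mono) (use mods(2) in auto)
        then show ?case using R' sames by (simp add: same_def search_mods_def)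
      next
        case (5 s')
        have "same search_mods UNIV s s'" using 5(2) by (rule same_mono) (use mods(2) in auto)
        then show ?case using 5 same_trans[OF sames] by (auto simp: less_Suc_eq)
      qed (simp_all add: mods_candidate algebra_simps)
    next
      case (2 s')
      have "fst s' 35 0 = 2 * k" using 2 R' by (simp add: same_def search_mods_def)
      then show ?case using 2
        by (intro runs_loop_free) (simp_all add: best_so_far_def tried_def)
    qed simp
  next
    case (3 s)
    have "same search_mods UNIV s1 s" using 3 by (rule same_mono) (use mods(1) in auto)
    then show ?case using R' same1 by (simp add: same_def search_mods_def)
  qed (use mods in \<open>auto simp: mods_candidate algebra_simps\<close>)
qed simp

end

section \<open>The complete program\<close>

text \<open>For \<open>k \<ge> 4\<close> by monotonicity in the base; the factor 4 is attained at
  \<open>k = 1\<close> and \<open>k = 2\<close>.\<close>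

lemma four_power_le: "0 < k \<Longrightarrow> 2 ^ (2 * k) \<le> 4 * k ^ (k :: nat)"
proof (cases "k \<ge> 4")
  case True
  then have "4 ^ k \<le> k ^ k" by (intro power_mono) auto
  then show ?thesis by (simp add: power_mult)
next
  case False
  moreover assume "0 < k"
  ultimately have "k \<in> {1, 2, 3}" by auto
  then show ?thesis by (auto simp: power_mult power_def numeral_eq_Suc)
qed

definition fair_div_prog :: prog where
  "fair_div_prog = PSeq fill_slots (PSeq copy_input (PSeq halving_table (PSeq coreset_phase search)))"

context index_metric
begin

section \<open>Arithmetic of the running time\<close>

lemma candidate_time_le:
  assumes "N \<le> 4 * w ^ 3" "k \<le> w" "0 < w"
  shows "candidate_time k N \<le> 2760 * w ^ 4"
proof -
  have "candidate_time k N = 50 * N + 410 * (k * N) + 570 * k + 100 * (k * k) + 250"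
    by (simp add: candidate_time_def algebra_simps)
  moreover have "w ^ 3 \<le> w ^ 4" "w \<le> w ^ 4" "w * w \<le> w ^ 4" "1 \<le> w ^ 4"
    using assms(3) power_increasing[of 3 4 w] power_increasing[of 1 4 w] power_increasing[of 2 4 w]
    by (auto simp: power2_eq_square)
  moreover have "k * N \<le> w * (4 * w ^ 3)" using assms by (intro mult_le_mono) auto
  then have "k * N \<le> 4 * w ^ 4" by (simp add: numeral_eq_Suc algebra_simps)
  moreover have "k * k \<le> w * w" using assms by (intro mult_le_mono) auto
  ultimately show ?thesis using assms by linarith
qed

text \<open>With \<open>w = m + k\<close>, the coreset has \<open>O(w ^ 3)\<close> points and a
  candidate costs \<open>O(w ^ 4)\<close>; there are \<open>m * 4 ^ k\<close> candidates, whence the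
  exponent 5. The terms with \<open>n\<close> have degree at most 2 in \<open>w\<close>. The
  constant 20000 is rounded up.\<close>

lemma total_time_le:
  assumes m: "0 < m" "m \<le> k" and N: "N \<le> m * (2 * k + 2 * k * k)"
  shows "(m * (40 * k + 50) + 20) + ((n * 40 + 20) + ((2 ^ (2 * k) * 100 + 100 * k + 100) +
      ((m * (2 * k * (330 * n + 200) + 150 * n + 100) + 20) +
       (m * (2 ^ (2 * k) * (candidate_time k N + 20) + 60) + 50)))) \<le> 20000 * (n + k ^ k) * (m + k) ^ 5"
proof -
  define w where "w = m + k"
  define X where "X = n + k ^ k"
  have w: "m \<le> w" "k \<le> w" "1 \<le> w" and k: "0 < k" using m by (auto simp: w_def)
  have X: "n \<le> X" "1 \<le> X" "2 ^ (2 * k) \<le> 4 * X"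
    using four_power_le[OF k] k by (auto simp: X_def Suc_le_eq)
  have pow: "w ^ i \<le> w ^ 5" if "i \<le> 5" for i using w that by (intro power_increasing) auto
  have "m * (2 * k + 2 * k * k) \<le> w * (2 * w + 2 * w * w)"
    using w by (intro mult_le_mono add_mono) auto
  also have "\<dots> = 2 * w ^ 2 + 2 * w ^ 3" by (simp add: numeral_eq_Suc algebra_simps)
  also have "\<dots> \<le> 4 * w ^ 3" using power_increasing[of 2 3 w] w by simp
  finally have N4: "N \<le> 4 * w ^ 3" using N by simp
  have "1 \<le> w ^ 4" using w by simp
  then have "candidate_time k N + 20 \<le> 2780 * w ^ 4"
    using candidate_time_le[OF N4 w(2)] w by linarith
  then have "m * (2 ^ (2 * k) * (candidate_time k N + 20)) \<le> w * (4 * X * (2780 * w ^ 4))"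
    using w X by (intro mult_le_mono) auto
  moreover have "w ^ 5 = w * w ^ 4" by (simp add: eval_nat_numeral)
  ultimately have big: "m * (2 ^ (2 * k) * (candidate_time k N + 20)) \<le> 11120 * (X * w ^ 5)"
    by (simp add: mult.left_commute)
  have P: "a \<le> X * w ^ 5" if "a \<le> x * w ^ i" "x \<le> X" "i \<le> 5" for a x i
    using that mult_le_mono[OF that(2) pow[OF that(3)]] by linarith
  have "m * k \<le> w ^ 2" using w by (simp add: power2_eq_square mult_le_mono)
  then have 1: "m * k \<le> X * w ^ 5" using X by (intro P[of _ 1 2]) auto
  have 2: "m \<le> X * w ^ 5" "k \<le> X * w ^ 5" using X w by (intro P[of _ 1 1]; simp)+
  have 3: "n \<le> X * w ^ 5" "1 \<le> X * w ^ 5" using P[of n n 0] P[of 1 1 0] X by auto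
  have "m * n \<le> n * w ^ 1" using w by (simp add: mult.commute)
  then have 4: "m * n \<le> X * w ^ 5" using X by (intro P[of _ n 1]) auto
  have "m * k * n \<le> w * w * n" using w by (intro mult_le_mono) auto
  then have 5: "m * k * n \<le> X * w ^ 5" using X by (intro P[of _ n 2]) (auto simp: power2_eq_square mult.commute)
  have 6: "2 ^ (2 * k) \<le> 4 * (X * w ^ 5)"
  proof -
    have "X \<le> X * w ^ 5" by (rule P[of X X 0]) auto
    with X(3) show ?thesis by linarith
  qed
  have "(m * (40 * k + 50) + 20) + ((n * 40 + 20) + ((2 ^ (2 * k) * 100 + 100 * k + 100) +
      ((m * (2 * k * (330 * n + 200) + 150 * n + 100) + 20) +
       (m * (2 ^ (2 * k) * (candidate_time k N + 20) + 60) + 50)))) =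
     440 * (m * k) + 210 * m + 210 + 40 * n + 100 * 2 ^ (2 * k) + 100 * k + 660 * (m * k * n) + 150 * (m * n) +
     m * (2 ^ (2 * k) * (candidate_time k N + 20))"
    by (simp add: algebra_simps)
  also have "\<dots> \<le> 20000 * (X * w ^ 5)"
    using 1 2 3 4 5 6 big by linarith
  finally show ?thesis unfolding X_def w_def by (simp only: mult.assoc)
qed

lemma runs_fair_div_prog:
  assumes c: "\<And>i. i < n \<Longrightarrow> c i < m" and m: "0 < m"
    and \<kappa>: "\<And>l. l < m \<Longrightarrow> 0 < \<kappa> l \<and> \<kappa> l \<le> card {q \<in> {..<n}. c q = l}"
    and k: "k = (\<Sum>l<m. \<kappa> l)"
  shows "runs \<delta> fair_div_prog (input_store n m \<kappa> c) (20000 * (n + k ^ k) * (m + k) ^ 5)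
    (\<lambda>s. let T = fst s 3 ` {..<k} in inj_on (fst s 3) {..<k} \<and> T \<subseteq> {..<n} \<and>
       (\<forall>q<k. c (fst s 3 q) = fst s 4 q \<and> fst s 4 q < m) \<and>
       (\<forall>l<m. card {q. q < k \<and> fst s 4 q = l} = \<kappa> l) \<and>
       (\<forall>Opt\<subseteq>{..<n}. 2 \<le> k \<longrightarrow> (\<forall>l<m. card {q \<in> Opt. c q = l} = \<kappa> l) \<longrightarrow>
          sum_nn_div \<delta> Opt \<le> 96 * real m * ln (real k) * sum_nn_div \<delta> T))"
  (is "runs _ _ ?s0 _ ?Q")
proof -
  have inp: "fst ?s0 0 0 = n" "fst ?s0 0 (Suc 0) = m" "\<And>l. l < m \<Longrightarrow> fst ?s0 1 l = \<kappa> l"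
    "\<And>i. i < n \<Longrightarrow> fst ?s0 2 i = c i" "\<And>a. 3 \<le> a \<Longrightarrow> fst ?s0 a = (\<lambda>_. 0)"
    by (auto simp: input_store_def fun_eq_iff)
  have mk: "m \<le> k"
  proof -
    have "(\<Sum>l<m. 1) \<le> (\<Sum>l<m. \<kappa> l)" by (rule sum_mono) (use \<kappa> in \<open>simp add: Suc_le_eq\<close>)
    then show ?thesis by (simp add: k)
  qed
  have k0: "0 < k" using mk m by simp
  have \<kappa>k: "\<kappa> l \<le> k" if "l < m" for l unfolding k by (rule member_le_sum) (use that in auto)
  have ne: "\<exists>x<n. c x = l" if "l < m" for l
  proof -
    have "0 < card {q \<in> {..<n}. c q = l}" using \<kappa>[OF that] by linarith
    then show ?thesis by (auto simp: card_gt_0_iff)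
  qed
  let ?N = "m * (2 * k + 2 * k * k)"
  have "runs \<delta> fair_div_prog ?s0 ((m * (40 * k + 50) + 20) + ((n * 40 + 20) + ((2 ^ (2 * k) * 100 + 100 * k + 100) +
      ((m * (2 * k * (330 * n + 200) + 150 * n + 100) + 20) +
       (m * (2 ^ (2 * k) * (candidate_time k ?N + 20) + 60) + 50))))) ?Q"
    unfolding fair_div_prog_def
  proof (rule runs_seq[OF runs_fill_slots[OF inp(2) _ k] _ order_refl], goal_cases)
    case (3 s1)
    then have slots: "slot_inv (\<lambda>j. if j < m then \<kappa> j else 0) k s1" and sm1: "same {4, 5, 21, 22} {} ?s0 s1"
      by blast+
    show ?case
    proof (rule runs_seq[OF runs_copy_input _ order_refl], goal_cases)
      case 1
      show ?case using sm1 inp by (simp add: same_def)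
    next
      case (2 s2)
      then have s2: "\<forall>i<n. fst s2 6 i = i \<and> fst s2 7 i = c i" and sm2: "same {6, 7, 21} {} s1 s2"
        using sm1 inp by (auto simp: same_def)
      show ?case
      proof (rule runs_seq[OF runs_halving_table _ order_refl], goal_cases)
        case 1
        show ?case using sm2 slots by (simp add: same_def slot_inv_def)
      next
        case (2 s3)
        then have s3: "fst s3 35 0 = 2 * k" "fst s3 25 0 = 2 ^ (2 * k)" "\<forall>v<2 ^ (2 * k). fst s3 26 v = v div 2"
          and sm3: "same {22, 24, 25, 26, 35} {} s2 s3" by blast+
        show ?case
        proof (rule runs_seq[OF runs_coreset_phase[where c = c] _ order_refl], goal_cases)
          case (14 s4)
          then have C: "coreset_inv c k m s4" and
            sm4: "same {9, 10, 11, 12, 13, 14, 15, 16, 17, 18, 19, 20, 21, 22, 23, 36} {0} s3 s4"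
            unfolding mods_coreset_phase by blast+
          have fr: "fst s4 0 = fst ?s0 0" "fst s4 2 = fst ?s0 2" "fst s4 4 = fst s1 4" "fst s4 5 = fst s1 5"
            "fst s4 35 = fst s3 35" "fst s4 25 = fst s3 25" "fst s4 26 = fst s3 26" "fst s4 30 = fst ?s0 30"
            using sm1 sm2 sm3 sm4 by (simp_all add: same_def)
          have cnt: "card {q. q < k \<and> fst s4 4 q = j} = (if j < m then \<kappa> j else 0)" for j
            using slots fr by (simp add: slot_inv_def)
          have slot: "fst s4 4 q < m" if "q < k" for q
          proof (rule ccontr)
            assume "\<not> fst s4 4 q < m"
            then have "card {q'. q' < k \<and> fst s4 4 q' = fst s4 4 q} = 0" using cnt by simp
            then show False using that by auto
          qed
          have cs: "coreset k {q \<in> {..<n}. c q = j} (centers s4 k j) (kept s4)" if "j < m" for j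
            using C that unfolding coreset_inv_def by blast
          have keptn: "kept s4 \<subseteq> {..<n}" using C unfolding coreset_inv_def by blast
          have "card {q. q < k \<and> fst s4 4 q = j} \<le> card {x \<in> kept s4. c x = j}" if "j < m" for j
          proof -
            have "\<kappa> j \<le> card (kept s4 \<inter> {q \<in> {..<n}. c q = j})"
              using \<kappa>[OF that] \<kappa>k[OF that] by (intro coreset_card[OF cs[OF that]]) auto
            also have "kept s4 \<inter> {q \<in> {..<n}. c q = j} = {x \<in> kept s4. c x = j}" using keptn by auto
            finally show ?thesis using cnt that by simp
          qed
          moreover have "centers s4 k l \<subseteq> kept s4" if "l < m" for l
            using cs[OF that] by (simp add: coreset_def)
          ultimately have R: "search_ready m k c s4"
            using inp fr slots s3 slot keptn c unfolding search_ready_def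
            by (auto simp: slot_inv_def)
          have "fst s4 20 0 \<le> ?N" using C by (simp add: coreset_inv_def)
          then have time: "candidate_time k (fst s4 20 0) \<le> candidate_time k ?N"
            unfolding candidate_time_def by (intro add_mono mult_le_mono) auto
          show ?case
          proof (rule runs_conseq[OF runs_frame[OF runs_search[OF R]]], goal_cases)
            case (2 s5)
            have best: "best_so_far s4 k c s5" and tried: "\<And>l v. l < m \<Longrightarrow> v < (2 :: nat) ^ (2 * k) \<Longrightarrow>
               tried s4 k c ((\<lambda>j. fst s4 16 (2 * k * l + j)) ` {j. j < 2 * k \<and> odd (v div 2 ^ j)}) s5"
              and sm5: "same (nmods search) (rmods search) s4 s5"
              by (fact 2[THEN conjunct1, THEN conjunct1] 2[THEN conjunct1, THEN conjunct2, rule_format] 2[THEN conjunct2])+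
            have fr5: "fst s5 4 = fst s4 4" using sm5 by (simp add: same_def search_def mods_candidate)
            \<comment> \<open>Code 0 of colour 0 has been tried, so some selection has been
              recorded.\<close>
            have "fst s5 30 0 \<noteq> 0" using tried[OF m, of 0] by (simp add: tried_def)
            then have fill: "fills_slots s4 k c (fst s5 3)"
              and val: "snd s5 3 0 = sum_nn_div \<delta> (fst s5 3 ` {..<k})"
              using best by (auto simp: best_so_far_def)
            have opt: "sum_nn_div \<delta> Opt \<le> 96 * real m * ln (real k) * sum_nn_div \<delta> (fst s5 3 ` {..<k})"
              if O: "Opt \<subseteq> {..<n}" "2 \<le> k" "\<forall>l<m. card {q \<in> Opt. c q = l} = \<kappa> l" for Opt
            proof -
              have "finite Opt" using O(1) finite_subset by blast
              then have "card Opt = (\<Sum>j<m. card {q \<in> Opt. c q = j})"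
                unfolding card_eq_sum using c O(1) by (intro sum.group[symmetric]) auto
              then have cO: "card Opt = k" using O(3) k by simp
              obtain l Z where l: "l < m" and Z: "Z \<subseteq> centers s4 k l" and
                approx: "\<forall>T\<subseteq>kept s4. (\<forall>j<m. card {t \<in> T. c t = j} = \<kappa> j) \<longrightarrow> far_selection c (kept s4) Z T \<longrightarrow>
                   sum_nn_div \<delta> Opt \<le> 96 * real m * ln (real k) * sum_nn_div \<delta> T"
                by (rule far_selection_approx[where P = "{..<n}" and col = c and \<kappa> = \<kappa> and m = m,
                    OF _ _ keptn cs _ O(1) _ cO O(2) m]) (use c O(3) in auto)
              \<comment> \<open>All positions that hold a member of \<open>Z\<close>; the number
                with binary digits \<open>J\<close> is a code at which exactly \<open>Z\<close> was
                tried.\<close>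
              define J where "J = {j. j < 2 * k \<and> fst s4 16 (2 * k * l + j) \<in> Z}"
              have J: "finite J" "J \<subseteq> {..<2 * k}" by (auto simp: J_def)
              have "set_encode J \<le> (\<Sum>j<2 * k. 2 ^ j)"
                unfolding set_encode_def using J(2) by (intro sum_mono2) auto
              also have "\<dots> < 2 ^ (2 * k)" unfolding lessThan_def mask_eq_sum_exp_nat[symmetric] by simp
              finally have v: "set_encode J < 2 ^ (2 * k)" .
              have "{j. j < 2 * k \<and> odd (set_encode J div 2 ^ j)} = J"
                using set_encode_inverse[OF J(1)] J(2) unfolding set_decode_def by auto
              moreover have "(\<lambda>j. fst s4 16 (2 * k * l + j)) ` J = Z"
                using Z by (auto simp: J_def centers_def)
              ultimately have "tried s4 k c Z s5" using tried[OF l v] by simp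
              then obtain T where T: "fills_slots s4 k c T" "far_selection c (kept s4) Z (T ` {..<k})"
                "sum_nn_div \<delta> (T ` {..<k}) \<le> snd s5 3 0" unfolding tried_def by blast
              have "card {t \<in> T ` {..<k}. c t = j} = \<kappa> j" if "j < m" for j
              proof -
                have "{t \<in> T ` {..<k}. c t = j} = T ` {q. q < k \<and> fst s4 4 q = j}"
                  using T(1) by (auto simp: fills_slots_def)
                moreover have "inj_on T {q. q < k \<and> fst s4 4 q = j}"
                  using T(1) by (auto simp: fills_slots_def inj_on_def)
                ultimately show ?thesis using cnt that by (simp add: card_image)
              qed
              moreover have "T ` {..<k} \<subseteq> kept s4" using T(1) by (auto simp: fills_slots_def)
              ultimately have "sum_nn_div \<delta> Opt \<le> 96 * real m * ln (real k) * sum_nn_div \<delta> (T ` {..<k})"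
                using approx T(2) by blast
              also have "\<dots> \<le> 96 * real m * ln (real k) * snd s5 3 0"
                using T(3) O(2) by (intro mult_left_mono) auto
              finally show ?thesis by (simp add: val)
            qed
            have "inj_on (fst s5 3) {..<k}" "fst s5 3 ` {..<k} \<subseteq> {..<n}"
              "\<forall>q<k. c (fst s5 3 q) = fst s5 4 q"
              using fill keptn unfolding fr5 fills_slots_def by auto
            then show ?case unfolding Let_def
              using slot cnt opt by (simp add: fr5)
          qed (use inp fr time in simp_all)
        qed (use sm1 sm2 sm3 s2 s3 inp slots k0 ne in \<open>auto simp: same_def slot_inv_def card_gt_0_iff\<close>)
      qed
    qed
  qed (use inp in simp_all)
  then show ?thesis
    by (rule runs_conseq) (use total_time_le[OF m mk order_refl] in simp_all)
qed

end

section \<open>From indices back to points of the metric space\<close>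

lemma sum_nn_div_cong:
  assumes "\<And>i j. i \<in> S \<Longrightarrow> j \<in> S \<Longrightarrow> d i j = d' i j"
  shows "sum_nn_div d S = sum_nn_div d' S"
proof -
  have "(\<lambda>q. d p q) ` (S - {p}) = (\<lambda>q. d' p q) ` (S - {p})" if "p \<in> S" for p
    using assms that by (intro image_cong) auto
  then show ?thesis unfolding sum_nn_div_def by (intro sum.cong) auto
qed

lemma fair_div_prog_approx:
  "fair_div_approx_alg TYPE('a) fair_div_prog 96 20000 5"
  unfolding fair_div_approx_alg_def
proof (intro allI impI)
  fix X :: "'a set" and d m P \<kappa> n x c k
  assume inst: "fair_instance X d m P \<kappa>" and pres: "presents m P n x c"
    and k: "k = (\<Sum>l<m. \<kappa> l)"
  from inst interpret Metric_space X d by (simp add: fair_instance_def)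
  have col: "\<And>i. i < n \<Longrightarrow> c i < m \<and> x i \<in> P (c i)"
    and inj: "inj_on x {..<n}" and img: "x ` {..<n} = (\<Union>l<m. P l)"
    using pres by (auto simp: presents_def bij_betw_def)
  have sub: "\<And>l. l < m \<Longrightarrow> P l \<subseteq> X" and m: "0 < m" and disj: "disjoint_family_on P {..<m}"
    and \<kappa>: "\<And>l. l < m \<Longrightarrow> 0 < \<kappa> l \<and> \<kappa> l \<le> card (P l)"
    using inst by (auto simp: fair_instance_def)
  have inX: "x i \<in> X" if "i < n" for i using col[OF that] sub by blast
  have colP: "x i \<in> P l \<longleftrightarrow> c i = l" if "i < n" "l < m" for i l
    using col[OF that(1)] disj that(2) unfolding disjoint_family_on_def by blast
  have cardx: "card (x ` S) = card S" if "S \<subseteq> {..<n}" for S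
    using inj that by (meson card_image inj_on_subset)
  have imgP: "x ` {q \<in> {..<n}. c q = l} = P l" if "l < m" for l
  proof -
    have "P l \<subseteq> x ` {..<n}" using img that by blast
    then show ?thesis using colP that by blast
  qed
  let ?\<delta> = "dist_oracle d n x"
  have "Metric_space {..<n} ?\<delta>"
  proof
    fix i j l
    show "0 \<le> ?\<delta> i j" "?\<delta> i j = ?\<delta> j i" by (auto simp: dist_oracle_def commute)
    show "?\<delta> i j = 0 \<longleftrightarrow> i = j" if "i \<in> {..<n}" "j \<in> {..<n}"
      using that inX inj by (auto simp: dist_oracle_def inj_on_def)
    show "?\<delta> i l \<le> ?\<delta> i j + ?\<delta> j l" if "i \<in> {..<n}" "j \<in> {..<n}" "l \<in> {..<n}"
      using that inX by (simp add: dist_oracle_def triangle)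
  qed
  then interpret idx: index_metric n ?\<delta> by (simp add: index_metric_def)
  have div_img: "sum_nn_div d (x ` S) = sum_nn_div ?\<delta> S" if "S \<subseteq> {..<n}" for S
  proof -
    have "sum_nn_div d (x ` S) = sum_nn_div (\<lambda>i j. d (x i) (x j)) S"
      by (rule sum_nn_div_image) (use inj that inj_on_subset in blast)
    also have "\<dots> = sum_nn_div ?\<delta> S"
      by (rule sum_nn_div_cong) (use that in \<open>auto simp: dist_oracle_def\<close>)
    finally show ?thesis .
  qed
  have "runs ?\<delta> fair_div_prog (input_store n m \<kappa> c) (20000 * (n + k ^ k) * (m + k) ^ 5)
    (\<lambda>s. let T = fst s 3 ` {..<k} in inj_on (fst s 3) {..<k} \<and> T \<subseteq> {..<n} \<and>
       (\<forall>q<k. c (fst s 3 q) = fst s 4 q \<and> fst s 4 q < m) \<and>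
       (\<forall>l<m. card {q. q < k \<and> fst s 4 q = l} = \<kappa> l) \<and>
       (\<forall>Opt\<subseteq>{..<n}. 2 \<le> k \<longrightarrow> (\<forall>l<m. card {q \<in> Opt. c q = l} = \<kappa> l) \<longrightarrow>
          sum_nn_div ?\<delta> Opt \<le> 96 * real m * ln (real k) * sum_nn_div ?\<delta> T))"
  proof (rule idx.runs_fair_div_prog[OF _ m _ k])
    show "0 < \<kappa> l \<and> \<kappa> l \<le> card {q \<in> {..<n}. c q = l}" if "l < m" for l
    proof -
      have "{q \<in> {..<n}. c q = l} \<subseteq> {..<n}" by auto
      from cardx[OF this] show ?thesis using \<kappa>[OF that] imgP[OF that] by simp
    qed
  qed (use col in auto)
  then obtain t s where exec: "exec ?\<delta> fair_div_prog (input_store n m \<kappa> c) t s"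
      "t \<le> 20000 * (n + k ^ k) * (m + k) ^ 5"
    and injT: "inj_on (fst s 3) {..<k}" and Tn: "fst s 3 ` {..<k} \<subseteq> {..<n}"
    and slot: "\<And>q. q < k \<Longrightarrow> c (fst s 3 q) = fst s 4 q \<and> fst s 4 q < m"
    and cnt: "\<And>l. l < m \<Longrightarrow> card {q. q < k \<and> fst s 4 q = l} = \<kappa> l"
    and opt: "\<And>Opt. Opt \<subseteq> {..<n} \<Longrightarrow> 2 \<le> k \<Longrightarrow> \<forall>l<m. card {q \<in> Opt. c q = l} = \<kappa> l \<Longrightarrow>
          sum_nn_div ?\<delta> Opt \<le> 96 * real m * ln (real k) * sum_nn_div ?\<delta> (fst s 3 ` {..<k})"
    unfolding runs_def Let_def by auto
  let ?T = "output_sel k n x s"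
  have out: "?T l = x ` fst s 3 ` {q. q < k \<and> fst s 4 q = l}" for l
    using Tn by (auto simp: output_sel_def)
  have un: "(\<Union>l<m. ?T l) = x ` fst s 3 ` {..<k}"
    using slot unfolding out by auto
  have sel: "fair_selection m P \<kappa> ?T"
    unfolding fair_selection_def
  proof (intro allI impI conjI)
    fix l assume l: "l < m"
    show "?T l \<subseteq> P l" unfolding out using slot Tn colP l by auto
    have "card (?T l) = card (fst s 3 ` {q. q < k \<and> fst s 4 q = l})"
      unfolding out by (rule cardx) (use Tn in auto)
    also have "\<dots> = card {q. q < k \<and> fst s 4 q = l}"
      by (rule card_image) (use injT in \<open>auto simp: inj_on_def\<close>)
    finally show "card (?T l) = \<kappa> l" using cnt[OF l] by simp
  qed
  have "1 / (96 * real m * ln (real k)) * fair_div_opt d m P \<kappa> \<le> sum_nn_div d (\<Union>l<m. ?T l)"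
  proof (cases "2 \<le> k")
    case False
    \<comment> \<open>Here the logarithm is 0 and division by zero yields 0, so the claim reduces to
      nonnegativity of the diversity.\<close>
    then have "ln (real k) = 0" by (cases "k = 0") (auto simp: not_le less_2_cases_iff)
    moreover have "0 \<le> sum_nn_div d (\<Union>l<m. ?T l)" unfolding un by (intro sum_nn_div_nonneg) auto
    ultimately show ?thesis by simp
  next
    case True
    let ?V = "{sum_nn_div d (\<Union>l<m. T l) | T. fair_selection m P \<kappa> T}"
    \<comment> \<open>Selections are subsets of a finite set, so the optimum is attained by one of
      them.\<close>
    have "?V \<subseteq> sum_nn_div d ` Pow (x ` {..<n})"
      unfolding img by (auto simp: fair_selection_def)
    then have "finite ?V" by (rule finite_subset) auto
    moreover have "?V \<noteq> {}" using sel by blast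
    ultimately have "fair_div_opt d m P \<kappa> \<in> ?V" unfolding fair_div_opt_def by (rule Max_in)
    then obtain T where T: "fair_selection m P \<kappa> T" "fair_div_opt d m P \<kappa> = sum_nn_div d (\<Union>l<m. T l)"
      by blast
    define Opt where "Opt = {i. i < n \<and> x i \<in> (\<Union>l<m. T l)}"
    have On: "Opt \<subseteq> {..<n}" by (auto simp: Opt_def)
    have TP: "T l \<subseteq> P l" "card (T l) = \<kappa> l" if "l < m" for l using T(1) that by (auto simp: fair_selection_def)
    have "(\<Union>l<m. T l) \<subseteq> x ` {..<n}" unfolding img using TP by blast
    then have xO: "x ` Opt = (\<Union>l<m. T l)" unfolding Opt_def by blast
    have "card {q \<in> Opt. c q = l} = \<kappa> l" if l: "l < m" for l
    proof -
      have "x ` {q \<in> Opt. c q = l} = T l"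
      proof
        show "x ` {q \<in> Opt. c q = l} \<subseteq> T l"
        proof
          fix y assume "y \<in> x ` {q \<in> Opt. c q = l}"
          then obtain q l' where q: "y = x q" "q < n" "c q = l" "l' < m" "x q \<in> T l'" by (auto simp: Opt_def)
          then have "c q = l'" using TP(1) colP by blast
          then show "y \<in> T l" using q by simp
        qed
        show "T l \<subseteq> x ` {q \<in> Opt. c q = l}"
        proof
          fix y assume y: "y \<in> T l"
          then have "y \<in> P l" using TP(1) l by blast
          then obtain q where "q < n" "c q = l" "y = x q" using imgP[OF l] by auto
          then show "y \<in> x ` {q \<in> Opt. c q = l}" using y l by (auto simp: Opt_def)
        qed
      qed
      moreover have "{q \<in> Opt. c q = l} \<subseteq> {..<n}" using On by auto
      ultimately show ?thesis using TP(2)[OF l] cardx[of "{q \<in> Opt. c q = l}"] by simp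
    qed
    then have "sum_nn_div ?\<delta> Opt \<le> 96 * real m * ln (real k) * sum_nn_div ?\<delta> (fst s 3 ` {..<k})"
      using opt[OF On True] by blast
    then have "fair_div_opt d m P \<kappa> \<le> 96 * real m * ln (real k) * sum_nn_div d (\<Union>l<m. ?T l)"
      unfolding T(2) un div_img[OF Tn] xO[symmetric] div_img[OF On] .
    moreover have "0 < 96 * real m * ln (real k)" using m True by simp
    ultimately show ?thesis by (simp add: divide_le_eq mult.commute)
  qed
  then show "\<exists>t s T. exec ?\<delta> fair_div_prog (input_store n m \<kappa> c) t s \<and>
       t \<le> 20000 * (n + k ^ k) * (m + k) ^ 5 \<and> T = output_sel k n x s \<and> fair_selection m P \<kappa> T \<and>
       1 / (96 * real m * ln (real k)) * fair_div_opt d m P \<kappa> \<le> sum_nn_div d (\<Union>l<m. T l)"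
    using exec sel by blast
qed

theorem theorem3:
  shows "\<exists>p C A e. 0 < C \<and>
    fair_div_approx_alg TYPE(nat) p C A e \<and> fair_div_approx_alg TYPE('a) p C A e"
  using fair_div_prog_approx[where 'a = nat] fair_div_prog_approx[where 'a = 'a]
  by (intro exI[of _ fair_div_prog] exI[of _ 96] exI[of _ 20000] exI[of _ 5]) simp

end
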